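(* Let $d\geq 1$ be an integer. For any graph $G=(V,E)$ with $|V|\geq d+1$, the following are equivalent. (i) $G$ is minimally rigid in the conical space $\mathbb{R}^d\oplus_1\mathbb{R}$. (ii) $G$ is minimally rigid in the cylindrical space $\mathbb{R}^d\oplus_\infty\mathbb{R}$. (iii) $G$ is an edge-disjoint union of spanning subgraphs $H$ and $T$, where $H$ is minimally rigid in $\mathbb{R}^d$ and $T$ is a tree.
   Context: All graphs are finite, simple and undirected. $\mathbb{R}^d$ carries the Euclidean norm. For a normed space $X$ with norm $\|\cdot\|_X$, $X\oplus_\infty\mathbb{R}$ is the direct sum with norm $\max\{\|x\|_X,|y|\}$ (a cylindrical normed space) and $X\oplus_1\mathbb{R}$ is the direct sum with norm $\|x\|_X+|y|$ (a conical normed space). Let $Y$ be a finite dimensional real normed space. A framework in $Y$ is a pair $(G,p)$ with $G=(V,E)$ a graph and $p=(p_v)_{v\in V}\in Y^V$ (a placement of $G$) with $p_v\neq p_w$ for every $vw\in E$. The rigidity map is $f_G:Y^V\to\mathbb{R}^E$, $(x_v)_{v}\mapsto(\|x_v-x_w\|_Y)_{vw\in E}$. The framework is well-positioned if $f_G$ is differentiable at $p$; a well-positioned framework is independent if $df_G(p):Y^V\to\mathbb{R}^E$ is surjective. A rigid motion of $Y$ is a family of continuous paths $\alpha_x:[-1,1]\to Y$ ($x\in Y$) such that $\alpha_x(0)=x$, $\alpha_x$ is differentiable at $0$, and $\|\alpha_x(t)-\alpha_y(t)\|_Y=\|x-y\|_Y$ for all $x,y\in Y$, $t\in[-1,1]$.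 Maps $\eta:Y\to Y$ of the form $\eta(x)=\alpha_x'(0)$ are infinitesimal rigid motions; they form a linear space $\mathcal{T}(Y)$. Put $\mathcal{T}(G,p)=\{(\eta(p_v))_{v\in V}:\eta\in\mathcal{T}(Y)\}\subseteq\ker df_G(p)$. A well-positioned framework $(G,p)$ is infinitesimally rigid if $\ker df_G(p)=\mathcal{T}(G,p)$, and minimally infinitesimally rigid if it is both infinitesimally rigid and independent. A graph $G$ is minimally rigid in $Y$ if there is a well-positioned placement $p\in Y^V$ such that $(G,p)$ is minimally infinitesimally rigid. *)

theory Defs
  imports "HOL-Analysis.Analysis"
begin

text \<open>
  A graph has the finite type \<open>'v\<close> as its vertex set and is given by its set of edges, which are
  two-element sets of vertices.  Subsets of the edge set are thus exactly the spanning subgraphs.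
\<close>

definition simple_graph :: "'v::finite set set \<Rightarrow> bool" where
  "simple_graph E \<longleftrightarrow> (\<forall>e\<in>E. card e = 2)"

definition connected_graph :: "'v::finite set set \<Rightarrow> bool" where
  "connected_graph E \<longleftrightarrow> (\<forall>v w. (v, w) \<in> {(a, b). {a, b} \<in> E}\<^sup>*)"

definition is_cycle :: "'v::finite set set \<Rightarrow> 'v list \<Rightarrow> bool" where
  "is_cycle E vs \<longleftrightarrow> 3 \<le> length vs \<and> distinct vs \<and>
     (\<forall>i < length vs. {vs ! i, vs ! (Suc i mod length vs)} \<in> E)"

definition tree_graph :: "'v::finite set set \<Rightarrow> bool" where
  "tree_graph E \<longleftrightarrow> simple_graph E \<and> connected_graph E \<and> (\<nexists>vs. is_cycle E vs)"

text \<open>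
  A finite dimensional normed space \<open>Y\<close> is represented by a Euclidean space \<open>'a\<close>, which supplies
  the vector space structure, together with the norm \<open>N\<close> of \<open>Y\<close> on it.  The topology of \<open>'a\<close>,
  and hence continuity and (Frechet) derivatives, agree with those induced by \<open>N\<close>, because all
  norms on a finite dimensional space are equivalent; every distance that is measured in
  \<open>Y\<close> is measured by \<open>N\<close>.
\<close>

definition cylindrical_norm :: "'a::real_normed_vector \<times> real \<Rightarrow> real" where
  "cylindrical_norm z = max (norm (fst z)) \<bar>snd z\<bar>"

definition conical_norm :: "'a::real_normed_vector \<times> real \<Rightarrow> real" where
  "conical_norm z = norm (fst z) + \<bar>snd z\<bar>"

lemma cylindrical_norm_equiv:
  "cylindrical_norm z \<le> norm z" "norm z \<le> 2 * cylindrical_norm z"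
  using norm_fst_le[of "fst z" "snd z"] norm_snd_le[of "snd z" "fst z"]
    norm_Pair_le[of "fst z" "snd z"]
  by (auto simp: cylindrical_norm_def)

lemma conical_norm_equiv:
  "conical_norm z \<le> 2 * norm z" "norm z \<le> conical_norm z"
  using norm_fst_le[of "fst z" "snd z"] norm_snd_le[of "snd z" "fst z"]
    norm_Pair_le[of "fst z" "snd z"]
  by (auto simp: conical_norm_def)

text \<open>
  The length of an edge \<open>e = {v, w}\<close> does not depend on the order of its end points, since
  \<open>N\<close> is symmetric.
\<close>

definition edge_length :: "('a::euclidean_space \<Rightarrow> real) \<Rightarrow> 'a ^ 'v::finite \<Rightarrow> 'v set \<Rightarrow> real" where
  "edge_length N x e = (THE r. \<exists>v w. e = {v, w} \<and> r = N (x $ v - x $ w))"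

lemma edge_length_doubleton:
  assumes "\<And>z. N (- z) = N z"
  shows "edge_length N x {v, w} = N (x $ v - x $ w)"
  unfolding edge_length_def
proof (rule the_equality)
  show "\<exists>v' w'. {v, w} = {v', w'} \<and> N (x $ v - x $ w) = N (x $ v' - x $ w')"
    by blast
  show "r = N (x $ v - x $ w)"
    if "\<exists>v' w'. {v, w} = {v', w'} \<and> r = N (x $ v' - x $ w')" for r
    using that assms[of "x $ v - x $ w"] by (auto simp: doubleton_eq_iff)
qed

text \<open>
  The space of real families indexed by \<open>E\<close> is embedded in the families indexed by all sets of
  vertices, as the subspace of those vanishing outside \<open>E\<close>.
\<close>

definition edge_space :: "'v::finite set set \<Rightarrow> (real ^ 'v set) set" where
  "edge_space E = {z. \<forall>e. e \<notin> E \<longrightarrow> z $ e = 0}"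

definition rigidity_map ::
  "('a::euclidean_space \<Rightarrow> real) \<Rightarrow> 'v::finite set set \<Rightarrow> 'a ^ 'v \<Rightarrow> real ^ 'v set" where
  "rigidity_map N E x = (\<chi> e. if e \<in> E then edge_length N x e else 0)"

definition framework :: "'v::finite set set \<Rightarrow> 'a::euclidean_space ^ 'v \<Rightarrow> bool" where
  "framework E p \<longleftrightarrow> (\<forall>v w. {v, w} \<in> E \<longrightarrow> p $ v \<noteq> p $ w)"

definition well_positioned ::
  "('a::euclidean_space \<Rightarrow> real) \<Rightarrow> 'v::finite set set \<Rightarrow> 'a ^ 'v \<Rightarrow> bool" where
  "well_positioned N E p \<longleftrightarrow> framework E p \<and> rigidity_map N E differentiable (at p)"

definition rigidity_differential ::
  "('a::euclidean_space \<Rightarrow> real) \<Rightarrow> 'v::finite set set \<Rightarrow> 'a ^ 'v \<Rightarrow> 'a ^ 'v \<Rightarrow> real ^ 'v set" where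
  "rigidity_differential N E p = frechet_derivative (rigidity_map N E) (at p)"

definition independent_framework ::
  "('a::euclidean_space \<Rightarrow> real) \<Rightarrow> 'v::finite set set \<Rightarrow> 'a ^ 'v \<Rightarrow> bool" where
  "independent_framework N E p \<longleftrightarrow>
     well_positioned N E p \<and> range (rigidity_differential N E p) = edge_space E"

text \<open>The values of \<open>\<alpha> x\<close> outside \<open>[-1, 1]\<close> are irrelevant.\<close>

definition rigid_motion ::
  "('a::euclidean_space \<Rightarrow> real) \<Rightarrow> ('a \<Rightarrow> real \<Rightarrow> 'a) \<Rightarrow> bool" where
  "rigid_motion N \<alpha> \<longleftrightarrow>
     (\<forall>x. continuous_on {-1..1} (\<alpha> x) \<and> \<alpha> x 0 = x \<and> \<alpha> x differentiable (at 0)) \<and>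
     (\<forall>x y. \<forall>t\<in>{-1..1}. N (\<alpha> x t - \<alpha> y t) = N (x - y))"

definition infinitesimal_motions :: "('a::euclidean_space \<Rightarrow> real) \<Rightarrow> ('a \<Rightarrow> 'a) set" where
  "infinitesimal_motions N =
     {\<eta>. \<exists>\<alpha>. rigid_motion N \<alpha> \<and> (\<forall>x. \<eta> x = vector_derivative (\<alpha> x) (at 0))}"

definition trivial_motions ::
  "('a::euclidean_space \<Rightarrow> real) \<Rightarrow> 'a ^ 'v::finite \<Rightarrow> ('a ^ 'v) set" where
  "trivial_motions N p = {(\<chi> v. \<eta> (p $ v)) | \<eta>. \<eta> \<in> infinitesimal_motions N}"

definition infinitesimally_rigid ::
  "('a::euclidean_space \<Rightarrow> real) \<Rightarrow> 'v::finite set set \<Rightarrow> 'a ^ 'v \<Rightarrow> bool" where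
  "infinitesimally_rigid N E p \<longleftrightarrow>
     well_positioned N E p \<and> {u. rigidity_differential N E p u = 0} = trivial_motions N p"

definition minimally_infinitesimally_rigid ::
  "('a::euclidean_space \<Rightarrow> real) \<Rightarrow> 'v::finite set set \<Rightarrow> 'a ^ 'v \<Rightarrow> bool" where
  "minimally_infinitesimally_rigid N E p \<longleftrightarrow>
     infinitesimally_rigid N E p \<and> independent_framework N E p"

definition minimally_rigid :: "('a::euclidean_space \<Rightarrow> real) \<Rightarrow> 'v::finite set set \<Rightarrow> bool" where
  "minimally_rigid N E \<longleftrightarrow> (\<exists>p. well_positioned N E p \<and> minimally_infinitesimally_rigid N E p)"

end

theory Submission
  imports Defs "HOL-Complex_Analysis.Conformal_Mappings"
begin

text \<open>
  In the cylindrical space the norm of an edge with displacement \<open>(x, y)\<close> is locally \<open>norm x\<close> or \<open>\<bar>y\<bar>\<close>,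
  so the differential of the rigidity map splits into the Euclidean rigidity matrix of the edges of
  the first kind and the incidence matrix of the others; this gives the decomposition.  In the
  conical space each row is the sum of the two kinds of rows, and by multilinearity one summand
  per row can be kept without destroying independence.  Dimension counts identify the kernels,
  since in both spaces the infinitesimal motions are those of the base space together with the
  vertical translations.

  Conversely it suffices to find a placement with independent rows.  If \<open>d \<ge> 2\<close>, any prescribed
  spanning tree can be made the set of steep edges of a placement in the cylindrical space.
  For the conical space, multilinearity provides independent rows with some choice of signs of the last
  coordinates; a sign is changed by moving the placement along a line on which the edge
  shrinks to a point and is reflected, because all determinants are real analytic along the line.
  If \<open>d = 1\<close>, the union of two edge-disjoint spanning trees is, possibly after exchanging edges between the trees,
  realised by two linear orders of the vertices which agree on one tree and disagree on the
  other; this follows by induction, removing a vertex of degree at most three.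
\<close>

section \<open>Linearly independent families of functionals\<close>

text \<open>Surjectivity of a differential is encoded as a \<open>dual_system\<close>, a family of
  vectors biorthogonal to the rows. With the vectors kept fixed it becomes the nonvanishing of a
  determinant in the placement, so independence travels along lines: polynomially for Euclidean
  rows, analytically once edge lengths enter. Rigidity is then a matter of counting: the number of
  edges is right, so independent rows suffice as soon as the placement spans the base affinely, and
  this is what asks for d + 1 vertices. The two ranges of d differ in room. For d >= 2 some
  direction avoids any finite set of lines; it separates a new leaf from its siblings and keeps all
  edges but one nondegenerate while that one collapses. On a line there is no such direction, and
  the induction closes because the trees may exchange edges. There |u - w| < |u + w| iff u w > 0, so
  one pair of orders (u, w) gives both the conical placement (u, w) and the cylindrical placement (u
  + w, u - w).\<close>

definition functional_map :: "'i set \<Rightarrow> ('i \<Rightarrow> 'w \<Rightarrow> real) \<Rightarrow> 'w \<Rightarrow> real ^ 'i" where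
  "functional_map E f x = (\<chi> e. if e \<in> E then f e x else 0)"

text \<open>For linear rows this is linear independence. Biorthogonal vectors are easy to repair
  when rows are scaled, replaced or put together.\<close>

definition dual_system :: "'i set \<Rightarrow> ('i \<Rightarrow> 'w \<Rightarrow> real) \<Rightarrow> bool" where
  "dual_system E f \<longleftrightarrow> (\<exists>b. \<forall>e\<in>E. \<forall>e'\<in>E. f e (b e') = (if e = e' then 1 else 0))"

lemma linear_functional_map:
  fixes f :: "'i::finite \<Rightarrow> 'w::real_vector \<Rightarrow> real"
  assumes "\<And>e. e \<in> E \<Longrightarrow> linear (f e)"
  shows "linear (functional_map E f)"
  using assms
  by (intro linearI) (auto simp: functional_map_def vec_eq_iff linear_add linear_scale)

lemma dual_system_iff_range:
  fixes f :: "'i::finite \<Rightarrow> 'w::real_vector \<Rightarrow> real"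
  assumes lin: "\<And>e. e \<in> E \<Longrightarrow> linear (f e)"
  shows "dual_system E f \<longleftrightarrow> range (functional_map E f) = {z. \<forall>e. e \<notin> E \<longrightarrow> z $ e = 0}"
proof
  assume "dual_system E f"
  then obtain b where b: "\<And>e e'. e \<in> E \<Longrightarrow> e' \<in> E \<Longrightarrow> f e (b e') = (if e = e' then 1 else 0)"
    unfolding dual_system_def by blast
  show "range (functional_map E f) = {z. \<forall>e. e \<notin> E \<longrightarrow> z $ e = 0}"
  proof (intro equalityI subsetI)
    fix z :: "real ^ 'i" assume z: "z \<in> {z. \<forall>e. e \<notin> E \<longrightarrow> z $ e = 0}"
    have "f e (\<Sum>e'\<in>E. z $ e' *\<^sub>R b e') = z $ e" if "e \<in> E" for e
    proof -
      have "f e (\<Sum>e'\<in>E. z $ e' *\<^sub>R b e') = (\<Sum>e'\<in>E. z $ e' * f e (b e'))"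
        using lin[OF that] by (simp add: linear_sum linear_scale)
      also have "\<dots> = (\<Sum>e'\<in>E. if e' = e then z $ e' else 0)"
        using b that by (intro sum.cong) auto
      finally show ?thesis using that by simp
    qed
    then have "functional_map E f (\<Sum>e'\<in>E. z $ e' *\<^sub>R b e') = z"
      using z by (auto simp: functional_map_def vec_eq_iff)
    then show "z \<in> range (functional_map E f)" by (metis rangeI)
  qed (auto simp: functional_map_def)
next
  assume R: "range (functional_map E f) = {z. \<forall>e. e \<notin> E \<longrightarrow> z $ e = 0}"
  have "\<exists>x. functional_map E f x = axis e' 1" if "e' \<in> E" for e'
  proof -
    have "axis e' 1 \<in> {z::real^'i. \<forall>e. e \<notin> E \<longrightarrow> z $ e = 0}" using that by (auto simp: axis_def)
    then show ?thesis unfolding R[symmetric] by (metis rangeE)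
  qed
  then obtain b where b: "\<And>e'. e' \<in> E \<Longrightarrow> functional_map E f (b e') = axis e' 1" by metis
  have "f e (b e') = (if e = e' then 1 else 0)" if "e \<in> E" "e' \<in> E" for e e'
    using arg_cong[OF b[OF that(2)], of "\<lambda>z. z $ e"] that(1)
    by (auto simp: functional_map_def axis_def)
  then show "dual_system E f" unfolding dual_system_def by blast
qed

lemma dual_system_cong:
  assumes "\<And>e x. e \<in> E \<Longrightarrow> f e x = g e x"
  shows "dual_system E f \<longleftrightarrow> dual_system E g"
  using assms unfolding dual_system_def by simp

lemma dual_system_scale:
  fixes f :: "'i \<Rightarrow> 'w::real_vector \<Rightarrow> real"
  assumes "dual_system E f" "\<And>e. e \<in> E \<Longrightarrow> linear (f e)" "\<And>e. e \<in> E \<Longrightarrow> k e \<noteq> 0"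
  shows "dual_system E (\<lambda>e x. k e * f e x)"
proof -
  from assms(1) obtain b where b: "\<And>e e'. e \<in> E \<Longrightarrow> e' \<in> E \<Longrightarrow> f e (b e') = (if e = e' then 1 else 0)"
    unfolding dual_system_def by blast
  have "k e * f e ((1 / k e') *\<^sub>R b e') = (if e = e' then 1 else 0)" if "e \<in> E" "e' \<in> E" for e e'
    using that b[OF that] assms(2)[OF that(1)] assms(3)[OF that(2)] by (simp add: linear_scale)
  then show ?thesis unfolding dual_system_def by (intro exI[of _ "\<lambda>e. (1 / k e) *\<^sub>R b e"]) simp
qed

text \<open>At its own dual vector \<open>b k\<close> the row \<open>k\<close> takes the value 1, so
  one of the two summands is nonzero there and can take over the row.\<close>

lemma dual_system_replace:
  fixes f :: "'i \<Rightarrow> 'w::real_vector \<Rightarrow> real"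
  assumes "dual_system E f" "\<And>e. e \<in> E \<Longrightarrow> linear (f e)" "k \<in> E"
    and sum: "\<And>x. f k x = g x + h x" and lin: "linear g" "linear h"
  shows "dual_system E (f(k := g)) \<or> dual_system E (f(k := h))"
proof -
  from assms(1) obtain b where b: "\<And>e e'. e \<in> E \<Longrightarrow> e' \<in> E \<Longrightarrow> f e (b e') = (if e = e' then 1 else 0)"
    unfolding dual_system_def by blast
  have *: "dual_system E (f(k := a))" if a: "linear a" "a (b k) \<noteq> 0" for a
  proof -
    \<comment> \<open>Gaussian elimination: \<open>b k\<close> is rescaled, and a multiple of it is
      subtracted from the other vectors so that the new row vanishes on them. The other rows do not
      notice, since they vanish on \<open>b k\<close>.\<close>
    define c where "c e = (if e = k then (1 / a (b k)) *\<^sub>R b k else b e - (a (b e) / a (b k)) *\<^sub>R b k)" for e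
    have "(f(k := a)) e (c e') = (if e = e' then 1 else 0)" if "e \<in> E" "e' \<in> E" for e e'
      using b[OF that] b[OF that(1) assms(3)] a assms(2)[OF that(1)]
      by (auto simp: c_def linear_diff linear_scale)
    then show ?thesis unfolding dual_system_def by blast
  qed
  have "g (b k) + h (b k) = 1" using b[OF assms(3) assms(3)] sum by simp
  then have "g (b k) \<noteq> 0 \<or> h (b k) \<noteq> 0" by linarith
  then show ?thesis using * lin by blast
qed

text \<open>Multilinearity of the determinant in the rows, without a choice of basis: expanding one
  row after another, some choice of summands stays independent.\<close>

lemma dual_system_split:
  fixes f :: "'i \<Rightarrow> 'w::real_vector \<Rightarrow> real"
  assumes fin: "finite E" and dual: "dual_system E f" and lin: "\<And>e. e \<in> E \<Longrightarrow> linear (g e)" "\<And>e. e \<in> E \<Longrightarrow> linear (h e)"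
    and sum: "\<And>e x. e \<in> E \<Longrightarrow> f e x = g e x + h e x"
  obtains F where "F \<subseteq> E" "dual_system E (\<lambda>e. if e \<in> F then g e else h e)"
proof -
  have f: "linear (f e)" if "e \<in> E" for e
  proof -
    have "f e = (\<lambda>x. g e x + h e x)" using sum that by blast
    then show ?thesis using lin[OF that] linear_compose_add by metis
  qed
  \<comment> \<open>\<open>S\<close> is the set of rows already expanded, \<open>F\<close> its part
    where \<open>g\<close> was taken; rows outside \<open>S\<close> are still
    \<open>f\<close>.\<close>
  have "\<exists>F\<subseteq>S. dual_system E (\<lambda>e. if e \<in> F then g e else if e \<in> S then h e else f e)" if "finite S" "S \<subseteq> E" for S
    using that
  proof (induction S rule: finite_induct)
    case empty
    show ?case using dual by (intro exI[of _ "{}"]) simp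
  next
    case (insert k S)
    then obtain F where F: "F \<subseteq> S" "dual_system E (\<lambda>e. if e \<in> F then g e else if e \<in> S then h e else f e)"
      by blast
    let ?f = "\<lambda>e. if e \<in> F then g e else if e \<in> S then h e else f e"
    have k: "k \<in> E" "k \<notin> F" using insert F by auto
    have "dual_system E (?f(k := g k)) \<or> dual_system E (?f(k := h k))"
    proof (rule dual_system_replace[OF F(2) _ k(1)])
      show "linear (?f e)" if "e \<in> E" for e using lin[OF that] f[OF that] by simp
      show "?f k x = g k x + h k x" for x using k insert.hyps sum[OF k(1)] by simp
      show "linear (g k)" "linear (h k)" using lin k by auto
    qed
    then show ?case
    proof
      assume "dual_system E (?f(k := g k))"
      moreover have "?f(k := g k) = (\<lambda>e. if e \<in> insert k F then g e else if e \<in> insert k S then h e else f e)"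
        using k by (auto simp: fun_eq_iff)
      ultimately show ?case using F(1) by (intro exI[of _ "insert k F"] conjI) (blast, simp only:)
    next
      assume "dual_system E (?f(k := h k))"
      moreover have "?f(k := h k) = (\<lambda>e. if e \<in> F then g e else if e \<in> insert k S then h e else f e)"
        using k by (auto simp: fun_eq_iff)
      ultimately show ?case using F(1) by (intro exI[of _ F] conjI) (blast, simp only:)
    qed
  qed
  from this[OF fin subset_refl] obtain F where F: "F \<subseteq> E" "dual_system E (\<lambda>e. if e \<in> F then g e else if e \<in> E then h e else f e)"
    by blast
  have "dual_system E (\<lambda>e. if e \<in> F then g e else h e)"
    using F(2) by (subst (asm) dual_system_cong[where g = "\<lambda>e. if e \<in> F then g e else h e"]) simp_all
  with F(1) that show ?thesis by blast
qed

text \<open>Padding by the identity makes the determinant over the whole index type equal to that of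
  the block indexed by \<open>E\<close>.\<close>

definition pairing_matrix :: "'i set \<Rightarrow> ('i \<Rightarrow> 'w \<Rightarrow> real) \<Rightarrow> ('i \<Rightarrow> 'w) \<Rightarrow> real ^ 'i ^ 'i" where
  "pairing_matrix E f b = (\<chi> e e'. if e \<in> E \<and> e' \<in> E then f e (b e') else if e = e' then 1 else 0)"

text \<open>The vectors \<open>b\<close> are arbitrary here. A \<open>b\<close> that works for one
  placement can be kept while the rows vary, and the determinant is then a function of the
  placement.\<close>

lemma dual_system_iff_det:
  fixes f :: "'i::finite \<Rightarrow> 'w::real_vector \<Rightarrow> real"
  assumes lin: "\<And>e. e \<in> E \<Longrightarrow> linear (f e)"
  shows "dual_system E f \<longleftrightarrow> (\<exists>b. det (pairing_matrix E f b) \<noteq> 0)"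
proof
  assume "dual_system E f"
  then obtain b where b: "\<And>e e'. e \<in> E \<Longrightarrow> e' \<in> E \<Longrightarrow> f e (b e') = (if e = e' then 1 else 0)"
    unfolding dual_system_def by blast
  then have "pairing_matrix E f b = mat 1"
    by (auto simp: pairing_matrix_def mat_def vec_eq_iff)
  then show "\<exists>b. det (pairing_matrix E f b) \<noteq> 0" by (metis det_I zero_neq_one)
next
  assume "\<exists>b. det (pairing_matrix E f b) \<noteq> 0"
  then obtain b where b: "det (pairing_matrix E f b) \<noteq> 0" by blast
  let ?M = "pairing_matrix E f b"
  have "z \<in> range (functional_map E f)" if z: "\<forall>e. e \<notin> E \<longrightarrow> z $ e = 0" for z
  proof -
    from b have "invertible ?M" by (simp add: invertible_det_nz)
    then obtain M' where "?M ** M' = mat 1" unfolding invertible_def by blast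
    then have y: "?M *v (M' *v z) = z" by (simp add: matrix_vector_mul_assoc)
    define c where "c = M' *v z"
    have "f e (\<Sum>e'\<in>E. c $ e' *\<^sub>R b e') = z $ e" if "e \<in> E" for e
    proof -
      have "z $ e = (?M *v c) $ e" using y by (simp only: c_def)
      also have "\<dots> = (\<Sum>e'\<in>UNIV. ?M $ e $ e' * c $ e')"
        by (simp add: matrix_vector_mult_def)
      also have "\<dots> = (\<Sum>e'\<in>UNIV. if e' \<in> E then c $ e' * f e (b e') else 0)"
        using that by (intro sum.cong) (auto simp: pairing_matrix_def)
      also have "\<dots> = (\<Sum>e'\<in>E. c $ e' * f e (b e'))"
        by (simp add: sum.If_cases)
      also have "\<dots> = f e (\<Sum>e'\<in>E. c $ e' *\<^sub>R b e')"
        using lin[OF that] by (simp add: linear_sum linear_scale)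
      finally show ?thesis by simp
    qed
    then have "functional_map E f (\<Sum>e'\<in>E. c $ e' *\<^sub>R b e') = z"
      using z by (auto simp: functional_map_def vec_eq_iff)
    then show ?thesis by (metis rangeI)
  qed
  then have "range (functional_map E f) = {z. \<forall>e. e \<notin> E \<longrightarrow> z $ e = 0}"
    by (auto simp: functional_map_def)
  then show "dual_system E f" using dual_system_iff_range[of E f, OF lin] by simp
qed

lemma dim_coordinate_subspace:
  fixes E :: "'i::finite set"
  shows "dim {z::real ^ 'i. \<forall>e. e \<notin> E \<longrightarrow> z $ e = 0} = card E"
  unfolding dim_vec_eq[symmetric] by (rule dim_substandard_cart)

text \<open>Rank-nullity: the map is injective on the orthogonal complement of its kernel and
  attains every family supported on \<open>E\<close>.\<close>

lemma dim_kernel_dual_system: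
  fixes f :: "'i::finite \<Rightarrow> 'w::euclidean_space \<Rightarrow> real"
  assumes lin: "\<And>e. e \<in> E \<Longrightarrow> linear (f e)" and dual: "dual_system E f"
  shows "dim {x. functional_map E f x = 0} + card E = DIM('w)"
proof -
  have L: "linear (functional_map E f)" using lin by (rule linear_functional_map)
  define K where "K = {x. functional_map E f x = 0}"
  define P where "P = {y \<in> UNIV. \<forall>x\<in>K. orthogonal x y}"
  have K: "subspace K" unfolding K_def using L by (rule linear_subspace_kernel)
  have P: "subspace P" by (auto simp: P_def subspace_def orthogonal_clauses)
  have dims: "dim P + dim K = DIM('w)"
    using dim_subspace_orthogonal_to_vectors[OF K subspace_UNIV] by (simp add: P_def)
  have "x = 0" if "x \<in> P" "functional_map E f x = 0" for x
    using that orthogonal_self[of x] by (auto simp: P_def K_def)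
  then have "inj_on (functional_map E f) (span P)"
    using linear_injective_on_subspace_0[OF L P] P by (simp add: span_eq_iff[THEN iffD2])
  then have "dim (functional_map E f ` P) = dim P"
    using L by (intro dim_image_eq)
  moreover have "functional_map E f ` P = range (functional_map E f)"
  proof (intro equalityI subsetI)
    fix z assume "z \<in> range (functional_map E f)"
    then obtain x where x: "z = functional_map E f x" by blast
    obtain y w where yw: "y \<in> span K" "\<And>u. u \<in> span K \<Longrightarrow> orthogonal w u" "x = y + w"
      using orthogonal_subspace_decomp_exists[of K x] by blast
    have "functional_map E f y = 0" using yw(1) K by (simp add: span_eq_iff[THEN iffD2] K_def)
    moreover have "orthogonal u w" if "u \<in> K" for u
      using yw(2)[OF span_base[OF that]] by (simp only: orthogonal_commute)
    then have "w \<in> P" by (simp add: P_def)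
    ultimately show "z \<in> functional_map E f ` P" using x yw(3) linear_add[OF L, of y w] by simp
  qed blast
  moreover have "dim (range (functional_map E f)) = card E"
    using dual_system_iff_range[of E f, OF lin] dual dim_coordinate_subspace[of E] by simp
  ultimately show ?thesis using dims by (simp add: K_def[symmetric])
qed

section \<open>Trees\<close>

definition joined :: "'v set set \<Rightarrow> 'v \<Rightarrow> 'v \<Rightarrow> bool" where
  "joined T a b \<longleftrightarrow> (a, b) \<in> {(a, b). {a, b} \<in> T}\<^sup>*"

text \<open>Inductions remove vertices while the vertex type stays fixed, so trees live on a subset
  \<open>A\<close>. Counting edges replaces acyclicity; it also forces \<open>A\<close> to be
  nonempty.\<close>

definition spanning_tree :: "'v::finite set \<Rightarrow> 'v set set \<Rightarrow> bool" where
  "spanning_tree A T \<longleftrightarrow> simple_graph T \<and> \<Union>T \<subseteq> A \<and> (\<forall>a\<in>A. \<forall>b\<in>A. joined T a b) \<and> card T + 1 = card A"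

text \<open>An arbitrary orientation of the edges, which makes the vector along an edge a linear map
  of the placement; it affects only the sign of \<open>edge_diff\<close>.\<close>

definition src :: "'v set \<Rightarrow> 'v" where "src e = (SOME v. v \<in> e)"

definition tgt :: "'v set \<Rightarrow> 'v" where "tgt e = (SOME v. v \<in> e \<and> v \<noteq> src e)"

definition edge_diff :: "'v::finite set \<Rightarrow> 'a::real_vector ^ 'v \<Rightarrow> 'a" where
  "edge_diff e x = x $ src e - x $ tgt e"

lemma src_tgt:
  assumes "card e = 2"
  shows "e = {src e, tgt e}" "src e \<noteq> tgt e"
proof -
  obtain a b where ab: "e = {a, b}" "a \<noteq> b" using assms by (metis card_2_iff)
  have s: "src e \<in> e" unfolding src_def by (rule someI[of _ a]) (simp add: ab)
  have "tgt e \<in> e \<and> tgt e \<noteq> src e" unfolding tgt_def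
    by (rule someI_ex) (use ab s in auto)
  then show "e = {src e, tgt e}" "src e \<noteq> tgt e" using s ab by auto
qed

lemma src_tgt_doubleton:
  assumes "a \<noteq> b"
  shows "src {a, b} = a \<and> tgt {a, b} = b \<or> src {a, b} = b \<and> tgt {a, b} = a"
  using src_tgt[of "{a, b}"] assms by (auto simp: doubleton_eq_iff)

lemma linear_edge_diff: "linear (edge_diff e)"
  by (intro linearI) (auto simp: edge_diff_def scaleR_diff_right)

lemma simple_graph_subset: "simple_graph E \<Longrightarrow> F \<subseteq> E \<Longrightarrow> simple_graph F"
  by (auto simp: simple_graph_def)

lemma simple_graph_edge: "simple_graph E \<Longrightarrow> {a, b} \<in> E \<Longrightarrow> a \<noteq> b"
  by (auto simp: simple_graph_def)

lemma joined_refl [simp]: "joined T a a"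
  by (simp add: joined_def)

lemma joined_edge: "{a, b} \<in> T \<Longrightarrow> joined T a b"
  by (auto simp: joined_def)

lemma joined_trans: "joined T a b \<Longrightarrow> joined T b c \<Longrightarrow> joined T a c"
  by (simp add: joined_def)

lemma joined_induct [consumes 1, case_names refl step]:
  assumes "joined T a b" "P a" "\<And>y z. joined T a y \<Longrightarrow> {y, z} \<in> T \<Longrightarrow> P y \<Longrightarrow> P z"
  shows "P b"
  using assms(1) unfolding joined_def
  by (induction rule: rtrancl_induct) (use assms(2,3) in \<open>auto simp: joined_def\<close>)

text \<open>Pushes walks forward along a vertex map. The maps \<open>r\<close> used below contract
  an edge by sending one end to the other.\<close>

lemma joined_map:
  assumes "joined T x y" "\<And>a b. {a, b} \<in> T \<Longrightarrow> joined T' (r a) (r b)"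
  shows "joined T' (r x) (r y)"
  using assms(1)
proof (induction rule: joined_induct)
  case (step y z)
  then show ?case using assms(2)[of y z] joined_trans[of T' "r x" "r y" "r z"] by blast
qed simp

lemma joined_sym: "joined T a b \<Longrightarrow> joined T b a"
proof (induction rule: joined_induct)
  case (step y z)
  then show ?case by (metis insert_commute joined_edge joined_trans)
qed simp

lemma joined_mono: "joined T a b \<Longrightarrow> T \<subseteq> T' \<Longrightarrow> joined T' a b"
  using joined_map[of T a b T' id] joined_edge by (metis id_apply subsetD)

text \<open>Induction by contracting an edge \<open>{v, a}\<close>: the number of vertices drops by
  one and the number of edges by at least one, while walks survive by
  \<open>joined_map\<close>.\<close>

lemma card_le_of_joined:
  fixes A :: "'v::finite set"
  assumes "simple_graph T" "\<Union>T \<subseteq> A" "\<And>a b. a \<in> A \<Longrightarrow> b \<in> A \<Longrightarrow> joined T a b"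
  shows "card A \<le> card T + 1"
  using assms
proof (induction "card A" arbitrary: A T rule: less_induct)
  case less
  show ?case
  proof (cases "\<exists>v\<in>A. \<exists>x\<in>A. x \<noteq> v")
    case False
    then have "A = {} \<or> (\<exists>v. A = {v})" by blast
    then show ?thesis by auto
  next
    case True
    then obtain v x where v: "v \<in> A" "x \<in> A" "x \<noteq> v" by blast
    then have "(v, x) \<in> {(a, b). {a, b} \<in> T}\<^sup>*" using less.prems(3)[of v x] by (simp add: joined_def)
    then obtain a where a: "{v, a} \<in> T" using v(3) by (auto elim: converse_rtranclE)
    have "a \<noteq> v" using simple_graph_edge[OF less.prems(1) a] by simp
    define r where "r z = (if z = v then a else z)" for z
    \<comment> \<open>Parallel edges created by the contraction merge in the image; the condition
      \<open>card e = 2\<close> makes the new graph simple by construction.\<close>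
    define T' where "T' = {e \<in> (`) r ` (T - {{v, a}}). card e = 2}"
    have "card T' \<le> card ((`) r ` (T - {{v, a}}))"
      unfolding T'_def by (intro card_mono) auto
    also have "\<dots> \<le> card (T - {{v, a}})" by (rule card_image_le) simp
    finally have card: "card T' + 1 \<le> card T" using a card_gt_0_iff[of T] by (simp add: card_Diff_singleton) force
    have "a \<in> A" using a less.prems(2) by auto
    have r: "r z \<in> A - {v}" if "z \<in> A" for z using that \<open>a \<noteq> v\<close> \<open>a \<in> A\<close> by (auto simp: r_def)
    have edge: "joined T' (r y) (r z)" if "{y, z} \<in> T" for y z
    proof (cases "{y, z} = {v, a} \<or> r y = r z")
      case True
      then have "r y = r z" by (auto simp: r_def doubleton_eq_iff)
      then show ?thesis by simp
    next
      case False
      then have "{y, z} \<in> T - {{v, a}}" "card (r ` {y, z}) = 2" using that by auto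
      then have "r ` {y, z} \<in> T'" unfolding T'_def by blast
      then show ?thesis using joined_edge[of "r y" "r z" T'] by simp
    qed
    have "card (A - {v}) \<le> card T' + 1"
    proof (rule less.hyps)
      show "card (A - {v}) < card A" using v by (meson card_Diff1_less finite)
      show "simple_graph T'" by (auto simp: T'_def simple_graph_def)
      show "\<Union>T' \<subseteq> A - {v}" using r less.prems(2) by (fastforce simp: T'_def)
      show "joined T' y z" if "y \<in> A - {v}" "z \<in> A - {v}" for y z
      proof -
        have "joined T' (r y) (r z)" by (rule joined_map[OF less.prems(3)[of y z] edge]) (use that in auto)
        then show ?thesis using that by (simp add: r_def)
      qed
    qed
    then show ?thesis using card v by (simp add: card_Diff_singleton)
  qed
qed

text \<open>A walk that has just used the removed edge stands at \<open>a\<close> or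
  \<open>b\<close> and can be restarted there.\<close>

lemma joined_remove_edge:
  assumes "{a, b} \<in> T" "joined T a c"
  shows "joined (T - {{a, b}}) a c \<or> joined (T - {{a, b}}) b c"
  using assms(2)
proof (induction rule: joined_induct)
  case (step y z)
  show ?case
  proof (cases "{y, z} = {a, b}")
    case True
    then show ?thesis by (auto simp: doubleton_eq_iff)
  next
    case False
    then have "joined (T - {{a, b}}) y z" using step by (intro joined_edge) auto
    then show ?thesis using step.IH joined_trans by metis
  qed
qed simp

lemma joined_bridge_edge:
  assumes "joined (T - {{a, b}}) a b" "joined T x y"
  shows "joined (T - {{a, b}}) x y"
proof -
  have "joined (T - {{a, b}}) (id p) (id q)" if "{p, q} \<in> T" for p q
  proof (cases "{p, q} = {a, b}")
    case True
    then show ?thesis using assms(1) joined_sym[OF assms(1)] by (auto simp: doubleton_eq_iff)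
  next
    case False
    then show ?thesis using that joined_edge[of p q "T - {{a, b}}"] by simp
  qed
  from joined_map[OF assms(2) this] show ?thesis by simp
qed

text \<open>Otherwise a detour would replace the edge, and \<open>A\<close> would be connected by
  fewer than \<open>card A - 1\<close> edges.\<close>

lemma spanning_tree_bridge:
  assumes "spanning_tree A T" "{a, b} \<in> T"
  shows "\<not> joined (T - {{a, b}}) a b"
proof
  assume j: "joined (T - {{a, b}}) a b"
  have "card A \<le> card (T - {{a, b}}) + 1"
  proof (rule card_le_of_joined)
    show "simple_graph (T - {{a, b}})" "\<Union>(T - {{a, b}}) \<subseteq> A"
      using assms by (auto simp: spanning_tree_def simple_graph_def)
    show "joined (T - {{a, b}}) x y" if "x \<in> A" "y \<in> A" for x y
      using assms(1) that by (intro joined_bridge_edge[OF j]) (auto simp: spanning_tree_def)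
  qed
  moreover have "card (T - {{a, b}}) < card T" using assms(2) by (intro psubset_card_mono) auto
  ultimately show False using assms(1) by (simp add: spanning_tree_def)
qed

lemma spanning_treeD:
  assumes "spanning_tree A T"
  shows "simple_graph T" "\<Union>T \<subseteq> A" "\<And>a b. a \<in> A \<Longrightarrow> b \<in> A \<Longrightarrow> joined T a b" "card T + 1 = card A"
    "\<And>a b. {a, b} \<in> T \<Longrightarrow> a \<in> A \<and> b \<in> A \<and> a \<noteq> b"
  using assms simple_graph_edge[of T] by (auto simp: spanning_tree_def)

lemma spanning_tree_remove_leaf:
  assumes T: "spanning_tree A T" and v: "{e \<in> T. v \<in> e} = {{v, a}}"
  shows "spanning_tree (A - {v}) (T - {{v, a}})" "a \<in> A - {v}"
proof -
  note D = spanning_treeD[OF T]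
  have va: "{v, a} \<in> T" using v by blast
  then show a: "a \<in> A - {v}" using D(5) by blast
  have "v \<in> A" using va D(2) by auto
  let ?r = "\<lambda>z. if z = v then a else z"
  have edge: "joined (T - {{v, a}}) (?r x) (?r y)" if "{x, y} \<in> T" for x y
  proof (cases "v \<in> {x, y}")
    case True
    then have "{x, y} \<in> {e \<in> T. v \<in> e}" using that by simp
    then have "{x, y} = {v, a}" unfolding v by simp
    then show ?thesis by (auto simp: doubleton_eq_iff)
  next
    case False
    then show ?thesis using that joined_edge[of x y "T - {{v, a}}"] by auto
  qed
  have "joined (T - {{v, a}}) x y" if "x \<in> A - {v}" "y \<in> A - {v}" for x y
  proof -
    have "joined (T - {{v, a}}) (?r x) (?r y)" by (rule joined_map[OF D(3)[of x y] edge]) (use that in auto)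
    then show ?thesis using that by simp
  qed
  moreover have "\<Union>(T - {{v, a}}) \<subseteq> A - {v}" using v D(2) by blast
  moreover have "card (T - {{v, a}}) + 1 = card (A - {v})"
    using D(4) va \<open>v \<in> A\<close> card_gt_0_iff[of T] by (auto simp: card_Diff_singleton)
  ultimately show "spanning_tree (A - {v}) (T - {{v, a}})"
    using D(1) by (auto simp: spanning_tree_def simple_graph_def)
qed

text \<open>Contraction of \<open>{v, a}\<close> turns \<open>{v, b}\<close> into
  \<open>{a, b}\<close>. If \<open>{a, b}\<close> were already present, the contracted graph would
  have too few edges to be connected.\<close>

lemma spanning_tree_suppress:
  assumes T: "spanning_tree A T" and v: "{e \<in> T. v \<in> e} = {{v, a}, {v, b}}" and ab: "a \<noteq> b"
  shows "spanning_tree (A - {v}) (insert {a, b} (T - {{v, a}, {v, b}}))" "{a, b} \<notin> T"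
    "a \<in> A - {v}" "b \<in> A - {v}"
proof -
  note D = spanning_treeD[OF T]
  have va: "{v, a} \<in> T" "{v, b} \<in> T" using v by blast+
  then show a: "a \<in> A - {v}" "b \<in> A - {v}" using D(5) by blast+
  have "v \<in> A" using va D(2) by auto
  let ?T = "insert {a, b} (T - {{v, a}, {v, b}})"
  let ?r = "\<lambda>z. if z = v then a else z"
  have edge: "joined ?T (?r x) (?r y)" if "{x, y} \<in> T" for x y
  proof (cases "v \<in> {x, y}")
    case True
    then have "{x, y} \<in> {e \<in> T. v \<in> e}" using that by simp
    then have "{x, y} = {v, a} \<or> {x, y} = {v, b}" unfolding v by simp
    then have "x = v \<and> (y = a \<or> y = b) \<or> y = v \<and> (x = a \<or> x = b)" by (auto simp: doubleton_eq_iff)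
    moreover have "joined ?T a b" "joined ?T b a"
      using joined_edge[of a b ?T] joined_edge[of b a ?T] by (simp_all add: insert_commute)
    ultimately show ?thesis using a by auto
  next
    case False
    then show ?thesis using that joined_edge[of x y ?T] by auto
  qed
  have j: "joined ?T x y" if "x \<in> A - {v}" "y \<in> A - {v}" for x y
  proof -
    have "joined ?T (?r x) (?r y)" by (rule joined_map[OF D(3)[of x y] edge]) (use that in auto)
    then show ?thesis using that by simp
  qed
  have sub: "\<Union>?T \<subseteq> A - {v}" using v D(2) a by blast
  have simple: "simple_graph ?T" using D(1) ab by (auto simp: simple_graph_def)
  have "{v, a} \<noteq> {v, b}" using ab by (auto simp: doubleton_eq_iff)
  then have c: "card (T - {{v, a}, {v, b}}) + 2 = card T"
    using va card_mono[of T "{{v, a}, {v, b}}"] by (subst card_Diff_subset) auto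
  have cA: "card (A - {v}) + 1 = card A" using \<open>v \<in> A\<close> by (metis Suc_eq_plus1 card.remove finite)
  show ab': "{a, b} \<notin> T"
  proof
    assume "{a, b} \<in> T"
    moreover have "{a, b} \<notin> {{v, a}, {v, b}}" using a by (simp add: doubleton_eq_iff)
    ultimately have "?T = T - {{v, a}, {v, b}}" by (intro insert_absorb) simp
    then show False using card_le_of_joined[OF simple sub j] c cA D(4) by simp
  qed
  have "card ?T = card (T - {{v, a}, {v, b}}) + 1" using ab' by simp
  with j sub simple c cA D(4) show "spanning_tree (A - {v}) ?T"
    by (auto simp: spanning_tree_def)
qed

lemma spanning_tree_add_leaf:
  assumes T: "spanning_tree A T" and "a \<in> A" "v \<notin> A"
  shows "spanning_tree (insert v A) (insert {v, a} T)"
proof -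
  note D = spanning_treeD[OF T]
  have new: "{v, a} \<notin> T" using D(2) assms(3) by auto
  have v: "joined (insert {v, a} T) v x" if "x \<in> insert v A" for x
  proof (cases "x = v")
    case False
    then have "joined (insert {v, a} T) a x" using joined_mono[OF D(3)[of a x]] assms that by auto
    then show ?thesis using joined_trans[OF joined_edge[of v a]] by simp
  qed simp
  then have "joined (insert {v, a} T) x y" if "x \<in> insert v A" "y \<in> insert v A" for x y
    using that joined_trans[OF joined_sym[of "insert {v, a} T" v x], of y] by simp
  then show ?thesis using D assms new
    by (auto simp: spanning_tree_def simple_graph_def card_insert_if)
qed

text \<open>The inverse of suppressing a vertex, with more freedom: the two halves left after
  deleting \<open>{a, b}\<close> may be joined through \<open>v\<close> at any \<open>x\<close> and
  \<open>y\<close> in them. This freedom is what allows edges to be exchanged between two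
  trees.\<close>

lemma spanning_tree_insert_vertex:
  assumes T: "spanning_tree A T" and ab: "{a, b} \<in> T" and v: "v \<notin> A"
    and x: "x \<in> A" "joined (T - {{a, b}}) a x" and y: "y \<in> A" "joined (T - {{a, b}}) b y"
  shows "spanning_tree (insert v A) (insert {v, x} (insert {v, y} (T - {{a, b}})))"
proof -
  note D = spanning_treeD[OF T]
  let ?T = "insert {v, x} (insert {v, y} (T - {{a, b}}))"
  have "x \<noteq> y" using spanning_tree_bridge[OF T ab] x y joined_trans joined_sym by metis
  then have ne: "{v, x} \<noteq> {v, y}" by (auto simp: doubleton_eq_iff)
  have new: "{v, x} \<notin> T" "{v, y} \<notin> T" using D(2) v by auto
  have m: "joined ?T p q" if "joined (T - {{a, b}}) p q" for p q
    using that by (rule joined_mono) auto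
  have vxy: "joined ?T v x" "joined ?T v y" by (intro joined_edge; simp)+
  have j: "joined ?T v a" "joined ?T v b"
    using joined_trans[OF vxy(1) joined_sym[OF m[OF x(2)]]] joined_trans[OF vxy(2) joined_sym[OF m[OF y(2)]]] .
  have "joined ?T v z" if "z \<in> insert v A" for z
  proof (cases "z = v")
    case False
    then have "joined (T - {{a, b}}) a z \<or> joined (T - {{a, b}}) b z"
      using that joined_remove_edge[OF ab D(3)[of a z]] D(5)[OF ab] by simp
    then have "joined ?T a z \<or> joined ?T b z" using m[of a z] m[of b z] by auto
    then show ?thesis using joined_trans[OF j(1), of z] joined_trans[OF j(2), of z] by auto
  qed simp
  then have "joined ?T p q" if "p \<in> insert v A" "q \<in> insert v A" for p q
    using that joined_trans[OF joined_sym[of ?T v p], of q] by simp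
  moreover have "card ?T = card (T - {{a, b}}) + 2" using new ne by simp
  then have "card ?T + 1 = card (insert v A)" using D(4) v card_Suc_Diff1[OF _ ab] by simp
  moreover have "simple_graph ?T" using D(1,5) v x(1) y(1) by (auto simp: simple_graph_def card_2_iff)
  moreover have "\<Union>?T \<subseteq> insert v A" using D(2) x(1) y(1) by auto
  ultimately show ?thesis by (simp add: spanning_tree_def)
qed

lemma sum_degree:
  fixes A :: "'v::finite set"
  assumes "simple_graph T" "\<Union>T \<subseteq> A"
  shows "(\<Sum>v\<in>A. card {e \<in> T. v \<in> e}) = 2 * card T"
proof -
  have "(\<Sum>v\<in>A. card {e \<in> T. v \<in> e}) = (\<Sum>v\<in>A. \<Sum>e\<in>T. if v \<in> e then 1 else 0)"
    by (simp add: sum.If_cases Int_def)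
  also have "\<dots> = (\<Sum>e\<in>T. \<Sum>v\<in>A. if v \<in> e then 1 else 0)" by (rule sum.swap)
  also have "\<dots> = (\<Sum>e\<in>T. card (A \<inter> e))" by (simp add: sum.If_cases Int_def)
  also have "\<dots> = (\<Sum>e\<in>T. 2)"
  proof (intro sum.cong refl)
    fix e assume "e \<in> T"
    then have "A \<inter> e = e" "card e = 2" using assms by (auto simp: simple_graph_def)
    then show "card (A \<inter> e) = 2" by simp
  qed
  finally show ?thesis by simp
qed

lemma spanning_tree_degree_pos:
  assumes T: "spanning_tree A T" and v: "v \<in> A" and A: "card A \<noteq> 1"
  shows "card {e \<in> T. v \<in> e} \<ge> 1"
proof -
  have "A \<noteq> {v}" using A by auto
  then obtain x where x: "x \<in> A" "x \<noteq> v" using v by blast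
  then have "(v, x) \<in> {(a, b). {a, b} \<in> T}\<^sup>*"
    using spanning_treeD(3)[OF T] v by (simp add: joined_def)
  then obtain a where "{v, a} \<in> T" using x(2) by (auto elim: converse_rtranclE)
  then have "{e \<in> T. v \<in> e} \<noteq> {}" by blast
  then show ?thesis by (simp add: Suc_le_eq card_gt_0_iff)
qed

lemma degree_one:
  assumes "simple_graph T" "card {e \<in> T. v \<in> e} = 1"
  obtains a where "{e \<in> T. v \<in> e} = {{v, a}}"
proof -
  from assms(2) obtain e where e: "{e \<in> T. v \<in> e} = {e}" by (auto simp: card_1_singleton_iff)
  then have "card e = 2" "v \<in> e" using assms(1) by (auto simp: simple_graph_def)
  then obtain a where "e = {v, a}" by (auto simp: card_2_iff)
  with e that show ?thesis by blast
qed

lemma degree_two: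
  assumes "simple_graph T" "card {e \<in> T. v \<in> e} = 2"
  obtains a b where "{e \<in> T. v \<in> e} = {{v, a}, {v, b}}" "a \<noteq> b"
proof -
  from assms(2) obtain e e' where e: "{e \<in> T. v \<in> e} = {e, e'}" "e \<noteq> e'" by (auto simp: card_2_iff)
  then have "card e = 2" "v \<in> e" "card e' = 2" "v \<in> e'" using assms(1) by (auto simp: simple_graph_def)
  then obtain a b where "e = {v, a}" "e' = {v, b}" by (auto simp: card_2_iff)
  with e that show ?thesis by blast
qed

lemma spanning_tree_leaf:
  assumes T: "spanning_tree A T" and A: "card A \<noteq> 1"
  obtains v a where "v \<in> A" "{e \<in> T. v \<in> e} = {{v, a}}"
proof -
  note D = spanning_treeD[OF T]
  have "\<exists>v\<in>A. card {e \<in> T. v \<in> e} < 2"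
  proof (rule ccontr)
    assume "\<not> ?thesis"
    then have "(\<Sum>v\<in>A. 2) \<le> (\<Sum>v\<in>A. card {e \<in> T. v \<in> e})" by (intro sum_mono) auto
    then show False using sum_degree[OF D(1,2)] D(4) by simp
  qed
  then obtain v where "v \<in> A" "card {e \<in> T. v \<in> e} < 2" by blast
  then have "card {e \<in> T. v \<in> e} = 1" using spanning_tree_degree_pos[OF T _ A] by force
  from degree_one[OF D(1) this] obtain a where "{e \<in> T. v \<in> e} = {{v, a}}" .
  with \<open>v \<in> A\<close> show ?thesis by (rule that)
qed

section \<open>Trees described by their incidence rows\<close>

lemma joined_constant:
  assumes "joined T a b" "\<And>a b. {a, b} \<in> T \<Longrightarrow> y a = y b"
  shows "y a = y b"
  using assms(1) by (induction rule: joined_induct) (use assms(2) in auto)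

text \<open>The dual vector of \<open>e\<close> is the indicator of the component of
  \<open>src e\<close> once \<open>e\<close> is deleted: it jumps across the bridge
  \<open>e\<close>, and every other edge stays on one side.\<close>

lemma dual_system_of_bridges:
  fixes T :: "'v::finite set set"
  assumes "simple_graph T" "\<And>a b. {a, b} \<in> T \<Longrightarrow> \<not> joined (T - {{a, b}}) a b"
  shows "dual_system T (\<lambda>e (x::real^'v). edge_diff e x)"
proof -
  define b :: "'v set \<Rightarrow> real ^ 'v" where
    "b e = (\<chi> v. if joined (T - {e}) (src e) v then 1 else 0)" for e
  have "edge_diff e (b e') = (if e = e' then 1 else 0)" if e: "e \<in> T" "e' \<in> T" for e e'
  proof -
    have st: "e = {src e, tgt e}" "e' = {src e', tgt e'}" using assms(1) e src_tgt by (auto simp: simple_graph_def)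
    show ?thesis
    proof (cases "e = e'")
      case True
      then show ?thesis using assms(2)[of "src e" "tgt e"] st e by (simp add: edge_diff_def b_def)
    next
      case False
      then have "joined (T - {e'}) (src e) (tgt e)"
        using st e by (intro joined_edge) auto
      then have "joined (T - {e'}) (src e') (src e) \<longleftrightarrow> joined (T - {e'}) (src e') (tgt e)"
        using joined_trans joined_sym by metis
      then show ?thesis using False by (simp add: edge_diff_def b_def)
    qed
  qed
  then show ?thesis unfolding dual_system_def by blast
qed

text \<open>Induction along the walk; when the next vertex already lies on the path, the path is cut
  back to it.\<close>

lemma joined_imp_path:
  assumes "joined T a b"
  shows "\<exists>vs. vs \<noteq> [] \<and> hd vs = a \<and> last vs = b \<and> distinct vs \<and> (\<forall>i. Suc i < length vs \<longrightarrow> {vs ! i, vs ! Suc i} \<in> T)"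
  using assms
proof (induction rule: joined_induct)
  case refl
  then show ?case by (intro exI[of _ "[a]"]) simp
next
  case (step y z)
  then obtain vs where vs: "vs \<noteq> []" "hd vs = a" "last vs = y" "distinct vs"
    "\<And>i. Suc i < length vs \<Longrightarrow> {vs ! i, vs ! Suc i} \<in> T" by blast
  show ?case
  proof (cases "z \<in> set vs")
    case False
    have "{(vs @ [z]) ! i, (vs @ [z]) ! Suc i} \<in> T" if "Suc i < length (vs @ [z])" for i
    proof (cases "Suc i < length vs")
      case True
      then show ?thesis using vs(5)[of i] by (simp add: nth_append)
    next
      case False
      then have "i = length vs - 1" using that vs(1) by auto
      then have "(vs @ [z]) ! i = y" "(vs @ [z]) ! Suc i = z"
        using vs(1,3) by (auto simp: nth_append last_conv_nth)
      then show ?thesis using step(2) by simp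
    qed
    then show ?thesis using False vs by (intro exI[of _ "vs @ [z]"]) auto
  next
    case True
    then obtain k where k: "k < length vs" "vs ! k = z" by (auto simp: in_set_conv_nth)
    have "last (take (Suc k) vs) = z" using k by (simp add: take_Suc_conv_app_nth)
    then show ?thesis using vs k by (intro exI[of _ "take (Suc k) vs"]) (auto simp: hd_take)
  qed
qed

text \<open>A path from \<open>a\<close> to \<open>b\<close> that avoids the edge closes up with it
  to a cycle; as the path is not the edge itself, it has at least three vertices.\<close>

lemma tree_graph_bridge:
  assumes "tree_graph T" "{a, b} \<in> T"
  shows "\<not> joined (T - {{a, b}}) a b"
proof
  assume "joined (T - {{a, b}}) a b"
  from joined_imp_path[OF this] obtain vs where vs: "vs \<noteq> []" "hd vs = a" "last vs = b" "distinct vs"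
    "\<And>i. Suc i < length vs \<Longrightarrow> {vs ! i, vs ! Suc i} \<in> T - {{a, b}}" by blast
  have "a \<noteq> b" using assms by (auto simp: tree_graph_def simple_graph_def)
  have h: "vs ! 0 = a" "vs ! (length vs - 1) = b" using vs by (auto simp: hd_conv_nth last_conv_nth)
  have "length vs \<noteq> 1" using h \<open>a \<noteq> b\<close> by auto
  moreover have "length vs \<noteq> 2" using h vs(5)[of 0] by auto
  moreover have "length vs \<noteq> 0" using vs(1) by simp
  ultimately have l: "3 \<le> length vs" by linarith
  have "{vs ! i, vs ! (Suc i mod length vs)} \<in> T" if "i < length vs" for i
  proof (cases "Suc i < length vs")
    case True
    then show ?thesis using vs(5)[of i] by simp
  next
    case False
    then have "i = length vs - 1" "Suc i = length vs" using that by auto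
    then show ?thesis using h assms(2) by (simp add: insert_commute)
  qed
  then have "is_cycle T vs" using l vs(4) by (simp add: is_cycle_def)
  then show False using assms(1) by (auto simp: tree_graph_def)
qed

text \<open>The dual vector of one edge of the cycle is constant across all other edges of the
  cycle, hence constant around it, but it has to jump across its own edge.\<close>

lemma acyclic_of_dual_system:
  fixes T :: "'v::finite set set"
  assumes "simple_graph T" "dual_system T (\<lambda>e (x::real^'v). edge_diff e x)"
  shows "\<not> is_cycle T vs"
proof
  assume "is_cycle T vs"
  then have c: "3 \<le> length vs" "distinct vs" "\<And>i. i < length vs \<Longrightarrow> {vs ! i, vs ! (Suc i mod length vs)} \<in> T"
    by (auto simp: is_cycle_def)
  obtain b where b: "\<And>e e'. e \<in> T \<Longrightarrow> e' \<in> T \<Longrightarrow> edge_diff e (b e' :: real^'v) = (if e = e' then 1 else 0)"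
    using assms(2) unfolding dual_system_def by blast
  let ?e = "{vs ! 0, vs ! 1}"
  have e0: "?e \<in> T" using c(3)[of 0] c(1) mod_less[of 1 "length vs"] by (cases "vs = []") simp_all
  have ne: "{vs ! i, vs ! (Suc i mod length vs)} \<noteq> ?e" if "0 < i" "i < length vs" for i
  proof (cases "Suc i < length vs")
    case True
    moreover have "0 < length vs" "1 < length vs" using c(1) by linarith+
    ultimately show ?thesis using that by (auto simp: doubleton_eq_iff nth_eq_iff_index_eq[OF c(2)])
  next
    case False
    then have i: "Suc i = length vs" using that by simp
    then have "i \<noteq> 1" "Suc i mod length vs = 0" using c(1) by auto
    moreover have "0 < length vs" "1 < length vs" using c(1) by linarith+
    ultimately show ?thesis using that by (auto simp: doubleton_eq_iff nth_eq_iff_index_eq[OF c(2)])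
  qed
  have eq: "b ?e $ (vs ! i) = b ?e $ (vs ! (Suc i mod length vs))" if "0 < i" "i < length vs" for i
  proof -
    have "vs ! i \<noteq> vs ! (Suc i mod length vs)" using simple_graph_edge[OF assms(1) c(3)[OF that(2)]] .
    from src_tgt_doubleton[OF this] show ?thesis
      using b[OF c(3)[OF that(2)] e0] ne[OF that] by (auto simp: edge_diff_def)
  qed
  have all: "b ?e $ (vs ! i) = b ?e $ (vs ! 1)" if "0 < i" "i < length vs" for i
    using that
  proof (induction i)
    case (Suc i)
    show ?case
    proof (cases "i = 0")
      case False
      then show ?thesis using Suc eq[of i] by simp
    qed simp
  qed simp
  have l: "Suc (length vs - 1) = length vs" "0 < length vs - 1" "length vs - 1 < length vs"
    using c(1) by auto
  have "b ?e $ (vs ! 0) = b ?e $ (vs ! 1)"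
    using eq[OF l(2,3)] all[OF l(2,3)] unfolding l(1) by simp
  moreover have "vs ! 0 \<noteq> vs ! 1" using simple_graph_edge[OF assms(1) e0] .
  from src_tgt_doubleton[OF this] have "b ?e $ (vs ! 0) \<noteq> b ?e $ (vs ! 1)"
    using b[OF e0 e0] by (auto simp: edge_diff_def)
  ultimately show False by simp
qed

lemma connected_graph_iff_joined: "connected_graph T \<longleftrightarrow> (\<forall>a b. joined T a b)"
  by (simp add: connected_graph_def joined_def)

lemma connected_graph_iff_kernel:
  fixes T :: "'v::finite set set"
  assumes "simple_graph T"
  shows "connected_graph T \<longleftrightarrow> {x::real^'v. \<forall>e\<in>T. edge_diff e x = 0} = {x. \<exists>c. \<forall>v. x $ v = c}"
proof
  assume c: "connected_graph T"
  show "{x::real^'v. \<forall>e\<in>T. edge_diff e x = 0} = {x. \<exists>c. \<forall>v. x $ v = c}"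
  proof (intro equalityI subsetI)
    fix x :: "real^'v" assume x: "x \<in> {x::real^'v. \<forall>e\<in>T. edge_diff e x = 0}"
    have "x $ a = x $ b" if "{a, b} \<in> T" for a b
      using x that src_tgt_doubleton[OF simple_graph_edge[OF assms that]] by (auto simp: edge_diff_def)
    then have "x $ v = x $ w" for v w
      using joined_constant[of T v w "($) x"] c by (auto simp: connected_graph_iff_joined)
    then show "x \<in> {x. \<exists>c. \<forall>v. x $ v = c}" by blast
  qed (auto simp: edge_diff_def)
next
  assume k: "{x::real^'v. \<forall>e\<in>T. edge_diff e x = 0} = {x. \<exists>c. \<forall>v. x $ v = c}"
  show "connected_graph T" unfolding connected_graph_iff_joined
  proof (intro allI)
    fix a b
    \<comment> \<open>The indicator of the component of \<open>a\<close> lies in the kernel, hence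
      is constant, and its value at \<open>a\<close> is 1.\<close>
    let ?x = "\<chi> v. if joined T a v then 1 else (0::real)"
    have "edge_diff e ?x = 0" if "e \<in> T" for e
    proof -
      have "joined T (src e) (tgt e)"
        using that src_tgt[of e] assms by (intro joined_edge) (auto simp: simple_graph_def)
      then have "joined T a (src e) \<longleftrightarrow> joined T a (tgt e)" using joined_trans joined_sym by metis
      then show ?thesis by (simp add: edge_diff_def)
    qed
    then obtain c where "\<And>v. ?x $ v = c" using k by blast
    from this[of a] this[of b] show "joined T a b" by (auto split: if_splits)
  qed
qed

lemma subspace_constant: "subspace {x::real^'v. \<exists>c. \<forall>v. x $ v = c}"
  by (force simp: subspace_def)

lemma dim_constant: "dim {x::real^'v::finite. \<exists>c. \<forall>v. x $ v = c} = 1"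
proof -
  have "{x::real^'v. \<exists>c. \<forall>v. x $ v = c} = span {(\<chi> v. 1) :: real^'v}"
    by (auto simp: span_singleton vec_eq_iff)
  moreover have "(\<chi> v. 1) \<noteq> (0 :: real^'v)" by (simp add: vec_eq_iff)
  ultimately show ?thesis by (simp add: dim_span)
qed

lemma functional_map_eq_0: "functional_map E f x = 0 \<longleftrightarrow> (\<forall>e\<in>E. f e x = 0)"
  by (auto simp: functional_map_def vec_eq_iff)

text \<open>Acyclicity is independence of the incidence rows, and connectedness says that only
  translations lie in the kernel. Trees thus play on the second summand the role that minimally
  rigid graphs play on the base.\<close>

lemma tree_graph_iff:
  fixes T :: "'v::finite set set"
  assumes "simple_graph T"
  shows "tree_graph T \<longleftrightarrow> dual_system T (\<lambda>e (x::real^'v). edge_diff e x) \<and>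
     {x::real^'v. \<forall>e\<in>T. edge_diff e x = 0} = {x. \<exists>c. \<forall>v. x $ v = c}"
  using assms tree_graph_bridge[of T] dual_system_of_bridges[of T] acyclic_of_dual_system[of T]
    connected_graph_iff_kernel[of T]
  by (auto simp: tree_graph_def)

lemma tree_graph_card:
  fixes T :: "'v::finite set set"
  assumes "tree_graph T"
  shows "card T + 1 = CARD('v)"
proof -
  have "simple_graph T" using assms by (simp add: tree_graph_def)
  then show ?thesis
    using tree_graph_iff[of T] assms dim_kernel_dual_system[of T "\<lambda>e (x::real^'v). edge_diff e x"]
      linear_edge_diff by (auto simp: functional_map_eq_0 dim_constant)
qed

lemma tree_graph_iff_spanning_tree: "tree_graph T \<longleftrightarrow> spanning_tree UNIV T"
proof
  assume "tree_graph T"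
  then show "spanning_tree UNIV T"
    using tree_graph_card[of T] by (auto simp: spanning_tree_def tree_graph_def connected_graph_iff_joined)
next
  assume T: "spanning_tree UNIV T"
  note D = spanning_treeD[OF this]
  then have "connected_graph T" by (simp add: connected_graph_iff_joined)
  then show "tree_graph T"
    using D(1) tree_graph_iff[OF D(1)] connected_graph_iff_kernel[OF D(1)]
      dual_system_of_bridges[OF D(1) spanning_tree_bridge[OF T]] by simp
qed

section \<open>Infinitesimal motions\<close>

lemma rigid_motionD:
  assumes "rigid_motion N \<alpha>"
  shows "continuous_on {-1..1} (\<alpha> x)" "\<alpha> x 0 = x" "(\<alpha> x has_vector_derivative vector_derivative (\<alpha> x) (at 0)) (at 0)"
    "t \<in> {-1..1} \<Longrightarrow> N (\<alpha> x t - \<alpha> y t) = N (x - y)"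
proof -
  have *: "(\<forall>x. continuous_on {-1..1} (\<alpha> x) \<and> \<alpha> x 0 = x \<and> \<alpha> x differentiable (at 0))"
    "\<forall>x y. \<forall>t\<in>{-1..1}. N (\<alpha> x t - \<alpha> y t) = N (x - y)"
    using assms unfolding rigid_motion_def by blast+
  show "continuous_on {-1..1} (\<alpha> x)" "\<alpha> x 0 = x" using *(1) by simp_all
  show "(\<alpha> x has_vector_derivative vector_derivative (\<alpha> x) (at 0)) (at 0)"
    using *(1) vector_derivative_works by blast
  show "t \<in> {-1..1} \<Longrightarrow> N (\<alpha> x t - \<alpha> y t) = N (x - y)" using *(2) by blast
qed

lemma edge_length_cong:
  assumes "\<And>v w. e = {v, w} \<Longrightarrow> N (x $ v - x $ w) = N (y $ v - y $ w)"
  shows "edge_length N x e = edge_length N y e"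
proof -
  have "(e = {v, w} \<and> r = N (x $ v - x $ w)) \<longleftrightarrow> (e = {v, w} \<and> r = N (y $ v - y $ w))" for v w r
    using assms[of v w] by auto
  then show ?thesis by (simp only: edge_length_def)
qed

lemma frechet_derivative_eq_0_of_constant_path:
  fixes f :: "'a::real_normed_vector \<Rightarrow> 'b::real_normed_vector"
  assumes f: "f differentiable (at (\<gamma> 0))" and \<gamma>: "(\<gamma> has_vector_derivative u) (at (0::real))"
    and const: "\<And>t. \<bar>t\<bar> \<le> 1 \<Longrightarrow> f (\<gamma> t) = f (\<gamma> 0)"
  shows "frechet_derivative f (at (\<gamma> 0)) u = 0"
proof -
  have "((\<lambda>t. f (\<gamma> t)) has_derivative (\<lambda>t. frechet_derivative f (at (\<gamma> 0)) (t *\<^sub>R u))) (at 0)"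
    by (rule has_derivative_compose[where f = \<gamma> and f' = "\<lambda>t. t *\<^sub>R u" and x = 0 and s = UNIV and g = f])
      (use \<gamma> f in \<open>simp_all only: has_vector_derivative_def frechet_derivative_works\<close>)
  moreover have "((\<lambda>t. f (\<gamma> t)) has_derivative (\<lambda>t. 0)) (at 0)"
  proof (rule has_derivative_transform_within[where f = "\<lambda>t. f (\<gamma> 0)" and d = 1])
    show "f (\<gamma> 0) = f (\<gamma> t)" if "dist t 0 < 1" for t
      using that by (intro const[symmetric]) simp
  qed simp_all
  ultimately have "(\<lambda>t. frechet_derivative f (at (\<gamma> 0)) (t *\<^sub>R u)) = (\<lambda>t. 0)"
    by (rule has_derivative_unique)
  from fun_cong[OF this, of 1] show ?thesis by simp
qed

lemma trivial_motions_subset_kernel: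
  assumes "well_positioned N E p"
  shows "trivial_motions N p \<subseteq> {u. rigidity_differential N E p u = 0}"
proof
  fix u assume "u \<in> trivial_motions N p"
  then obtain \<eta> \<alpha> where u: "u = (\<chi> v. \<eta> (p $ v))" and \<alpha>: "rigid_motion N \<alpha>"
    and \<eta>: "\<And>x. \<eta> x = vector_derivative (\<alpha> x) (at 0)"
    unfolding trivial_motions_def infinitesimal_motions_def by blast
  \<comment> \<open>The whole placement is carried along by the rigid motion, so its edge lengths
    stay constant.\<close>
  define \<gamma> where "\<gamma> t = (\<chi> v. \<alpha> (p $ v) t)" for t
  have \<gamma>0: "\<gamma> 0 = p" using rigid_motionD(2)[OF \<alpha>] by (simp add: \<gamma>_def vec_eq_iff)
  have "(\<gamma> has_vector_derivative u) (at 0)"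
  proof -
    have "(\<gamma> has_derivative (\<lambda>t. t *\<^sub>R u)) (at 0)"
    proof (subst has_derivative_componentwise_within, intro ballI)
      fix b :: "'a ^ 'b" assume "b \<in> Basis"
      then obtain v c where b: "b = axis v c" by (auto simp: Basis_vec_def)
      have "(\<alpha> (p $ v) has_derivative (\<lambda>t. t *\<^sub>R \<eta> (p $ v))) (at 0)"
        using rigid_motionD(3)[OF \<alpha>, of "p $ v"] \<eta> by (simp add: has_vector_derivative_def)
      then have "((\<lambda>t. \<alpha> (p $ v) t \<bullet> c) has_derivative (\<lambda>t. (t *\<^sub>R \<eta> (p $ v)) \<bullet> c)) (at 0)"
        by (rule has_derivative_inner_left)
      then show "((\<lambda>t. \<gamma> t \<bullet> b) has_derivative (\<lambda>t. (t *\<^sub>R u) \<bullet> b)) (at 0)"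
        by (simp add: b inner_axis \<gamma>_def u)
    qed
    then show ?thesis by (simp add: has_vector_derivative_def)
  qed
  moreover have "rigidity_map N E (\<gamma> t) = rigidity_map N E (\<gamma> 0)" if "\<bar>t\<bar> \<le> 1" for t
  proof -
    have t: "t \<in> {-1..1}" using that by auto
    have "edge_length N (\<gamma> t) e = edge_length N p e" for e
      by (rule edge_length_cong) (simp add: \<gamma>_def rigid_motionD(4)[OF \<alpha> t])
    then show ?thesis unfolding rigidity_map_def \<gamma>0 by (simp cong: if_cong)
  qed
  ultimately show "u \<in> {u. rigidity_differential N E p u = 0}"
    using frechet_derivative_eq_0_of_constant_path[of "rigidity_map N E" \<gamma> u] assms
    by (simp add: \<gamma>0 rigidity_differential_def well_positioned_def)
qed

lemma infinitesimal_motion_path: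
  assumes "\<eta> \<in> infinitesimal_motions N"
  obtains \<beta> where "(\<beta> has_derivative (\<lambda>t. t *\<^sub>R (\<eta> x - \<eta> y))) (at (0::real))"
    "\<beta> 0 = x - y" "\<And>t. \<bar>t\<bar> \<le> 1 \<Longrightarrow> N (\<beta> t) = N (x - y)"
proof -
  from assms obtain \<alpha> where \<alpha>: "rigid_motion N \<alpha>" and \<eta>: "\<And>x. \<eta> x = vector_derivative (\<alpha> x) (at 0)"
    unfolding infinitesimal_motions_def by blast
  have "((\<lambda>t. \<alpha> x t - \<alpha> y t) has_vector_derivative \<eta> x - \<eta> y) (at 0)"
    using rigid_motionD(3)[OF \<alpha>] \<eta> by (intro has_vector_derivative_diff) simp_all
  then show ?thesis
    by (intro that[of "\<lambda>t. \<alpha> x t - \<alpha> y t"])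
      (auto simp: has_vector_derivative_def rigid_motionD(2)[OF \<alpha>] intro!: rigid_motionD(4)[OF \<alpha>])
qed

text \<open>Since \<open>norm (w t) \<ge> 0\<close>, \<open>h\<close> has a local maximum at 0 and
  \<open>h' = 0\<close>; then \<open>norm (w t) = h 0 - h t\<close> is of smaller order than
  \<open>t\<close>, so \<open>w' = 0\<close>. This replaces differentiation of a norm at points
  where it has a kink.\<close>

lemma norm_plus_constant_imp_derivative_0:
  fixes w :: "real \<Rightarrow> 'a::real_normed_vector" and h :: "real \<Rightarrow> real"
  assumes w: "(w has_derivative (\<lambda>t. t *\<^sub>R w')) (at 0)" "w 0 = 0"
    and h: "(h has_derivative (\<lambda>t. t * h')) (at 0)"
    and const: "\<And>t. \<bar>t\<bar> < 1 \<Longrightarrow> norm (w t) + h t = h 0"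
  shows "w' = 0" "h' = 0"
proof -
  have "((\<lambda>t. h 0 - h t) has_derivative (\<lambda>t. 0 - t * h')) (at 0)"
    by (intro has_derivative_diff has_derivative_const h)
  then have "((\<lambda>t. h 0 - h t) has_real_derivative - h') (at 0)"
    by (rule has_derivative_imp_has_field_derivative) simp
  note dh = this
  have nonneg: "h 0 - h t = norm (w t)" if "\<bar>t\<bar> < 1" for t using const[OF that] by simp
  from dh have "- h' = 0"
    by (rule DERIV_local_min[where d = 1]) (auto simp: nonneg)
  then show "h' = 0" by simp
  have "((\<lambda>t. norm (h t - h 0) / norm t) \<longlongrightarrow> 0) (at 0)"
    using h \<open>h' = 0\<close> by (simp add: has_derivative_iff_norm)
  then have "((\<lambda>t. norm (w t) / norm t) \<longlongrightarrow> 0) (at 0)"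
  proof (rule Lim_transform_within[where d = 1])
    show "norm (h t - h 0) / norm t = norm (w t) / norm t" if "0 < dist t 0" "dist t 0 < 1" for t
    proof -
      have "norm (h t - h 0) = norm (w t)"
        using nonneg[of t] that norm_ge_zero[of "w t"] unfolding real_norm_def dist_real_def by linarith
      then show ?thesis by simp
    qed
  qed simp
  then have "(w has_derivative (\<lambda>t. 0)) (at 0)"
    using w(2) by (simp add: has_derivative_iff_norm)
  with w(1) have "(\<lambda>t. t *\<^sub>R w') = (\<lambda>t. 0)" by (rule has_derivative_unique)
  from fun_cong[OF this, of 1] show "w' = 0" by simp
qed

text \<open>The condition obtained by differentiating squared distances along a motion. That such a
  map is affine is a consequence and not part of the definition.\<close>

definition euclidean_motions :: "('a::euclidean_space \<Rightarrow> 'a) set" where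
  "euclidean_motions = {\<eta>. \<forall>x y. (\<eta> x - \<eta> y) \<bullet> (x - y) = 0}"

text \<open>After subtraction of \<open>\<eta> 0\<close> the condition polarises to skewness,
  \<open>f x \<bullet> y = - (f y \<bullet> x)\<close>. The right-hand side is linear in
  \<open>x\<close>, and a vector is determined by its inner products, so \<open>f\<close> is
  linear.\<close>

lemma euclidean_motions_iff_affine:
  "\<eta> \<in> euclidean_motions \<longleftrightarrow> (\<exists>f b. linear f \<and> (\<forall>x. f x \<bullet> x = 0) \<and> \<eta> = (\<lambda>x. f x + b))"
proof
  assume \<eta>: "\<eta> \<in> euclidean_motions"
  define f where "f x = \<eta> x - \<eta> 0" for x
  have f: "(f x - f y) \<bullet> (x - y) = 0" for x y using \<eta> by (simp add: f_def euclidean_motions_def)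
  have f0: "f 0 = 0" by (simp add: f_def)
  have self: "f x \<bullet> x = 0" for x using f[of x 0] f0 by simp
  have skew: "f x \<bullet> y = - (f y \<bullet> x)" for x y
    using f[of x y] self by (simp add: inner_diff algebra_simps)
  have "linear f"
  proof (rule linearI)
    fix x y :: 'a and c :: real
    have "(f (x + y) - (f x + f y)) \<bullet> z = 0" for z
    proof -
      have "(f (x + y) - (f x + f y)) \<bullet> z = f (x + y) \<bullet> z - (f x \<bullet> z + f y \<bullet> z)" by (simp add: inner_diff inner_add)
      also have "\<dots> = - (f z \<bullet> (x + y)) + f z \<bullet> x + f z \<bullet> y" using skew[of "x + y" z] skew[of x z] skew[of y z] by linarith
      finally show ?thesis by (simp add: inner_add)
    qed
    then show "f (x + y) = f x + f y" using inner_eq_zero_iff[of "f (x + y) - (f x + f y)"] by simp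
    have "(f (c *\<^sub>R x) - c *\<^sub>R f x) \<bullet> z = 0" for z
      using skew[of "c *\<^sub>R x" z] skew[of x z] by (simp add: inner_diff)
    then show "f (c *\<^sub>R x) = c *\<^sub>R f x" using inner_eq_zero_iff[of "f (c *\<^sub>R x) - c *\<^sub>R f x"] by simp
  qed
  moreover have "\<eta> = (\<lambda>x. f x + \<eta> 0)" by (simp add: f_def)
  ultimately show "\<exists>f b. linear f \<and> (\<forall>x. f x \<bullet> x = 0) \<and> \<eta> = (\<lambda>x. f x + b)" using self by blast
next
  assume "\<exists>f b. linear f \<and> (\<forall>x. f x \<bullet> x = 0) \<and> \<eta> = (\<lambda>x. f x + b)"
  then obtain f b where f: "linear f" "\<And>x. f x \<bullet> x = 0" "\<eta> = (\<lambda>x. f x + b)" by blast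
  then show "\<eta> \<in> euclidean_motions"
    by (simp add: euclidean_motions_def linear_diff[OF f(1), symmetric])
qed

text \<open>The Cayley transform of \<open>(t / 2) f\<close> is a curve of rotations with derivative \<open>f\<close> at \<open>0\<close>.\<close>

lemma skew_motion_path:
  fixes f :: "'a::euclidean_space \<Rightarrow> 'a"
  assumes f: "linear f" and skew: "\<And>x. f x \<bullet> x = 0"
  obtains \<alpha> where "\<And>x. continuous_on UNIV (\<alpha> x)" "\<And>x. \<alpha> x 0 = x"
    "\<And>x. (\<alpha> x has_vector_derivative f x) (at 0)" "\<And>x y t. norm (\<alpha> x t - \<alpha> y t) = norm (x - y)"
proof -
  have ex: "\<exists>y. y - (t / 2) *\<^sub>R f y = x + (t / 2) *\<^sub>R f x" for x t
  proof -
    let ?g = "\<lambda>y. y - (t / 2) *\<^sub>R f y"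
    have g: "linear ?g"
      using f by (intro linearI) (auto simp: linear_add linear_scale algebra_simps)
    \<comment> \<open>Skewness makes \<open>f y\<close> orthogonal to \<open>y\<close>, so the
      operator is injective for every \<open>t\<close> and the curve exists for all times.\<close>
    have "y = 0" if "?g y = 0" for y
    proof -
      have "y \<bullet> y = ((t / 2) *\<^sub>R f y) \<bullet> y" using that by simp
      then show ?thesis using skew[of y] by simp
    qed
    then have "inj ?g" using linear_injective_0[OF g] by blast
    then have "surj ?g" using linear_injective_imp_surjective g by blast
    from surjD[OF this, of "x + (t / 2) *\<^sub>R f x"] show ?thesis by (auto simp: eq_commute)
  qed
  define \<alpha> where "\<alpha> x t = (SOME y. y - (t / 2) *\<^sub>R f y = x + (t / 2) *\<^sub>R f x)" for x t
  have \<alpha>: "\<alpha> x t - (t / 2) *\<^sub>R f (\<alpha> x t) = x + (t / 2) *\<^sub>R f x" for x t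
    unfolding \<alpha>_def by (rule someI_ex) (rule ex)
  \<comment> \<open>In this form the increment is \<open>f\<close> of a sum. By skewness an
    increment is orthogonal to the corresponding sum, which is why norms are preserved.\<close>
  then have \<alpha>': "\<alpha> x t - x = (t / 2) *\<^sub>R f (\<alpha> x t + x)" for x t
    using \<alpha>[of x t] by (simp add: linear_add[OF f] algebra_simps)
  have norm: "norm (\<alpha> x t - \<alpha> y t) = norm (x - y)" for x y t
  proof -
    let ?a = "\<alpha> x t - \<alpha> y t" and ?b = "x - y"
    have "?a - ?b = (\<alpha> x t - x) - (\<alpha> y t - y)" by simp
    also have "\<dots> = (t / 2) *\<^sub>R f (?a + ?b)"
      unfolding \<alpha>' by (simp add: linear_add[OF f] linear_diff[OF f] algebra_simps)
    finally have "?a - ?b = (t / 2) *\<^sub>R f (?a + ?b)" .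
    then have "(?a - ?b) \<bullet> (?a + ?b) = 0" using skew[of "?a + ?b"] by simp
    then have "?a \<bullet> ?a = ?b \<bullet> ?b" by (simp add: inner_diff inner_add inner_commute)
    then show ?thesis by (simp add: norm_eq_sqrt_inner)
  qed
  have \<alpha>0: "\<alpha> x 0 = x" for x using \<alpha>[of x 0] by simp
  have fixes0: "norm (\<alpha> x t) = norm x" for x t
  proof -
    have "\<alpha> 0 t \<bullet> \<alpha> 0 t = ((t / 2) *\<^sub>R f (\<alpha> 0 t)) \<bullet> \<alpha> 0 t"
      using \<alpha>'[of 0 t] by simp
    then have "\<alpha> 0 t = 0" using skew by simp
    then show ?thesis using norm[of x t 0] by simp
  qed
  obtain B where B: "0 < B" "\<And>x. norm (f x) \<le> B * norm x"
    using linear_bounded_pos[OF f] by blast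
  \<comment> \<open>Pairing the difference \<open>?z\<close> with itself removes the term with
    \<open>f ?z\<close>, so the bound comes without an estimate of the inverse operator.\<close>
  have lip: "norm (\<alpha> x t - \<alpha> x s) \<le> B * norm x * \<bar>t - s\<bar>" for x t s
  proof -
    let ?z = "\<alpha> x t - \<alpha> x s"
    have "?z = (\<alpha> x t - x) - (\<alpha> x s - x)" by simp
    also have "\<dots> = (t / 2) *\<^sub>R f ?z + ((t - s) / 2) *\<^sub>R f (\<alpha> x s + x)"
      unfolding \<alpha>' by (simp add: linear_add[OF f] linear_diff[OF f] algebra_simps diff_divide_distrib)
    finally have "?z = (t / 2) *\<^sub>R f ?z + ((t - s) / 2) *\<^sub>R f (\<alpha> x s + x)" .
    then have "?z \<bullet> ?z = ((t / 2) *\<^sub>R f ?z + ((t - s) / 2) *\<^sub>R f (\<alpha> x s + x)) \<bullet> ?z" by simp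
    also have "\<dots> = ((t - s) / 2) * (f (\<alpha> x s + x) \<bullet> ?z)"
      using skew[of ?z] by (simp add: inner_add)
    also have "\<dots> \<le> \<bar>(t - s) / 2\<bar> * \<bar>f (\<alpha> x s + x) \<bullet> ?z\<bar>" by (metis abs_ge_self abs_mult)
    also have "\<dots> \<le> \<bar>(t - s) / 2\<bar> * (norm (f (\<alpha> x s + x)) * norm ?z)"
      by (intro mult_left_mono Cauchy_Schwarz_ineq2) auto
    also have "\<dots> \<le> \<bar>(t - s) / 2\<bar> * (B * (2 * norm x) * norm ?z)"
    proof (intro mult_left_mono mult_right_mono)
      have "norm (f (\<alpha> x s + x)) \<le> B * norm (\<alpha> x s + x)" by (rule B)
      also have "\<dots> \<le> B * (2 * norm x)"
        using norm_triangle_ineq[of "\<alpha> x s" x] fixes0[of x s] B(1) by (intro mult_left_mono) auto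
      finally show "norm (f (\<alpha> x s + x)) \<le> B * (2 * norm x)" .
    qed auto
    finally have "norm ?z * norm ?z \<le> (B * norm x * \<bar>t - s\<bar>) * norm ?z"
      by (simp add: power2_norm_eq_inner[symmetric] power2_eq_square abs_divide algebra_simps)
    then show ?thesis using B(1) by (cases "?z = 0") auto
  qed
  have cont: "continuous_on UNIV (\<alpha> x)" for x
  proof (rule lipschitz_on_continuous_on)
    show "(B * norm x)-lipschitz_on UNIV (\<alpha> x)"
      using B(1) lip by (intro lipschitz_onI) (auto simp: dist_norm)
  qed
  have "(\<alpha> x has_vector_derivative f x) (at 0)" for x
    unfolding has_vector_derivative_def has_derivative_iff_norm
  proof (intro conjI bounded_linear_scaleR_left)
    have "norm (\<alpha> x t - x - t *\<^sub>R f x) / norm t \<le> (B * B * norm x) * norm t" if "t \<noteq> 0" for t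
    proof -
      have "t *\<^sub>R f x = (t / 2) *\<^sub>R (f x + f x)" by (simp add: scaleR_add_right flip: scaleR_add_left)
      then have "\<alpha> x t - x - t *\<^sub>R f x = (t / 2) *\<^sub>R f (\<alpha> x t + x) - (t / 2) *\<^sub>R (f x + f x)"
        using \<alpha>'[of x t] by (simp only:)
      also have "\<dots> = (t / 2) *\<^sub>R f (\<alpha> x t - x)"
        by (simp add: linear_add[OF f] linear_diff[OF f] algebra_simps)
      finally have "\<alpha> x t - x - t *\<^sub>R f x = (t / 2) *\<^sub>R f (\<alpha> x t - x)" .
      then have "norm (\<alpha> x t - x - t *\<^sub>R f x) = \<bar>t\<bar> / 2 * norm (f (\<alpha> x t - x))" by simp
      also have "\<dots> \<le> \<bar>t\<bar> * (B * (B * norm x * \<bar>t\<bar>))"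
      proof (intro mult_mono)
        have "norm (f (\<alpha> x t - x)) \<le> B * norm (\<alpha> x t - x)" by (rule B)
        also have "\<dots> \<le> B * (B * norm x * \<bar>t\<bar>)"
          using lip[of x t 0] \<alpha>0[of x] B(1) by (intro mult_left_mono) auto
        finally show "norm (f (\<alpha> x t - x)) \<le> B * (B * norm x * \<bar>t\<bar>)" .
      qed auto
      finally show ?thesis using that by (simp add: divide_le_eq algebra_simps)
    qed
    then have "\<forall>\<^sub>F t in at 0. norm (norm (\<alpha> x t - x - t *\<^sub>R f x) / norm t) \<le> (B * B * norm x) * norm t"
      by (auto simp: eventually_at intro!: exI[of _ 1])
    moreover have "((\<lambda>t. (B * B * norm x) * norm t) \<longlongrightarrow> 0) (at 0)" by (auto intro!: tendsto_eq_intros)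
    ultimately have "((\<lambda>t. norm (\<alpha> x t - x - t *\<^sub>R f x) / norm t) \<longlongrightarrow> 0) (at 0)"
      by (rule Lim_null_comparison)
    then show "((\<lambda>t. norm (\<alpha> x t - \<alpha> x 0 - (t - 0) *\<^sub>R f x) / norm (t - 0)) \<longlongrightarrow> 0) (at 0)"
      by (simp add: \<alpha>0)
  qed
  with cont \<alpha>0 norm that show ?thesis by blast
qed

section \<open>Differentials of the rigidity maps\<close>

lemma has_derivative_norm_sgn:
  fixes z :: "'a::real_inner"
  assumes "z \<noteq> 0"
  shows "(norm has_derivative (\<lambda>h. sgn z \<bullet> h)) (at z)"
  using has_derivative_norm[OF assms] by (simp add: inner_commute)

lemma has_derivative_abs_snd:
  fixes z :: "'a::real_normed_vector \<times> real"
  assumes "snd z \<noteq> 0"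
  shows "((\<lambda>z. \<bar>snd z\<bar>) has_derivative (\<lambda>h. sgn (snd z) * snd h)) (at z)"
  using has_derivative_compose[OF has_derivative_snd[OF has_derivative_ident] has_derivative_norm_sgn, of z UNIV] assms
  by simp

lemma has_derivative_norm_fst:
  fixes z :: "'a::real_inner \<times> real"
  assumes "fst z \<noteq> 0"
  shows "((\<lambda>z. norm (fst z)) has_derivative (\<lambda>h. sgn (fst z) \<bullet> fst h)) (at z)"
  using has_derivative_compose[OF has_derivative_fst[OF has_derivative_ident] has_derivative_norm_sgn, of z UNIV] assms
  by simp

lemma has_derivative_conical_norm:
  fixes z :: "'a::real_inner \<times> real"
  assumes "fst z \<noteq> 0" "snd z \<noteq> 0"
  shows "(conical_norm has_derivative (\<lambda>h. (sgn (fst z), sgn (snd z)) \<bullet> h)) (at z)"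
  using has_derivative_add[OF has_derivative_norm_fst[OF assms(1)] has_derivative_abs_snd[OF assms(2)]]
  unfolding conical_norm_def[abs_def] inner_prod_def by simp

lemma has_derivative_cylindrical_norm_fst:
  fixes z :: "'a::real_inner \<times> real"
  assumes "norm (fst z) > \<bar>snd z\<bar>"
  shows "(cylindrical_norm has_derivative (\<lambda>h. (sgn (fst z), 0) \<bullet> h)) (at z)"
proof (rule has_derivative_transform_within_open)
  let ?S = "{z :: 'a \<times> real. norm (fst z) > \<bar>snd z\<bar>}"
  show "open ?S" by (intro open_Collect_less continuous_intros)
  show "z \<in> ?S" using assms by simp
  show "((\<lambda>z. norm (fst z)) has_derivative (\<lambda>h. (sgn (fst z), 0) \<bullet> h)) (at z)"
    using has_derivative_norm_fst[of z] assms by (cases "fst z = 0") (auto simp: inner_prod_def)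
  show "norm (fst x) = cylindrical_norm x" if "x \<in> ?S" for x
    using that by (simp add: cylindrical_norm_def)
qed

lemma has_derivative_cylindrical_norm_snd:
  fixes z :: "'a::real_inner \<times> real"
  assumes "norm (fst z) < \<bar>snd z\<bar>"
  shows "(cylindrical_norm has_derivative (\<lambda>h. (0, sgn (snd z)) \<bullet> h)) (at z)"
proof (rule has_derivative_transform_within_open)
  let ?S = "{z :: 'a \<times> real. norm (fst z) < \<bar>snd z\<bar>}"
  show "open ?S" by (intro open_Collect_less continuous_intros)
  show "z \<in> ?S" using assms by simp
  have "snd z \<noteq> 0" using assms norm_ge_zero[of "fst z"] by auto
  then show "((\<lambda>z. \<bar>snd z\<bar>) has_derivative (\<lambda>h. (0, sgn (snd z)) \<bullet> h)) (at z)"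
    using has_derivative_abs_snd[of z] by (simp add: inner_prod_def)
  show "\<bar>snd x\<bar> = cylindrical_norm x" if "x \<in> ?S" for x
    using that by (simp add: cylindrical_norm_def)
qed

lemma edge_length_edge_diff:
  assumes "\<And>z. N (- z) = N z" "card e = 2"
  shows "edge_length N x e = N (edge_diff e x)"
proof -
  have "edge_length N x {src e, tgt e} = N (x $ src e - x $ tgt e)"
    using assms(1) by (rule edge_length_doubleton)
  moreover have "{src e, tgt e} = e" using src_tgt(1)[OF assms(2)] by simp
  ultimately show ?thesis by (simp add: edge_diff_def)
qed

lemma bounded_linear_edge_diff: "bounded_linear (edge_diff e :: 'a::euclidean_space ^ 'v::finite \<Rightarrow> 'a)"
  using linear_edge_diff linear_conv_bounded_linear by blast

lemma has_derivative_rigidity_map: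
  fixes p :: "'a::euclidean_space ^ 'v::finite"
  assumes N: "\<And>z. N (- z) = N z" and E: "simple_graph E"
    and g: "\<And>e. e \<in> E \<Longrightarrow> (N has_derivative (\<lambda>h. g e \<bullet> h)) (at (edge_diff e p))"
  shows "(rigidity_map N E has_derivative functional_map E (\<lambda>e x. g e \<bullet> edge_diff e x)) (at p)"
proof (subst has_derivative_componentwise_within, intro ballI)
  fix b :: "real ^ 'v set" assume "b \<in> Basis"
  then obtain e where b: "b = axis e 1" by (auto simp: Basis_vec_def)
  show "((\<lambda>x. rigidity_map N E x \<bullet> b) has_derivative
     (\<lambda>x. functional_map E (\<lambda>e x. g e \<bullet> edge_diff e x) x \<bullet> b)) (at p)"
  proof (cases "e \<in> E")
    case True
    have "card e = 2" using E True by (simp add: simple_graph_def)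
    then have "(\<lambda>x. rigidity_map N E x \<bullet> b) = (\<lambda>x. N (edge_diff e x))"
      using edge_length_edge_diff[of N e, OF N] True by (simp add: b inner_axis rigidity_map_def)
    moreover have "((\<lambda>x. N (edge_diff e x)) has_derivative (\<lambda>x. g e \<bullet> edge_diff e x)) (at p)"
      by (rule has_derivative_compose[OF bounded_linear_imp_has_derivative[OF bounded_linear_edge_diff] g[OF True]])
    ultimately show ?thesis using True by (simp add: b inner_axis functional_map_def)
  next
    case False
    then show ?thesis by (simp add: b inner_axis rigidity_map_def functional_map_def)
  qed
qed

lemma rigidity_differential_eq:
  fixes p :: "'a::euclidean_space ^ 'v::finite"
  assumes "\<And>z. N (- z) = N z" "simple_graph E"
    and "\<And>e. e \<in> E \<Longrightarrow> (N has_derivative (\<lambda>h. g e \<bullet> h)) (at (edge_diff e p))"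
  shows "rigidity_map N E differentiable (at p)"
    "rigidity_differential N E p = functional_map E (\<lambda>e x. g e \<bullet> edge_diff e x)"
  using has_derivative_rigidity_map[of N E g p, OF assms] frechet_derivative_at differentiableI
  unfolding rigidity_differential_def by (blast, metis)

text \<open>Moving only \<open>src e\<close> changes \<open>edge_diff e\<close> in any given
  direction, so a kink of \<open>N\<close> at a single edge vector already destroys
  differentiability of the whole rigidity map.\<close>

lemma well_positioned_directional:
  fixes p :: "'a::euclidean_space ^ 'v::finite"
  assumes N: "\<And>z. N (- z) = N z" and E: "simple_graph E" and wp: "well_positioned N E p" and e: "e \<in> E"
  shows "(\<lambda>t::real. N (edge_diff e p + t *\<^sub>R z)) differentiable (at 0)"
proof -
  have "card e = 2" using E e by (simp add: simple_graph_def)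
  note st = src_tgt(2)[OF this]
  let ?\<gamma> = "\<lambda>t::real. p + t *\<^sub>R axis (src e) z"
  have "((\<lambda>x. rigidity_map N E x \<bullet> axis e 1) \<circ> ?\<gamma>) differentiable (at 0)"
  proof (rule differentiable_chain_at)
    show "?\<gamma> differentiable (at 0)"
      by (intro differentiable_add differentiable_const differentiable_scaleR differentiable_ident)
    show "(\<lambda>x. rigidity_map N E x \<bullet> axis e 1) differentiable at (?\<gamma> 0)"
      using wp by (intro differentiable_inner differentiable_const) (simp add: well_positioned_def)
  qed
  moreover have "(\<lambda>x. rigidity_map N E x \<bullet> axis e 1) \<circ> ?\<gamma> = (\<lambda>t. N (edge_diff e p + t *\<^sub>R z))"
    using edge_length_edge_diff[of N e, OF N \<open>card e = 2\<close>] e st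
    by (intro ext) (simp add: inner_axis rigidity_map_def edge_diff_def, simp add: axis_def algebra_simps)
  ultimately show ?thesis by simp
qed

section \<open>Well-positioned placements in the three spaces\<close>

lemma framework_iff: "simple_graph E \<Longrightarrow> framework E p \<longleftrightarrow> (\<forall>e\<in>E. edge_diff e p \<noteq> 0)"
proof
  assume "simple_graph E" "framework E p"
  then have "{src e, tgt e} \<in> E" if "e \<in> E" for e
    using src_tgt(1)[of e] that by (simp add: simple_graph_def)
  with \<open>framework E p\<close> show "\<forall>e\<in>E. edge_diff e p \<noteq> 0"
    by (simp add: framework_def edge_diff_def)
next
  assume E: "simple_graph E" and *: "\<forall>e\<in>E. edge_diff e p \<noteq> 0"
  show "framework E p" unfolding framework_def
  proof (intro allI impI)
    fix v w assume e: "{v, w} \<in> E"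
    then show "p $ v \<noteq> p $ w"
      using src_tgt_doubleton[OF simple_graph_edge[OF E e]] * by (auto simp: edge_diff_def)
  qed
qed

text \<open>Solved for \<open>\<bar>t\<bar>\<close>, a differentiable \<open>f\<close> would make
  \<open>norm t\<close> plus a differentiable function constant, which would force the derivative of
  \<open>\<lambda>t. t\<close> to vanish.\<close>

lemma not_differentiable_abs_plus_linear:
  fixes a b :: real
  assumes "k \<noteq> 0" "f differentiable (at 0)"
    and f: "\<And>t. \<bar>t\<bar> < 1 \<Longrightarrow> f t = a + b * t + k * \<bar>t\<bar>"
  shows False
proof -
  have "(\<lambda>t. (f t - a - b * t) / k) differentiable (at 0)"
    using assms(1,2) by (intro differentiable_divide differentiable_diff differentiable_mult differentiable_const differentiable_ident) auto
  then have "(\<lambda>t. - ((f t - a - b * t) / k)) differentiable (at 0)" by (rule differentiable_minus)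
  then obtain D where "((\<lambda>t. - ((f t - a - b * t) / k)) has_derivative (\<lambda>t. t * D)) (at 0)"
    unfolding real_differentiable_def has_field_derivative_def by (auto simp: mult.commute[of _ "_::real"])
  moreover have "((\<lambda>t::real. t) has_derivative (\<lambda>t. t *\<^sub>R 1)) (at 0)" by simp
  moreover have "norm t + - ((f t - a - b * t) / k) = - ((f 0 - a - b * 0) / k)" if "\<bar>t\<bar> < 1" for t
    using f[of t] f[of 0] that assms(1) by simp
  ultimately show False
    using norm_plus_constant_imp_derivative_0(1)[of "\<lambda>t. t" 1 "\<lambda>t. - ((f t - a - b * t) / k)" D] by simp
qed

lemma well_positioned_norm:
  assumes "simple_graph E"
  shows "well_positioned norm E (q :: 'a::euclidean_space ^ 'v::finite) \<longleftrightarrow> (\<forall>e\<in>E. edge_diff e q \<noteq> 0)"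
    "well_positioned norm E q \<Longrightarrow>
       rigidity_differential norm E q = functional_map E (\<lambda>e x. sgn (edge_diff e q) \<bullet> edge_diff e x)"
proof -
  have *: "rigidity_map norm E differentiable (at q)"
    "rigidity_differential norm E q = functional_map E (\<lambda>e x. sgn (edge_diff e q) \<bullet> edge_diff e x)"
    if "\<forall>e\<in>E. edge_diff e q \<noteq> 0"
    using rigidity_differential_eq[of norm E "\<lambda>e. sgn (edge_diff e q)" q] assms that has_derivative_norm_sgn
    by auto
  then show "well_positioned norm E q \<longleftrightarrow> (\<forall>e\<in>E. edge_diff e q \<noteq> 0)"
    using framework_iff[OF assms, of q] by (auto simp: well_positioned_def)
  then show "rigidity_differential norm E q = functional_map E (\<lambda>e x. sgn (edge_diff e q) \<bullet> edge_diff e x)"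
    if "well_positioned norm E q" using *(2) that by blast
qed

text \<open>A vanishing component of an edge vector leaves a kink: moving in that component along a
  unit vector changes the length by exactly \<open>\<bar>t\<bar>\<close>.\<close>

lemma well_positioned_conical:
  fixes p :: "('a::euclidean_space \<times> real) ^ 'v::finite"
  assumes E: "simple_graph E"
  shows "well_positioned conical_norm E p \<longleftrightarrow> (\<forall>e\<in>E. fst (edge_diff e p) \<noteq> 0 \<and> snd (edge_diff e p) \<noteq> 0)"
      (is "_ \<longleftrightarrow> ?R")
    "well_positioned conical_norm E p \<Longrightarrow> rigidity_differential conical_norm E p =
       functional_map E (\<lambda>e x. (sgn (fst (edge_diff e p)), sgn (snd (edge_diff e p))) \<bullet> edge_diff e x)"
proof -
  have sym: "conical_norm (- z) = conical_norm z" for z :: "'a \<times> real" by (simp add: conical_norm_def)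
  have *: "rigidity_map conical_norm E differentiable (at p)"
    "rigidity_differential conical_norm E p =
      functional_map E (\<lambda>e x. (sgn (fst (edge_diff e p)), sgn (snd (edge_diff e p))) \<bullet> edge_diff e x)"
    if ?R
    using rigidity_differential_eq[of conical_norm E "\<lambda>e. (sgn (fst (edge_diff e p)), sgn (snd (edge_diff e p)))" p]
      E that has_derivative_conical_norm[of "edge_diff _ p"] sym by auto
  have **: "fst (edge_diff e p) \<noteq> 0 \<and> snd (edge_diff e p) \<noteq> 0" if wp: "well_positioned conical_norm E p" and e: "e \<in> E" for e
  proof (rule ccontr)
    let ?d = "edge_diff e p"
    assume "\<not> ?thesis"
    then consider "fst ?d = 0" | "snd ?d = 0" by blast
    then show False
    proof cases
      case 1
      obtain b :: 'a where b: "b \<in> Basis" using nonempty_Basis by blast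
      have "(\<lambda>t. conical_norm (?d + t *\<^sub>R (b, 0))) differentiable (at 0)"
        using sym E wp e by (rule well_positioned_directional)
      then show False
        by (rule not_differentiable_abs_plus_linear[of 1 _ "\<bar>snd ?d\<bar>" 0, rotated])
          (use 1 b in \<open>auto simp: conical_norm_def\<close>)
    next
      case 2
      have "(\<lambda>t. conical_norm (?d + t *\<^sub>R (0, 1))) differentiable (at 0)"
        using sym E wp e by (rule well_positioned_directional)
      then show False
        by (rule not_differentiable_abs_plus_linear[of 1 _ "norm (fst ?d)" 0, rotated])
          (use 2 in \<open>auto simp: conical_norm_def\<close>)
    qed
  qed
  have "?R \<Longrightarrow> framework E p" using framework_iff[OF E, of p] by fastforce
  then have "?R \<Longrightarrow> well_positioned conical_norm E p" using *(1) by (simp only: well_positioned_def)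
  with ** show iff: "well_positioned conical_norm E p \<longleftrightarrow> ?R" by blast
  show "well_positioned conical_norm E p \<Longrightarrow> rigidity_differential conical_norm E p =
       functional_map E (\<lambda>e x. (sgn (fst (edge_diff e p)), sgn (snd (edge_diff e p))) \<bullet> edge_diff e x)"
    using *(2) iff by blast
qed

lemma well_positioned_cylindrical:
  fixes p :: "('a::euclidean_space \<times> real) ^ 'v::finite"
  assumes E: "simple_graph E"
  defines "g \<equiv> \<lambda>e. if norm (fst (edge_diff e p)) > \<bar>snd (edge_diff e p)\<bar>
    then (sgn (fst (edge_diff e p)), 0) else (0, sgn (snd (edge_diff e p)))"
  shows "well_positioned cylindrical_norm E p \<longleftrightarrow> (\<forall>e\<in>E. norm (fst (edge_diff e p)) \<noteq> \<bar>snd (edge_diff e p)\<bar>)"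
      (is "_ \<longleftrightarrow> ?R")
    "well_positioned cylindrical_norm E p \<Longrightarrow> rigidity_differential cylindrical_norm E p =
       functional_map E (\<lambda>e x. g e \<bullet> edge_diff e x)"
proof -
  have sym: "cylindrical_norm (- z) = cylindrical_norm z" for z :: "'a \<times> real" by (simp add: cylindrical_norm_def)
  have *: "rigidity_map cylindrical_norm E differentiable (at p)"
    "rigidity_differential cylindrical_norm E p = functional_map E (\<lambda>e x. g e \<bullet> edge_diff e x)"
    if ?R
  proof -
    have "(cylindrical_norm has_derivative (\<lambda>h. g e \<bullet> h)) (at (edge_diff e p))" if "e \<in> E" for e
      using \<open>?R\<close> that has_derivative_cylindrical_norm_fst[of "edge_diff e p"]
        has_derivative_cylindrical_norm_snd[of "edge_diff e p"]
      by (cases "norm (fst (edge_diff e p)) > \<bar>snd (edge_diff e p)\<bar>") (auto simp: g_def)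
    from rigidity_differential_eq[of cylindrical_norm E g p, OF sym E this]
    show "rigidity_map cylindrical_norm E differentiable (at p)"
      "rigidity_differential cylindrical_norm E p = functional_map E (\<lambda>e x. g e \<bullet> edge_diff e x)" by auto
  qed
  have **: "norm (fst (edge_diff e p)) \<noteq> \<bar>snd (edge_diff e p)\<bar>" if wp: "well_positioned cylindrical_norm E p" and e: "e \<in> E" for e
  proof
    let ?d = "edge_diff e p"
    assume eq: "norm (fst ?d) = \<bar>snd ?d\<bar>"
    \<comment> \<open>The framework condition enters here: it makes the common size of both
      components positive.\<close>
    have "?d \<noteq> 0" using wp e framework_iff[OF E] by (auto simp: well_positioned_def)
    then have nz: "norm (fst ?d) \<noteq> 0" using eq by (auto simp: prod_eq_iff)
    \<comment> \<open>Along the radial direction of the first component the length is a multiple of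
      \<open>max (1 + t) 1\<close>, which is \<open>1 + t / 2 + \<bar>t\<bar> / 2\<close>.\<close>
    have "(\<lambda>t. cylindrical_norm (?d + t *\<^sub>R (fst ?d, 0))) differentiable (at 0)"
      using sym E wp e by (rule well_positioned_directional)
    then show False
    proof (rule not_differentiable_abs_plus_linear[rotated])
      show "norm (fst ?d) / 2 \<noteq> 0" using nz by simp
      fix t :: real assume t: "\<bar>t\<bar> < 1"
      have "norm (fst ?d + t *\<^sub>R fst ?d) = (1 + t) * norm (fst ?d)"
        using t norm_scaleR[of "1 + t" "fst ?d"] by (simp add: scaleR_add_left)
      then have "cylindrical_norm (?d + t *\<^sub>R (fst ?d, 0)) = max ((1 + t) * norm (fst ?d)) (1 * norm (fst ?d))"
        using eq by (simp add: cylindrical_norm_def)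
      also have "\<dots> = max (1 + t) 1 * norm (fst ?d)"
        by (simp add: max_mult_distrib_right)
      also have "\<dots> = norm (fst ?d) + norm (fst ?d) / 2 * t + norm (fst ?d) / 2 * \<bar>t\<bar>"
        by (simp add: max_def abs_if field_simps)
      finally show "cylindrical_norm (?d + t *\<^sub>R (fst ?d, 0)) =
        norm (fst ?d) + norm (fst ?d) / 2 * t + norm (fst ?d) / 2 * \<bar>t\<bar>" .
    qed
  qed
  have "?R \<Longrightarrow> framework E p" using framework_iff[OF E, of p] by fastforce
  then have "?R \<Longrightarrow> well_positioned cylindrical_norm E p" using *(1) by (simp only: well_positioned_def)
  with ** show iff: "well_positioned cylindrical_norm E p \<longleftrightarrow> ?R" by blast
  show "well_positioned cylindrical_norm E p \<Longrightarrow> rigidity_differential cylindrical_norm E p =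
       functional_map E (\<lambda>e x. g e \<bullet> edge_diff e x)"
    using *(2) iff by blast
qed

section \<open>Infinitesimal motions of the Euclidean, cylindrical and conical norms\<close>

lemma infinitesimal_motion_derivative:
  assumes "\<eta> \<in> infinitesimal_motions N" "(N has_derivative D) (at (x - y))"
  shows "D (\<eta> x - \<eta> y) = 0"
proof -
  obtain \<beta> where \<beta>: "(\<beta> has_derivative (\<lambda>t. t *\<^sub>R (\<eta> x - \<eta> y))) (at (0::real))"
    "\<beta> 0 = x - y" "\<And>t. \<bar>t\<bar> \<le> 1 \<Longrightarrow> N (\<beta> t) = N (x - y)"
    using infinitesimal_motion_path[OF assms(1), where x = x and y = y] by metis
  have "frechet_derivative N (at (\<beta> 0)) (\<eta> x - \<eta> y) = 0"
  proof (rule frechet_derivative_eq_0_of_constant_path)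
    show "N differentiable at (\<beta> 0)" using assms(2) \<beta>(2) by (auto simp: differentiable_def)
    show "(\<beta> has_vector_derivative \<eta> x - \<eta> y) (at 0)" using \<beta>(1) by (simp add: has_vector_derivative_def)
    show "N (\<beta> t) = N (\<beta> 0)" if "\<bar>t\<bar> \<le> 1" for t using \<beta>(3)[OF that] \<beta>(2) by simp
  qed
  then show ?thesis using frechet_derivative_at[OF assms(2)] \<beta>(2) by simp
qed

lemma infinitesimal_motions_norm: "infinitesimal_motions norm = euclidean_motions"
proof (intro equalityI subsetI)
  fix \<eta> :: "'a \<Rightarrow> 'a" assume \<eta>: "\<eta> \<in> infinitesimal_motions norm"
  have "(\<eta> x - \<eta> y) \<bullet> (x - y) = 0" for x y
  proof (cases "x = y")
    case False
    then have "sgn (x - y) \<bullet> (\<eta> x - \<eta> y) = 0"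
      using infinitesimal_motion_derivative[OF \<eta> has_derivative_norm_sgn] by simp
    then show ?thesis using False by (simp add: sgn_div_norm inner_commute)
  qed simp
  then show "\<eta> \<in> euclidean_motions" by (simp add: euclidean_motions_def)
next
  fix \<eta> :: "'a \<Rightarrow> 'a" assume "\<eta> \<in> euclidean_motions"
  then obtain f b where f: "linear f" "\<And>x. f x \<bullet> x = 0" and \<eta>: "\<eta> = (\<lambda>x. f x + b)"
    unfolding euclidean_motions_iff_affine by blast
  obtain \<alpha> where \<alpha>: "\<And>x. continuous_on UNIV (\<alpha> x)" "\<And>x. \<alpha> x 0 = x"
    "\<And>x. (\<alpha> x has_vector_derivative f x) (at 0)" "\<And>x y t. norm (\<alpha> x t - \<alpha> y t) = norm (x - y)"
    using skew_motion_path[OF f] by metis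
  have d: "((\<lambda>t. \<alpha> x t + t *\<^sub>R b) has_vector_derivative \<eta> x) (at 0)" for x
    unfolding \<eta> by (intro has_vector_derivative_add \<alpha>) (auto intro!: derivative_eq_intros)
  have "rigid_motion norm (\<lambda>x t. \<alpha> x t + t *\<^sub>R b)"
    unfolding rigid_motion_def
  proof (intro conjI allI ballI)
    show "continuous_on {-1..1} (\<lambda>t. \<alpha> x t + t *\<^sub>R b)" for x
      by (intro continuous_intros continuous_on_subset[OF \<alpha>(1)]) simp
    show "(\<lambda>t. \<alpha> x t + t *\<^sub>R b) differentiable at 0" for x
      using d[of x] unfolding has_vector_derivative_def differentiable_def by blast
  qed (simp_all add: \<alpha>)
  moreover have "\<eta> x = vector_derivative (\<lambda>t. \<alpha> x t + t *\<^sub>R b) (at 0)" for x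
    using vector_derivative_at[OF d] by simp
  ultimately show "\<eta> \<in> infinitesimal_motions norm"
    unfolding infinitesimal_motions_def by blast
qed

definition product_motions :: "('a::euclidean_space \<times> real \<Rightarrow> 'a \<times> real) set" where
  "product_motions = {\<lambda>z. (\<eta> (fst z), c) | \<eta> c. \<eta> \<in> euclidean_motions}"

text \<open>A motion of the base combined with a vertical drift keeps \<open>norm (fst z)\<close>
  and \<open>\<bar>snd z\<bar>\<close> of all differences, so one argument covers every norm built
  from these two numbers.\<close>

lemma product_motions_subset:
  fixes N :: "'a::euclidean_space \<times> real \<Rightarrow> real"
  assumes N: "\<And>z. N z = m (norm (fst z)) \<bar>snd z\<bar>"
  shows "product_motions \<subseteq> infinitesimal_motions N"
proof
  fix \<zeta> :: "'a \<times> real \<Rightarrow> 'a \<times> real" assume "\<zeta> \<in> product_motions"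
  then obtain \<eta> c where \<zeta>: "\<zeta> = (\<lambda>z. (\<eta> (fst z), c))" and "\<eta> \<in> infinitesimal_motions norm"
    unfolding product_motions_def infinitesimal_motions_norm by blast
  then obtain \<alpha> where \<alpha>: "rigid_motion norm \<alpha>" and \<eta>: "\<And>x. \<eta> x = vector_derivative (\<alpha> x) (at 0)"
    unfolding infinitesimal_motions_def by blast
  note D = rigid_motionD[OF \<alpha>]
  let ?\<alpha> = "\<lambda>z t. (\<alpha> (fst z) t, snd z + t * c)"
  have d: "(?\<alpha> z has_vector_derivative \<zeta> z) (at 0)" for z
    unfolding \<zeta> \<eta> by (intro has_vector_derivative_Pair D(3)) (auto intro!: derivative_eq_intros)
  have "rigid_motion N ?\<alpha>"
    unfolding rigid_motion_def
  proof (intro conjI allI ballI)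
    fix z w :: "'a \<times> real" and t :: real
    show "continuous_on {-1..1} (?\<alpha> z)" by (intro continuous_intros D(1))
    show "?\<alpha> z 0 = z" using D(2) by simp
    show "?\<alpha> z differentiable at 0" using d[of z] by (auto simp: has_vector_derivative_def differentiable_def)
    assume "t \<in> {-1..1}"
    then show "N (?\<alpha> z t - ?\<alpha> w t) = N (z - w)" by (simp add: N D(4))
  qed
  moreover have "\<zeta> z = vector_derivative (?\<alpha> z) (at 0)" for z
    using vector_derivative_at[OF d] by simp
  ultimately show "\<zeta> \<in> infinitesimal_motions N"
    unfolding infinitesimal_motions_def by blast
qed

lemma product_motionsI:
  assumes "\<And>x y y'. fst (\<zeta> (x, y)) = fst (\<zeta> (x, y'))"
    and "\<And>x x' y. (fst (\<zeta> (x, y)) - fst (\<zeta> (x', y))) \<bullet> (x - x') = 0"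
    and "\<And>z z'. snd (\<zeta> z) = snd (\<zeta> z')"
  shows "\<zeta> \<in> product_motions"
proof -
  have "\<zeta> z = (fst (\<zeta> (fst z, 0)), snd (\<zeta> 0))" for z
    using assms(1)[of "fst z" "snd z" 0] assms(3)[of z 0] by (simp add: prod_eq_iff)
  then have "\<zeta> = (\<lambda>z. (fst (\<zeta> (fst z, 0)), snd (\<zeta> 0)))" by blast
  moreover have "(\<lambda>x. fst (\<zeta> (x, 0))) \<in> euclidean_motions"
    using assms(2) by (simp add: euclidean_motions_def)
  ultimately show ?thesis unfolding product_motions_def
    by (intro CollectI exI[of _ "\<lambda>x. fst (\<zeta> (x, 0))"] exI[of _ "snd (\<zeta> 0)"]) blast
qed

text \<open>The norm is differentiable at flat and at steep differences. Flat ones give the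
  Euclidean condition on the first component, steep ones equality of the second; the remaining pairs
  are compared through a third point that is far enough away.\<close>

lemma infinitesimal_motions_cylindrical:
  "infinitesimal_motions (cylindrical_norm :: 'a::euclidean_space \<times> real \<Rightarrow> real) = product_motions"
proof (intro equalityI subsetI)
  fix \<zeta> :: "'a \<times> real \<Rightarrow> 'a \<times> real" assume \<zeta>: "\<zeta> \<in> infinitesimal_motions cylindrical_norm"
  have H: "sgn (x - x') \<bullet> (fst (\<zeta> (x, y)) - fst (\<zeta> (x', y'))) = 0" if "norm (x - x') > \<bar>y - y'\<bar>" for x x' y y'
    using infinitesimal_motion_derivative[OF \<zeta> has_derivative_cylindrical_norm_fst, of "(x, y)" "(x', y')"] that
    by (simp add: inner_prod_def)
  have H: "(fst (\<zeta> (x, y)) - fst (\<zeta> (x', y'))) \<bullet> (x - x') = 0" if "norm (x - x') > \<bar>y - y'\<bar>" for x x' y y'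
    using H[OF that] that by (auto simp: sgn_div_norm inner_commute)
  have T: "snd (\<zeta> (x, y)) = snd (\<zeta> (x', y'))" if "norm (x - x') < \<bar>y - y'\<bar>" for x x' y y'
    using infinitesimal_motion_derivative[OF \<zeta> has_derivative_cylindrical_norm_snd, of "(x, y)" "(x', y')"] that
      norm_ge_zero[of "x - x'"]
    by (auto simp: inner_prod_def sgn_if split: if_splits)
  show "\<zeta> \<in> product_motions"
  proof (rule product_motionsI)
    fix x x' :: 'a and y y' :: real
    show "(fst (\<zeta> (x, y)) - fst (\<zeta> (x', y))) \<bullet> (x - x') = 0"
      using H[of y y x x'] by (cases "x = x'") auto
    show "fst (\<zeta> (x, y)) = fst (\<zeta> (x, y'))"
    proof (rule ccontr)
      let ?u = "fst (\<zeta> (x, y)) - fst (\<zeta> (x, y'))"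
      assume "\<not> ?thesis"
      then have u: "norm ?u > 0" by simp
      \<comment> \<open>\<open>k\<close> makes the displaced point flat relative to both
        \<open>(x, y)\<close> and \<open>(x, y')\<close>; the two orthogonality relations then
        differ by \<open>?u \<bullet> (k *\<^sub>R ?u)\<close>.\<close>
      define k where "k = (\<bar>y - y'\<bar> + 1) / norm ?u"
      have k: "k > 0" "norm (k *\<^sub>R ?u) > \<bar>y - y'\<bar>" using u by (simp_all add: k_def)
      have "(fst (\<zeta> (x + k *\<^sub>R ?u, y)) - fst (\<zeta> (x, y))) \<bullet> (k *\<^sub>R ?u) = 0"
        "(fst (\<zeta> (x + k *\<^sub>R ?u, y)) - fst (\<zeta> (x, y'))) \<bullet> (k *\<^sub>R ?u) = 0"
        using H[of y y "x + k *\<^sub>R ?u" x] H[of y y' "x + k *\<^sub>R ?u" x] k u by simp_all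
      then have "?u \<bullet> (k *\<^sub>R ?u) = 0" by (simp only: inner_diff_left)
      then show False using k u by simp
    qed
    fix z z' :: "'a \<times> real"
    \<comment> \<open>The height \<open>M\<close> puts \<open>(0, M)\<close> steeply above both
      \<open>z\<close> and \<open>z'\<close>.\<close>
    define M where "M = \<bar>snd z\<bar> + \<bar>snd z'\<bar> + norm (fst z) + norm (fst z') + 1"
    have "snd (\<zeta> (0, M)) = snd (\<zeta> (fst z, snd z))"
    proof (rule T)
      have "norm (fst z) < M - snd z" using norm_ge_zero[of "fst z'"] unfolding M_def by linarith
      then show "norm (0 - fst z) < \<bar>M - snd z\<bar>" by simp
    qed
    moreover have "snd (\<zeta> (0, M)) = snd (\<zeta> (fst z', snd z'))"
    proof (rule T)
      have "norm (fst z') < M - snd z'" using norm_ge_zero[of "fst z"] unfolding M_def by linarith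
      then show "norm (0 - fst z') < \<bar>M - snd z'\<bar>" by simp
    qed
    ultimately show "snd (\<zeta> z) = snd (\<zeta> z')" by simp
  qed
next
  fix \<zeta> :: "'a \<times> real \<Rightarrow> 'a \<times> real" assume "\<zeta> \<in> product_motions"
  then show "\<zeta> \<in> infinitesimal_motions cylindrical_norm"
    using product_motions_subset[of cylindrical_norm max] by (auto simp: cylindrical_norm_def)
qed

text \<open>Horizontal and vertical differences already determine the motion, although the norm has
  kinks there: one component starts at zero, the length of the other is smooth, and
  \<open>norm_plus_constant_imp_derivative_0\<close> makes both derivatives vanish.\<close>

lemma infinitesimal_motions_conical:
  "infinitesimal_motions (conical_norm :: 'a::euclidean_space \<times> real \<Rightarrow> real) = product_motions"
proof (intro equalityI subsetI)
  fix \<zeta> :: "'a \<times> real \<Rightarrow> 'a \<times> real" assume \<zeta>: "\<zeta> \<in> infinitesimal_motions conical_norm"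
  have path: "\<exists>\<beta>. (\<beta> has_derivative (\<lambda>t. t *\<^sub>R (\<zeta> z - \<zeta> z'))) (at (0::real)) \<and> \<beta> 0 = z - z' \<and>
      (\<forall>t. \<bar>t\<bar> < 1 \<longrightarrow> norm (fst (\<beta> t)) + \<bar>snd (\<beta> t)\<bar> = norm (fst z - fst z') + \<bar>snd z - snd z'\<bar>)" for z z'
  proof -
    obtain \<beta> where "(\<beta> has_derivative (\<lambda>t. t *\<^sub>R (\<zeta> z - \<zeta> z'))) (at (0::real))" "\<beta> 0 = z - z'"
      "\<And>t. \<bar>t\<bar> \<le> 1 \<Longrightarrow> conical_norm (\<beta> t) = conical_norm (z - z')"
      using infinitesimal_motion_path[OF \<zeta>, where x = z and y = z'] by metis
    then show ?thesis by (intro exI[of _ \<beta>]) (simp add: conical_norm_def)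
  qed
  have V: "\<zeta> (x, y) = \<zeta> (x, y')" for x y y'
  proof (cases "y = y'")
    case False
    obtain \<beta> where \<beta>: "(\<beta> has_derivative (\<lambda>t. t *\<^sub>R (\<zeta> (x, y) - \<zeta> (x, y')))) (at (0::real))" "\<beta> 0 = (0, y - y')"
      "\<And>t. \<bar>t\<bar> < 1 \<Longrightarrow> norm (fst (\<beta> t)) + \<bar>snd (\<beta> t)\<bar> = \<bar>y - y'\<bar>"
      using path[of "(x, y)" "(x, y')"] by auto
    have 1: "((\<lambda>t. fst (\<beta> t)) has_derivative (\<lambda>t. t *\<^sub>R fst (\<zeta> (x, y) - \<zeta> (x, y')))) (at 0)"
      using has_derivative_fst[OF \<beta>(1)] by simp
    have 2: "((\<lambda>t. \<bar>snd (\<beta> t)\<bar>) has_derivative (\<lambda>t. t * (sgn (y - y') * snd (\<zeta> (x, y) - \<zeta> (x, y'))))) (at 0)"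
      using has_derivative_compose[OF \<beta>(1) has_derivative_abs_snd] False \<beta>(2) by (simp add: algebra_simps)
    have "norm (fst (\<beta> t)) + \<bar>snd (\<beta> t)\<bar> = \<bar>snd (\<beta> 0)\<bar>" if "\<bar>t\<bar> < 1" for t
      using \<beta>(2) \<beta>(3)[OF that] by simp
    from norm_plus_constant_imp_derivative_0[OF 1 _ 2 this] \<beta>(2) False
    show ?thesis by (auto simp: prod_eq_iff sgn_if split: if_splits)
  qed simp
  have R: "snd (\<zeta> (x, y)) = snd (\<zeta> (x', y)) \<and> (fst (\<zeta> (x, y)) - fst (\<zeta> (x', y))) \<bullet> (x - x') = 0" for x x' y
  proof (cases "x = x'")
    case False
    obtain \<beta> where \<beta>: "(\<beta> has_derivative (\<lambda>t. t *\<^sub>R (\<zeta> (x, y) - \<zeta> (x', y)))) (at (0::real))" "\<beta> 0 = (x - x', 0)"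
      "\<And>t. \<bar>t\<bar> < 1 \<Longrightarrow> norm (fst (\<beta> t)) + \<bar>snd (\<beta> t)\<bar> = norm (x - x')"
      using path[of "(x, y)" "(x', y)"] by auto
    have 1: "((\<lambda>t. snd (\<beta> t)) has_derivative (\<lambda>t. t *\<^sub>R snd (\<zeta> (x, y) - \<zeta> (x', y)))) (at 0)"
      using has_derivative_snd[OF \<beta>(1)] by simp
    have 2: "((\<lambda>t. norm (fst (\<beta> t))) has_derivative (\<lambda>t. t * (sgn (x - x') \<bullet> fst (\<zeta> (x, y) - \<zeta> (x', y))))) (at 0)"
      using has_derivative_compose[OF \<beta>(1) has_derivative_norm_fst] False \<beta>(2) by simp
    have "norm (snd (\<beta> t)) + norm (fst (\<beta> t)) = norm (fst (\<beta> 0))" if "\<bar>t\<bar> < 1" for t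
      using \<beta>(2) \<beta>(3)[OF that] by simp
    from norm_plus_constant_imp_derivative_0[OF 1 _ 2 this] \<beta>(2) False
    show ?thesis by (auto simp: sgn_div_norm inner_commute)
  qed simp
  show "\<zeta> \<in> product_motions"
  proof (rule product_motionsI)
    show "snd (\<zeta> z) = snd (\<zeta> z')" for z z'
      using V[of "fst z" "snd z" "snd z'"] R[of "fst z" "snd z'" "fst z'"] by simp
    show "fst (\<zeta> (x, y)) = fst (\<zeta> (x, y'))" for x y y' using V[of x y y'] by simp
  qed (use R in blast)
next
  fix \<zeta> :: "'a \<times> real \<Rightarrow> 'a \<times> real" assume "\<zeta> \<in> product_motions"
  then show "\<zeta> \<in> infinitesimal_motions conical_norm"
    using product_motions_subset[of conical_norm "(+)"] by (auto simp: conical_norm_def)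
qed

section \<open>From product spaces to the base space\<close>

definition fstv :: "('a \<times> 'b) ^ 'v \<Rightarrow> 'a ^ 'v" where "fstv x = (\<chi> v. fst (x $ v))"
definition sndv :: "('a \<times> 'b) ^ 'v \<Rightarrow> 'b ^ 'v" where "sndv x = (\<chi> v. snd (x $ v))"
definition pairv :: "'a ^ 'v \<Rightarrow> 'b ^ 'v \<Rightarrow> ('a \<times> 'b) ^ 'v" where "pairv q s = (\<chi> v. (q $ v, s $ v))"

lemma fstv_pairv [simp]: "fstv (pairv q s) = q" and sndv_pairv [simp]: "sndv (pairv q s) = s"
  and pairv_fstv_sndv [simp]: "pairv (fstv x) (sndv x) = x"
  by (simp_all add: fstv_def sndv_def pairv_def vec_eq_iff)

lemma linear_fstv: "linear fstv" and linear_sndv: "linear sndv"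
  by (auto intro!: linearI simp: fstv_def sndv_def vec_eq_iff)

lemma edge_diff_pair: "edge_diff e x = (edge_diff e (fstv x), edge_diff e (sndv x))"
  by (simp add: edge_diff_def fstv_def sndv_def prod_eq_iff)

lemma edge_diff_0 [simp]: "edge_diff e 0 = 0"
  by (simp add: edge_diff_def)

lemma linear_inner_edge_diff: "linear (\<lambda>x. g \<bullet> edge_diff e x)"
  using linear_compose[OF linear_edge_diff bounded_linear.linear[OF bounded_linear_inner_right[of g]], of e]
  by (simp add: o_def)

lemma linear_mult_edge_diff: "linear (\<lambda>x. (c::real) * edge_diff e x)"
  using linear_inner_edge_diff[of c e] by simp

lemma dual_system_product:
  fixes f :: "'i \<Rightarrow> 'a::real_vector ^ 'v::finite \<Rightarrow> real" and g :: "'i \<Rightarrow> 'b::real_vector ^ 'v \<Rightarrow> real"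
  assumes HT: "H \<inter> T = {}" and f: "\<And>e. e \<in> H \<Longrightarrow> linear (f e)" and g: "\<And>e. e \<in> T \<Longrightarrow> linear (g e)"
  shows "dual_system (H \<union> T) (\<lambda>e x. if e \<in> H then f e (fstv x) else g e (sndv x)) \<longleftrightarrow>
    dual_system H f \<and> dual_system T g"
proof
  assume "dual_system (H \<union> T) (\<lambda>e x. if e \<in> H then f e (fstv x) else g e (sndv x))"
  then obtain b where b: "\<And>e e'. e \<in> H \<union> T \<Longrightarrow> e' \<in> H \<union> T \<Longrightarrow>
      (if e \<in> H then f e (fstv (b e')) else g e (sndv (b e'))) = (if e = e' then 1 else 0)"
    unfolding dual_system_def by blast
  have "f e (fstv (b e')) = (if e = e' then 1 else 0)" if "e \<in> H" "e' \<in> H" for e e'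
    using b[of e e'] that by simp
  moreover have "g e (sndv (b e')) = (if e = e' then 1 else 0)" if "e \<in> T" "e' \<in> T" for e e'
  proof -
    have "e \<notin> H" using that HT by blast
    then show ?thesis using b[of e e'] that by simp
  qed
  ultimately show "dual_system H f \<and> dual_system T g"
    unfolding dual_system_def
    by (intro conjI exI[of _ "\<lambda>e. fstv (b e)"] exI[of _ "\<lambda>e. sndv (b e)"] ballI)
next
  assume "dual_system H f \<and> dual_system T g"
  then obtain b c where b: "\<And>e e'. e \<in> H \<Longrightarrow> e' \<in> H \<Longrightarrow> f e (b e') = (if e = e' then 1 else 0)"
    and c: "\<And>e e'. e \<in> T \<Longrightarrow> e' \<in> T \<Longrightarrow> g e (c e') = (if e = e' then 1 else 0)"
    unfolding dual_system_def by blast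
  define d where "d e = (if e \<in> H then pairv (b e) 0 else pairv 0 (c e))" for e
  have "(if e \<in> H then f e (fstv (d e')) else g e (sndv (d e'))) = (if e = e' then 1 else 0)"
    if "e \<in> H \<union> T" "e' \<in> H \<union> T" for e e'
    using that b[of e e'] c[of e e'] linear_0[OF f, of e] linear_0[OF g, of e]
    by (auto simp: d_def)
  then show "dual_system (H \<union> T) (\<lambda>e x. if e \<in> H then f e (fstv x) else g e (sndv x))"
    unfolding dual_system_def by (intro exI[of _ d] ballI)
qed

lemma minimally_infinitesimally_rigid_iff:
  fixes p :: "'a::euclidean_space ^ 'v::finite"
  assumes "well_positioned N E p" "rigidity_differential N E p = functional_map E f"
    "\<And>e. e \<in> E \<Longrightarrow> linear (f e)"
  shows "minimally_infinitesimally_rigid N E p \<longleftrightarrow>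
    dual_system E f \<and> {x. \<forall>e\<in>E. f e x = 0} = trivial_motions N p"
  using assms dual_system_iff_range[of E f]
  by (auto simp: minimally_infinitesimally_rigid_def infinitesimally_rigid_def independent_framework_def
      edge_space_def functional_map_eq_0)

lemma minimally_rigid_norm_iff:
  assumes "simple_graph H"
  shows "minimally_rigid (norm :: 'a::euclidean_space \<Rightarrow> real) H \<longleftrightarrow>
    (\<exists>q :: 'a ^ 'v::finite. (\<forall>e\<in>H. edge_diff e q \<noteq> 0) \<and>
       dual_system H (\<lambda>e x. sgn (edge_diff e q) \<bullet> edge_diff e x) \<and>
       {x. \<forall>e\<in>H. sgn (edge_diff e q) \<bullet> edge_diff e x = 0} = trivial_motions norm q)"
proof -
  have "well_positioned norm H q \<and> minimally_infinitesimally_rigid norm H q \<longleftrightarrow>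
    (\<forall>e\<in>H. edge_diff e q \<noteq> 0) \<and> dual_system H (\<lambda>e x. sgn (edge_diff e q) \<bullet> edge_diff e x) \<and>
       {x. \<forall>e\<in>H. sgn (edge_diff e q) \<bullet> edge_diff e x = 0} = trivial_motions norm q" for q :: "'a ^ 'v"
    using minimally_infinitesimally_rigid_iff[OF _ well_positioned_norm(2)[OF assms] linear_inner_edge_diff, of q]
      well_positioned_norm(1)[OF assms, of q] by blast
  then show ?thesis unfolding minimally_rigid_def by presburger
qed

lemma trivial_motions_norm: "trivial_motions norm q = {(\<chi> v. \<eta> (q $ v)) | \<eta>. \<eta> \<in> euclidean_motions}"
  by (simp add: trivial_motions_def infinitesimal_motions_norm)

lemma trivial_motions_product:
  fixes p :: "('a::euclidean_space \<times> real) ^ 'v::finite"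
  assumes "infinitesimal_motions N = product_motions"
  shows "trivial_motions N p = {x. fstv x \<in> trivial_motions norm (fstv p) \<and> (\<exists>c. \<forall>v. sndv x $ v = c)}"
proof (intro equalityI subsetI)
  fix x assume "x \<in> trivial_motions N p"
  then obtain \<eta> c where \<eta>: "\<eta> \<in> euclidean_motions" "x = (\<chi> v. (\<eta> (fst (p $ v)), c))"
    unfolding trivial_motions_def assms product_motions_def by blast
  then have "fstv x = (\<chi> v. \<eta> (fstv p $ v))" "\<forall>v. sndv x $ v = c" by (simp_all add: fstv_def sndv_def)
  then show "x \<in> {x. fstv x \<in> trivial_motions norm (fstv p) \<and> (\<exists>c. \<forall>v. sndv x $ v = c)}"
    unfolding trivial_motions_norm using \<eta>(1) by blast
next
  fix x :: "('a \<times> real) ^ 'v" assume "x \<in> {x. fstv x \<in> trivial_motions norm (fstv p) \<and> (\<exists>c. \<forall>v. sndv x $ v = c)}"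
  then obtain \<eta> c where \<eta>: "\<eta> \<in> euclidean_motions" "fstv x = (\<chi> v. \<eta> (fstv p $ v))" "\<forall>v. sndv x $ v = c"
    unfolding trivial_motions_norm by blast
  then have "x = (\<chi> v. (\<lambda>z. (\<eta> (fst z), c)) (p $ v))"
    by (simp add: vec_eq_iff fstv_def sndv_def prod_eq_iff)
  moreover have "(\<lambda>z. (\<eta> (fst z), c)) \<in> infinitesimal_motions N"
    unfolding assms product_motions_def using \<eta>(1) by blast
  ultimately show "x \<in> trivial_motions N p" unfolding trivial_motions_def
    by (intro CollectI exI[of _ "\<lambda>z. (\<eta> (fst z), c)"]) simp
qed

lemma trivial_motions_norm_orthogonal:
  assumes "u \<in> trivial_motions norm q"
  shows "sgn (edge_diff e q) \<bullet> edge_diff e u = 0"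
proof -
  obtain \<eta> where \<eta>: "\<eta> \<in> euclidean_motions" "u = (\<chi> v. \<eta> (q $ v))"
    using assms unfolding trivial_motions_norm by blast
  then have "edge_diff e u \<bullet> edge_diff e q = 0" by (simp add: euclidean_motions_def edge_diff_def)
  then show ?thesis by (simp add: sgn_div_norm inner_commute)
qed

text \<open>Common end for both product norms: the rows are in block form, and inserting
  \<open>pairv x 0\<close> or \<open>pairv 0 x\<close> into the kernel hypothesis separates the two
  blocks.\<close>

lemma minimally_rigid_and_tree_of_split:
  fixes q :: "'a::euclidean_space ^ 'v::finite"
  assumes H: "simple_graph H" and T: "simple_graph T" and HT: "H \<inter> T = {}"
    and q: "\<And>e. e \<in> H \<Longrightarrow> edge_diff e q \<noteq> 0" and \<sigma>: "\<And>e. e \<in> T \<Longrightarrow> \<sigma> e \<noteq> 0"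
    and dual: "dual_system (H \<union> T) (\<lambda>e x. if e \<in> H then sgn (edge_diff e q) \<bullet> edge_diff e (fstv x)
        else \<sigma> e * edge_diff e (sndv x))"
    and kernel: "\<And>x. \<forall>e\<in>H. sgn (edge_diff e q) \<bullet> edge_diff e (fstv x) = 0 \<Longrightarrow> \<forall>e\<in>T. \<sigma> e * edge_diff e (sndv x) = 0 \<Longrightarrow>
        fstv x \<in> trivial_motions norm q \<and> (\<exists>c. \<forall>v. sndv x $ v = c)"
  shows "minimally_rigid (norm :: 'a \<Rightarrow> real) H \<and> tree_graph T"
proof
  have d: "dual_system H (\<lambda>e x. sgn (edge_diff e q) \<bullet> edge_diff e x)" "dual_system T (\<lambda>e x. \<sigma> e * edge_diff e x)"
    using dual dual_system_product[OF HT, of "\<lambda>e x. sgn (edge_diff e q) \<bullet> edge_diff e x" "\<lambda>e x. \<sigma> e * edge_diff e x"]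
      linear_inner_edge_diff linear_mult_edge_diff by blast+
  have "x \<in> trivial_motions norm q" if "\<forall>e\<in>H. sgn (edge_diff e q) \<bullet> edge_diff e x = 0" for x
    using kernel[of "pairv x 0"] that by simp
  then have "{x. \<forall>e\<in>H. sgn (edge_diff e q) \<bullet> edge_diff e x = 0} = trivial_motions norm q"
    using trivial_motions_norm_orthogonal[of _ q] by blast
  then show "minimally_rigid (norm :: 'a \<Rightarrow> real) H"
    unfolding minimally_rigid_norm_iff[OF H] using q d(1) by blast
  have "dual_system T (\<lambda>e x. (1 / \<sigma> e) * (\<sigma> e * edge_diff e x))"
    by (rule dual_system_scale[OF d(2) linear_mult_edge_diff]) (use \<sigma> in simp)
  then have "dual_system T (\<lambda>e (x :: real ^ 'v). edge_diff e x)"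
    by (subst (asm) dual_system_cong[where g = "\<lambda>e x. edge_diff e x"]) (use \<sigma> in simp_all)
  moreover have "{x :: real ^ 'v. \<forall>e\<in>T. edge_diff e x = 0} = {x. \<exists>c. \<forall>v. x $ v = c}"
  proof (intro equalityI subsetI)
    fix x :: "real ^ 'v" assume "x \<in> {x. \<forall>e\<in>T. edge_diff e x = 0}"
    then show "x \<in> {x. \<exists>c. \<forall>v. x $ v = c}" using kernel[of "pairv 0 x"] by simp
  qed (auto simp: edge_diff_def)
  ultimately show "tree_graph T" using tree_graph_iff[OF T] by blast
qed

lemma cylindrical_imp_decomposition:
  assumes E: "simple_graph E" and rigid: "minimally_rigid (cylindrical_norm :: 'a::euclidean_space \<times> real \<Rightarrow> real) (E :: 'v::finite set set)"
  shows "\<exists>H T. H \<union> T = E \<and> H \<inter> T = {} \<and> minimally_rigid (norm :: 'a \<Rightarrow> real) H \<and> tree_graph T"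
proof -
  obtain p :: "('a \<times> real) ^ 'v" where wp: "well_positioned cylindrical_norm E p"
    and mir: "minimally_infinitesimally_rigid cylindrical_norm E p"
    using rigid unfolding minimally_rigid_def by blast
  define q s where "q = fstv p" and "s = sndv p"
  have d: "fst (edge_diff e p) = edge_diff e q" "snd (edge_diff e p) = edge_diff e s" for e
    unfolding q_def s_def by (simp_all add: edge_diff_pair[of e p])
  define H where "H = {e \<in> E. norm (edge_diff e q) > \<bar>edge_diff e s\<bar>}"
  define T where "T = E - H"
  define f where "f e x = (if e \<in> H then sgn (edge_diff e q) \<bullet> edge_diff e (fstv x)
        else sgn (edge_diff e s) * edge_diff e (sndv x))" for e and x :: "('a \<times> real) ^ 'v"
  have HT: "H \<union> T = E" "H \<inter> T = {}" by (auto simp: H_def T_def)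
  have lin: "linear (f e)" for e
    unfolding f_def using linear_compose[OF linear_fstv linear_inner_edge_diff[of "sgn (edge_diff e q)" e]]
      linear_compose[OF linear_sndv linear_mult_edge_diff[of "sgn (edge_diff e s)" e]] by (cases "e \<in> H") (simp_all add: o_def)
  have ne: "norm (edge_diff e q) \<noteq> \<bar>edge_diff e s\<bar>" if "e \<in> E" for e
    using well_positioned_cylindrical(1)[OF E, of p] wp that by (simp add: d)
  have "rigidity_differential cylindrical_norm E p = functional_map E f"
    unfolding well_positioned_cylindrical(2)[OF E wp] functional_map_def d f_def H_def
    by (intro ext) (simp add: vec_eq_iff inner_prod_def edge_diff_pair)
  from minimally_infinitesimally_rigid_iff[OF wp this lin] mir
  have dual: "dual_system E f" and ker: "{x. \<forall>e\<in>E. f e x = 0} = trivial_motions cylindrical_norm p" by blast+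
  have *: "minimally_rigid (norm :: 'a \<Rightarrow> real) H \<and> tree_graph T"
  proof (rule minimally_rigid_and_tree_of_split)
    show "simple_graph H" "simple_graph T" using E by (auto intro: simple_graph_subset simp: H_def T_def)
    show "edge_diff e q \<noteq> 0" if "e \<in> H" for e using that by (auto simp: H_def)
    show "sgn (edge_diff e s) \<noteq> 0" if "e \<in> T" for e
      using that ne[of e] norm_ge_zero[of "edge_diff e q"] by (auto simp: T_def H_def sgn_0_0)
    show "dual_system (H \<union> T) (\<lambda>e x. if e \<in> H then sgn (edge_diff e q) \<bullet> edge_diff e (fstv x)
        else sgn (edge_diff e s) * edge_diff e (sndv x))"
      using dual unfolding HT f_def[abs_def] .
    fix x assume "\<forall>e\<in>H. sgn (edge_diff e q) \<bullet> edge_diff e (fstv x) = 0"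
      "\<forall>e\<in>T. sgn (edge_diff e s) * edge_diff e (sndv x) = 0"
    then have "x \<in> trivial_motions cylindrical_norm p" unfolding ker[symmetric] f_def T_def by auto
    then show "fstv x \<in> trivial_motions norm q \<and> (\<exists>c. \<forall>v. sndv x $ v = c)"
      unfolding trivial_motions_product[OF infinitesimal_motions_cylindrical] q_def by blast
  qed (use HT in simp_all)
  then show ?thesis using HT by blast
qed

lemma conical_imp_decomposition:
  assumes E: "simple_graph E" and rigid: "minimally_rigid (conical_norm :: 'a::euclidean_space \<times> real \<Rightarrow> real) (E :: 'v::finite set set)"
  shows "\<exists>H T. H \<union> T = E \<and> H \<inter> T = {} \<and> minimally_rigid (norm :: 'a \<Rightarrow> real) H \<and> tree_graph T"
proof -
  obtain p :: "('a \<times> real) ^ 'v" where wp: "well_positioned conical_norm E p"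
    and mir: "minimally_infinitesimally_rigid conical_norm E p"
    using rigid unfolding minimally_rigid_def by blast
  define q s where "q = fstv p" and "s = sndv p"
  have d: "fst (edge_diff e p) = edge_diff e q" "snd (edge_diff e p) = edge_diff e s" for e
    unfolding q_def s_def by (simp_all add: edge_diff_pair[of e p])
  define g where "g e x = sgn (edge_diff e q) \<bullet> edge_diff e (fstv x)" for e and x :: "('a \<times> real) ^ 'v"
  define h where "h e x = sgn (edge_diff e s) * edge_diff e (sndv x)" for e and x :: "('a \<times> real) ^ 'v"
  define f where "f e x = g e x + h e x" for e x
  have ling: "linear (g e)" and linh: "linear (h e)" for e
    unfolding g_def h_def using linear_compose[OF linear_fstv linear_inner_edge_diff[of "sgn (edge_diff e q)" e]]
      linear_compose[OF linear_sndv linear_mult_edge_diff[of "sgn (edge_diff e s)" e]] by (simp_all add: o_def)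
  then have linf: "linear (f e)" for e unfolding f_def by (intro linear_compose_add)
  have ne: "edge_diff e q \<noteq> 0" "edge_diff e s \<noteq> 0" if "e \<in> E" for e
    using well_positioned_conical(1)[OF E, of p] wp that by (simp_all add: d)
  have "rigidity_differential conical_norm E p = functional_map E f"
    unfolding well_positioned_conical(2)[OF E wp] functional_map_def d f_def g_def h_def
    by (intro ext) (simp add: vec_eq_iff inner_prod_def edge_diff_pair)
  from minimally_infinitesimally_rigid_iff[OF wp this linf] mir
  have dual: "dual_system E f" and ker: "{x. \<forall>e\<in>E. f e x = 0} = trivial_motions conical_norm p" by blast+
  have "finite E" by simp
  then obtain H where H: "H \<subseteq> E" "dual_system E (\<lambda>e. if e \<in> H then g e else h e)"
    using dual ling linh f_def by (rule dual_system_split)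
  let ?f = "\<lambda>e. if e \<in> H then g e else h e"
  define T where "T = E - H"
  have HT: "H \<union> T = E" "H \<inter> T = {}" using H(1) by (auto simp: T_def)
  have lin': "linear (?f e)" for e using ling linh by simp
  \<comment> \<open>A trivial motion annihilates both summands of every row, so it stays in the
    kernel whichever summand is selected; equal dimensions then make the two kernels
    coincide.\<close>
  have triv: "g e x = 0 \<and> h e x = 0" if "x \<in> trivial_motions conical_norm p" for e x
  proof -
    have "fstv x \<in> trivial_motions norm q" "\<exists>c. \<forall>v. sndv x $ v = c"
      using that unfolding trivial_motions_product[OF infinitesimal_motions_conical] q_def by blast+
    then show ?thesis using trivial_motions_norm_orthogonal[of "fstv x" q e]
      by (auto simp: g_def h_def edge_diff_def)
  qed
  have "{x. functional_map E f x = 0} = {x. functional_map E ?f x = 0}"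
  proof (rule subspace_dim_equal)
    show "subspace {x. functional_map E f x = 0}" "subspace {x. functional_map E ?f x = 0}"
      using linf lin' by (intro linear_subspace_kernel linear_functional_map; simp)+
    show "{x. functional_map E f x = 0} \<subseteq> {x. functional_map E ?f x = 0}"
      using triv unfolding functional_map_eq_0 ker by auto
    show "dim {x. functional_map E f x = 0} \<ge> dim {x. functional_map E ?f x = 0}"
      using dim_kernel_dual_system[OF linf dual] dim_kernel_dual_system[OF lin' H(2)] by simp
  qed
  then have ker': "{x. \<forall>e\<in>E. ?f e x = 0} = trivial_motions conical_norm p"
    unfolding functional_map_eq_0 ker by simp
  have "minimally_rigid (norm :: 'a \<Rightarrow> real) H \<and> tree_graph T"
  proof (rule minimally_rigid_and_tree_of_split)
    show "simple_graph H" "simple_graph T" using E H(1) by (auto intro: simple_graph_subset simp: T_def)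
    show "edge_diff e q \<noteq> 0" if "e \<in> H" for e using that H(1) ne by blast
    show "sgn (edge_diff e s) \<noteq> 0" if "e \<in> T" for e
      using that ne[of e] by (auto simp: T_def sgn_0_0)
    show "dual_system (H \<union> T) (\<lambda>e x. if e \<in> H then sgn (edge_diff e q) \<bullet> edge_diff e (fstv x)
        else sgn (edge_diff e s) * edge_diff e (sndv x))"
      using H(2) unfolding HT by (subst dual_system_cong[where g = ?f]) (simp_all add: g_def h_def)
    fix x assume "\<forall>e\<in>H. sgn (edge_diff e q) \<bullet> edge_diff e (fstv x) = 0"
      "\<forall>e\<in>T. sgn (edge_diff e s) * edge_diff e (sndv x) = 0"
    then have "x \<in> trivial_motions conical_norm p" unfolding ker'[symmetric] g_def h_def T_def by auto
    then show "fstv x \<in> trivial_motions norm q \<and> (\<exists>c. \<forall>v. sndv x $ v = c)"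
      unfolding trivial_motions_product[OF infinitesimal_motions_conical] q_def by blast
  qed (use HT in simp_all)
  then show ?thesis using HT by blast
qed

section \<open>Generic placements\<close>

text \<open>Affine spanning, phrased so as to give injectivity of the evaluation map
  \<open>affine_values q\<close>.\<close>

definition affinely_spanning :: "(real ^ 'd) ^ 'v \<Rightarrow> bool" where
  "affinely_spanning q \<longleftrightarrow> (\<forall>(A :: real ^ 'd ^ 'd) b. (\<forall>v. A *v (q $ v) + b = 0) \<longrightarrow> A = 0 \<and> b = 0)"

text \<open>Parameters \<open>(A, b)\<close> of the Euclidean motions, a space that does not depend
  on the placement; \<open>affine_values q\<close> turns them into trivial motions.\<close>

definition skew_affine :: "((real ^ 'd ^ 'd) \<times> (real ^ 'd)) set" where
  "skew_affine = {z. \<forall>x. (fst z *v x) \<bullet> x = 0}"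

definition affine_values :: "(real ^ 'd) ^ 'v \<Rightarrow> (real ^ 'd ^ 'd) \<times> (real ^ 'd) \<Rightarrow> (real ^ 'd) ^ 'v" where
  "affine_values q z = (\<chi> v. fst z *v (q $ v) + snd z)"

lemma linear_affine_values: "linear (affine_values q)"
  by (intro linearI)
    (auto simp: affine_values_def vec_eq_iff matrix_vector_mult_def sum.distrib sum_distrib_left algebra_simps)

lemma subspace_skew_affine: "subspace skew_affine"
  unfolding subspace_def skew_affine_def
  by (auto simp: matrix_vector_mult_add_rdistrib inner_add_left scaleR_matrix_vector_assoc[symmetric])

lemma trivial_motions_norm_eq: "trivial_motions norm q = affine_values q ` skew_affine"
proof (intro equalityI subsetI)
  fix x assume "x \<in> trivial_motions norm q"
  then obtain f b where f: "linear f" "\<And>x. f x \<bullet> x = 0" "x = (\<chi> v. f (q $ v) + b)"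
    unfolding trivial_motions_norm euclidean_motions_iff_affine by blast
  then have "x = affine_values q (matrix f, b)" "(matrix f, b) \<in> skew_affine"
    by (simp_all add: affine_values_def skew_affine_def matrix_works)
  then show "x \<in> affine_values q ` skew_affine" by blast
next
  fix x assume "x \<in> affine_values q ` skew_affine"
  then obtain A b where A: "\<And>x. (A *v x) \<bullet> x = 0" "x = (\<chi> v. A *v (q $ v) + b)"
    by (auto simp: affine_values_def skew_affine_def)
  then have "(\<lambda>x. A *v x + b) \<in> euclidean_motions"
    unfolding euclidean_motions_iff_affine using matrix_vector_mul_linear[of A] by blast
  with A(2) show "x \<in> trivial_motions norm q" unfolding trivial_motions_norm
    by (intro CollectI exI[of _ "\<lambda>x. A *v x + b"]) simp
qed

lemma subspace_trivial_motions: "subspace (trivial_motions norm (q :: (real ^ 'd) ^ 'v::finite))"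
  unfolding trivial_motions_norm_eq using linear_affine_values subspace_skew_affine
  by (rule linear_subspace_image)

text \<open>All spaces of trivial motions are images of the same parameter space, and at an affinely
  spanning placement no dimension is lost.\<close>

lemma dim_trivial_motions_le:
  fixes q q' :: "(real ^ 'd) ^ 'v::finite"
  assumes "affinely_spanning q"
  shows "dim (trivial_motions norm q') \<le> dim (trivial_motions norm q)"
proof -
  have "z = 0" if "affine_values q z = 0" for z
  proof -
    have "\<forall>v. fst z *v (q $ v) + snd z = 0"
      using arg_cong[OF that, of "\<lambda>x. x $ _"] by (simp add: affine_values_def)
    then show ?thesis using assms unfolding affinely_spanning_def by (simp add: prod_eq_iff)
  qed
  then have "inj (affine_values q)"
    using linear_injective_0[OF linear_affine_values] by blast
  then have "dim (trivial_motions norm q) = dim (skew_affine :: ((real ^ 'd ^ 'd) \<times> (real ^ 'd)) set)"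
    unfolding trivial_motions_norm_eq
    by (intro dim_image_eq linear_affine_values) (auto intro: inj_on_subset)
  moreover have "dim (trivial_motions norm q') \<le> dim (skew_affine :: ((real ^ 'd ^ 'd) \<times> (real ^ 'd)) set)"
    unfolding trivial_motions_norm_eq by (intro dim_image_le linear_affine_values)
  ultimately show ?thesis by simp
qed

text \<open>The kernel contains the trivial motions, so a dimension bound is enough. The number of
  edges fixes the dimension of the kernel: it is one more than that of the trivial motions at a
  rigid placement \<open>q0\<close> of \<open>H\<close>, hence at most the dimension of the trivial
  motions at \<open>p\<close>. \<open>H\<close> and \<open>T\<close> enter through their sizes and
  need not be the pattern realised by \<open>p\<close>.\<close>

lemma minimally_rigid_of_dual_system:
  fixes p :: "((real ^ 'd) \<times> real) ^ 'v::finite" and E :: "'v set set"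
  assumes wp: "well_positioned N E p" and rd: "rigidity_differential N E p = functional_map E f"
    and lin: "\<And>e. e \<in> E \<Longrightarrow> linear (f e)" and dual: "dual_system E f"
    and N: "infinitesimal_motions N = product_motions" and span: "affinely_spanning (fstv p)"
    and HT: "H \<union> T = E" "H \<inter> T = {}" "simple_graph H" "minimally_rigid (norm :: real ^ 'd \<Rightarrow> real) H" "tree_graph T"
  shows "minimally_rigid N E"
proof -
  obtain q0 :: "(real ^ 'd) ^ 'v" where q0: "dual_system H (\<lambda>e x. sgn (edge_diff e q0) \<bullet> edge_diff e x)"
    "{x. \<forall>e\<in>H. sgn (edge_diff e q0) \<bullet> edge_diff e x = 0} = trivial_motions norm q0"
    using HT(4) unfolding minimally_rigid_norm_iff[OF HT(3)] by blast
  have d0: "dim (trivial_motions norm q0) + card H = CARD('v) * CARD('d)"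
    using dim_kernel_dual_system[OF linear_inner_edge_diff q0(1)] unfolding functional_map_eq_0 q0(2)
    by simp
  have dT: "card T + 1 = CARD('v)" using tree_graph_card[OF HT(5)] .
  have cE: "card E = card H + card T" using HT(1,2) by (metis card_Un_disjoint finite)
  let ?C = "{x :: real ^ 'v. \<exists>c. \<forall>v. x $ v = c}"
  have "dim (trivial_motions norm (fstv p) \<times> ?C) = dim (trivial_motions norm (fstv p)) + 1"
    using dim_Times[OF subspace_trivial_motions[of "fstv p"] subspace_constant] unfolding dim_constant .
  moreover have "dim ((\<lambda>z. pairv (fst z) (snd z)) ` (trivial_motions norm (fstv p) \<times> ?C)) = dim (trivial_motions norm (fstv p) \<times> ?C)"
  proof (rule dim_image_eq)
    show "linear (\<lambda>z :: ((real ^ 'd) ^ 'v) \<times> (real ^ 'v). pairv (fst z) (snd z))"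
      by (intro linearI) (simp_all add: pairv_def vec_eq_iff)
    show "inj_on (\<lambda>z :: ((real ^ 'd) ^ 'v) \<times> (real ^ 'v). pairv (fst z) (snd z)) A" for A
      by (intro inj_onI) (auto simp: pairv_def vec_eq_iff prod_eq_iff)
  qed
  moreover have "(\<lambda>z. pairv (fst z) (snd z)) ` (trivial_motions norm (fstv p) \<times> ?C) = trivial_motions N p"
  proof (intro equalityI subsetI)
    fix x assume "x \<in> trivial_motions N p"
    then have "(fstv x, sndv x) \<in> trivial_motions norm (fstv p) \<times> ?C"
      unfolding trivial_motions_product[OF N] by simp
    from image_eqI[OF _ this, of x "\<lambda>z. pairv (fst z) (snd z)"]
    show "x \<in> (\<lambda>z. pairv (fst z) (snd z)) ` (trivial_motions norm (fstv p) \<times> ?C)" by simp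
  qed (auto simp: trivial_motions_product[OF N])
  ultimately have "dim (trivial_motions N p) = dim (trivial_motions norm (fstv p)) + 1" by simp
  moreover have "dim {x. functional_map E f x = 0} + card E = CARD('v) * (CARD('d) + 1)"
    using dim_kernel_dual_system[OF lin dual] by simp
  ultimately have le: "dim {x. functional_map E f x = 0} \<le> dim (trivial_motions N p)"
    using d0 dT cE dim_trivial_motions_le[OF span, of q0] by (simp add: algebra_simps)
  have sub: "trivial_motions N p \<subseteq> {x. functional_map E f x = 0}"
    using trivial_motions_subset_kernel[OF wp] unfolding rd .
  have "subspace (trivial_motions N p)"
    unfolding trivial_motions_product[OF N]
    using linear_subspace_vimage[OF linear_fstv subspace_trivial_motions[of "fstv p"]]
      linear_subspace_vimage[OF linear_sndv subspace_constant] subspace_inter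
    by (simp add: vimage_def Collect_conj_eq)
  moreover have "subspace {x. functional_map E f x = 0}"
    using lin by (intro linear_subspace_kernel linear_functional_map)
  ultimately have "trivial_motions N p = {x. functional_map E f x = 0}"
    using subspace_dim_equal sub le by blast
  then have "minimally_infinitesimally_rigid N E p"
    using minimally_infinitesimally_rigid_iff[OF wp rd lin] dual by (simp add: functional_map_eq_0)
  then show ?thesis unfolding minimally_rigid_def using wp by blast
qed

text \<open>Genericity arguments only look at lines, where a nonzero polynomial has finitely many
  zeros; this avoids polynomials in several variables.\<close>

definition line_polynomial :: "('a::real_vector \<Rightarrow> real) \<Rightarrow> bool" where
  "line_polynomial F \<longleftrightarrow> (\<forall>x y. \<exists>P. \<forall>t. F (x + t *\<^sub>R y) = poly P t)"

lemma line_polynomial_const: "line_polynomial (\<lambda>_. c)"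
  unfolding line_polynomial_def by (intro allI exI[of _ "[:c:]"]) simp

lemma line_polynomial_linear:
  assumes "linear F"
  shows "line_polynomial F"
  unfolding line_polynomial_def
proof (intro allI)
  show "\<exists>P. \<forall>t. F (x + t *\<^sub>R y) = poly P t" for x y
    by (intro exI[of _ "[:F x, F y:]"]) (simp add: linear_add[OF assms] linear_scale[OF assms])
qed

lemma line_polynomial_mult:
  assumes "line_polynomial F" "line_polynomial G"
  shows "line_polynomial (\<lambda>x. F x * G x)"
  unfolding line_polynomial_def
proof (intro allI)
  fix x y
  obtain P Q where "\<And>t. F (x + t *\<^sub>R y) = poly P t" "\<And>t. G (x + t *\<^sub>R y) = poly Q t"
    using assms unfolding line_polynomial_def by metis
  then show "\<exists>P. \<forall>t. F (x + t *\<^sub>R y) * G (x + t *\<^sub>R y) = poly P t"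
    by (intro exI[of _ "P * Q"]) simp
qed

lemma line_polynomial_add:
  assumes "line_polynomial F" "line_polynomial G"
  shows "line_polynomial (\<lambda>x. F x + G x)"
  unfolding line_polynomial_def
proof (intro allI)
  fix x y
  obtain P Q where "\<And>t. F (x + t *\<^sub>R y) = poly P t" "\<And>t. G (x + t *\<^sub>R y) = poly Q t"
    using assms unfolding line_polynomial_def by metis
  then show "\<exists>P. \<forall>t. F (x + t *\<^sub>R y) + G (x + t *\<^sub>R y) = poly P t"
    by (intro exI[of _ "P + Q"]) simp
qed

lemma line_polynomial_sum:
  assumes "\<And>i. i \<in> I \<Longrightarrow> line_polynomial (F i)"
  shows "line_polynomial (\<lambda>x. \<Sum>i\<in>I. F i x)"
  using assms
  by (induction I rule: infinite_finite_induct) (auto intro: line_polynomial_const line_polynomial_add)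

lemma line_polynomial_prod:
  assumes "\<And>i. i \<in> I \<Longrightarrow> line_polynomial (F i)"
  shows "line_polynomial (\<lambda>x. \<Prod>i\<in>I. F i x)"
  using assms
  by (induction I rule: infinite_finite_induct) (auto intro: line_polynomial_const line_polynomial_mult)

lemma line_polynomial_det:
  fixes M :: "'a::real_vector \<Rightarrow> real ^ 'n ^ 'n::finite"
  assumes "\<And>i j. line_polynomial (\<lambda>x. M x $ i $ j)"
  shows "line_polynomial (\<lambda>x. det (M x))"
  unfolding det_def
  by (intro line_polynomial_sum line_polynomial_mult line_polynomial_const line_polynomial_prod assms)

text \<open>On the line from \<open>y\<close> to \<open>x\<close> the function is a nonzero
  polynomial, so some parameter close to 0 avoids its zeros.\<close>

lemma line_polynomial_dense:
  fixes F :: "'a::real_normed_vector \<Rightarrow> real"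
  assumes F: "line_polynomial F" "F x \<noteq> 0" and U: "open U" "y \<in> U"
  shows "\<exists>z\<in>U. F z \<noteq> 0"
proof -
  obtain P where P: "\<And>t. F (y + t *\<^sub>R (x - y)) = poly P t"
    using F(1) unfolding line_polynomial_def by blast
  have "poly P 1 \<noteq> 0" using P[of 1] F(2) by simp
  then have fin: "finite {t. poly P t = 0}" by (intro poly_roots_finite) auto
  have "open ((\<lambda>t. y + t *\<^sub>R (x - y)) -` U)"
    using U(1) by (intro open_vimage continuous_intros)
  moreover have "0 \<in> (\<lambda>t. y + t *\<^sub>R (x - y)) -` U" using U(2) by simp
  ultimately obtain r :: real where r: "r > 0" "ball 0 r \<subseteq> (\<lambda>t. y + t *\<^sub>R (x - y)) -` U"
    unfolding open_contains_ball by blast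
  have "infinite {0<..<r}" using r(1) by simp
  then have "infinite ({0<..<r} - {t. poly P t = 0})" using fin by (rule Diff_infinite_finite[rotated])
  then have "{0<..<r} - {t. poly P t = 0} \<noteq> {}" by (metis finite.emptyI)
  then obtain t where "t \<in> {0<..<r}" "poly P t \<noteq> 0" by blast
  then have "t \<in> ball 0 r" by simp
  with r(2) have "y + t *\<^sub>R (x - y) \<in> U" by blast
  moreover have "F (y + t *\<^sub>R (x - y)) \<noteq> 0" using P[of t] \<open>poly P t \<noteq> 0\<close> by simp
  ultimately show ?thesis by blast
qed

lemma line_polynomial_common:
  fixes F G :: "'a::real_vector \<Rightarrow> real"
  assumes F: "line_polynomial F" "F x \<noteq> 0" and G: "line_polynomial G" "G y \<noteq> 0"
  shows "\<exists>z. F z * G z \<noteq> 0"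
proof -
  obtain P where P: "\<And>t. F (y + t *\<^sub>R (x - y)) = poly P t"
    using F(1) unfolding line_polynomial_def by blast
  obtain Q where Q: "\<And>t. G (y + t *\<^sub>R (x - y)) = poly Q t"
    using G(1) unfolding line_polynomial_def by blast
  have "P \<noteq> 0" "Q \<noteq> 0" using P[of 1] F(2) Q[of 0] G(2) by auto
  then have "P * Q \<noteq> 0" by simp
  then obtain t where "poly (P * Q) t \<noteq> 0" by (metis poly_all_0_iff_0)
  then show ?thesis using P[of t] Q[of t] by (metis poly_mult)
qed

text \<open>Signed volume, up to a factor, of the simplex on \<open>d + 1\<close> vertices with apex
  \<open>u None\<close> and other corners \<open>u (Some i)\<close>.\<close>

definition frame_det :: "('d option \<Rightarrow> 'v) \<Rightarrow> (real ^ 'd) ^ 'v \<Rightarrow> real" where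
  "frame_det u q = det (\<chi> i. q $ u (Some i) - q $ u None)"

text \<open>If an affine map vanishes at the corners, its linear part kills the differences of
  corners; read row by row, the invertible frame matrix kills each row of \<open>A\<close>.\<close>

lemma affinely_spanning_of_frame_det:
  assumes "frame_det u q \<noteq> 0"
  shows "affinely_spanning q"
  unfolding affinely_spanning_def
proof (intro allI impI)
  fix A :: "real ^ 'a ^ 'a" and b assume *: "\<forall>v. A *v (q $ v) + b = 0"
  let ?Q = "(\<chi> i. q $ u (Some i) - q $ u None) :: real ^ 'a ^ 'a"
  have "?Q *v (A $ k) = 0" for k
  proof -
    have "(?Q *v (A $ k)) $ i = (A *v (q $ u (Some i) - q $ u None)) $ k" for i
      by (simp add: matrix_vector_mult_def mult.commute)
    moreover have "A *v (q $ u (Some i) - q $ u None) = 0" for i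
      using *[rule_format, of "u (Some i)"] *[rule_format, of "u None"]
      by (simp add: matrix_vector_mult_diff_distrib) (metis add_right_cancel)
    ultimately show ?thesis by (simp add: vec_eq_iff)
  qed
  moreover have "invertible ?Q" using assms by (simp add: frame_det_def invertible_det_nz)
  ultimately have "A $ k = 0" for k
    by (metis invertible_def matrix_left_invertible_ker)
  then have "A = 0" by (simp add: vec_eq_iff)
  then show "A = 0 \<and> b = 0" using * by simp
qed

lemma line_polynomial_frame_det:
  fixes u :: "'d::finite option \<Rightarrow> 'v::finite"
  shows "line_polynomial (frame_det u)"
proof -
  have "linear (\<lambda>q :: (real ^ 'd) ^ 'v. (q $ u (Some i) - q $ u None) $ j)" for i j
    by (intro linearI) (auto simp: algebra_simps)
  then have "line_polynomial (\<lambda>q :: (real ^ 'd) ^ 'v. (\<chi> i. q $ u (Some i) - q $ u None) $ i $ j)" for i j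
    by (simp only: vec_lambda_beta, rule line_polynomial_linear)
  then show ?thesis unfolding frame_det_def[abs_def] by (rule line_polynomial_det)
qed

lemma frame_det_nonzero:
  assumes "inj u"
  shows "\<exists>q :: (real ^ 'd) ^ 'v. frame_det u q \<noteq> 0"
proof -
  define q :: "(real ^ 'd) ^ 'v" where "q = (\<chi> v. \<Sum>i\<in>UNIV. if v = u (Some i) then axis i 1 else 0)"
  have "q $ u (Some i) = axis i 1" for i
  proof -
    have "q $ u (Some i) = (\<Sum>j\<in>UNIV. if j = i then axis j 1 else 0)"
      unfolding q_def using inj_eq[OF assms] by (simp add: eq_commute[of i])
    then show ?thesis by simp
  qed
  moreover have "q $ u None = 0"
    unfolding q_def using assms by (auto intro!: sum.neutral dest: injD)
  ultimately have "(\<chi> i. q $ u (Some i) - q $ u None) = mat 1"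
    by (simp add: vec_eq_iff mat_def axis_def)
  then show ?thesis unfolding frame_det_def by (intro exI[of _ q]) simp
qed

lemma line_polynomial_pairing_det:
  fixes b :: "'v::finite set \<Rightarrow> 'a::euclidean_space ^ 'v"
  shows "line_polynomial (\<lambda>q. det (pairing_matrix H (\<lambda>e x. edge_diff e q \<bullet> edge_diff e x) b))"
proof (intro line_polynomial_det)
  fix e e' :: "'v set"
  have "linear (\<lambda>q :: 'a ^ 'v. edge_diff e q \<bullet> edge_diff e (b e'))"
    using linear_inner_edge_diff[of "edge_diff e (b e')" e] by (simp add: inner_commute)
  then show "line_polynomial (\<lambda>q. pairing_matrix H (\<lambda>e x. edge_diff e q \<bullet> edge_diff e x) b $ e $ e')"
    unfolding pairing_matrix_def
    by (cases "e \<in> H \<and> e' \<in> H") (auto intro: line_polynomial_linear line_polynomial_const)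
qed

text \<open>The unnormalised rows are linear in \<open>q\<close>, which makes their determinants
  polynomial along lines.\<close>

lemma dual_system_sgn_iff:
  fixes q :: "'a::euclidean_space ^ 'v::finite"
  assumes "\<And>e. e \<in> H \<Longrightarrow> edge_diff e q \<noteq> 0"
  shows "dual_system H (\<lambda>e x. sgn (edge_diff e q) \<bullet> edge_diff e x) \<longleftrightarrow> dual_system H (\<lambda>e x. edge_diff e q \<bullet> edge_diff e x)"
proof
  assume "dual_system H (\<lambda>e x. sgn (edge_diff e q) \<bullet> edge_diff e x)"
  then have "dual_system H (\<lambda>e x. norm (edge_diff e q) * (sgn (edge_diff e q) \<bullet> edge_diff e x))"
    by (rule dual_system_scale) (simp_all add: linear_inner_edge_diff assms)
  then show "dual_system H (\<lambda>e x. edge_diff e q \<bullet> edge_diff e x)"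
    by (rule dual_system_cong[THEN iffD1, rotated]) (simp add: sgn_div_norm assms)
next
  assume "dual_system H (\<lambda>e x. edge_diff e q \<bullet> edge_diff e x)"
  then have "dual_system H (\<lambda>e x. inverse (norm (edge_diff e q)) * (edge_diff e q \<bullet> edge_diff e x))"
    by (rule dual_system_scale) (simp_all add: linear_inner_edge_diff assms)
  then show "dual_system H (\<lambda>e x. sgn (edge_diff e q) \<bullet> edge_diff e x)"
    by (rule dual_system_cong[THEN iffD1, rotated]) (simp add: sgn_div_norm)
qed

text \<open>Once \<open>b\<close> is frozen at a rigid placement, both requirements are nonvanishing
  of line polynomials. A common nonzero is found on the line joining two placements and is then
  moved into the open set.\<close>

lemma generic_placement:
  fixes H :: "'v::finite set set" and u :: "'d::finite option \<Rightarrow> 'v"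
  assumes H: "simple_graph H" "minimally_rigid (norm :: real ^ 'd \<Rightarrow> real) H" and u: "inj u"
    and U: "open U" "q' \<in> U"
  obtains q :: "(real ^ 'd) ^ 'v" where "q \<in> U" "frame_det u q \<noteq> 0"
    "dual_system H (\<lambda>e x. edge_diff e q \<bullet> edge_diff e x)"
proof -
  obtain q0 :: "(real ^ 'd) ^ 'v" where q0: "\<And>e. e \<in> H \<Longrightarrow> edge_diff e q0 \<noteq> 0"
    "dual_system H (\<lambda>e x. sgn (edge_diff e q0) \<bullet> edge_diff e x)"
    using H(2) unfolding minimally_rigid_norm_iff[OF H(1)] by blast
  have "dual_system H (\<lambda>e x. edge_diff e q0 \<bullet> edge_diff e x)"
    using dual_system_sgn_iff[OF q0(1)] q0(2) by blast
  then obtain b where b: "det (pairing_matrix H (\<lambda>e x. edge_diff e q0 \<bullet> edge_diff e x) b) \<noteq> 0"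
    unfolding dual_system_iff_det[OF linear_inner_edge_diff] by blast
  obtain q1 :: "(real ^ 'd) ^ 'v" where q1: "frame_det u q1 \<noteq> 0" using frame_det_nonzero[OF u] by blast
  let ?F = "\<lambda>q. det (pairing_matrix H (\<lambda>e x. edge_diff e q \<bullet> edge_diff e x) b)"
  obtain q2 where "?F q2 * frame_det u q2 \<noteq> 0"
    using line_polynomial_common[OF line_polynomial_pairing_det b line_polynomial_frame_det q1] by blast
  from line_polynomial_dense[OF line_polynomial_mult[OF line_polynomial_pairing_det line_polynomial_frame_det] this U]
  obtain q where "q \<in> U" "?F q \<noteq> 0" "frame_det u q \<noteq> 0" by auto
  moreover have "dual_system H (\<lambda>e x. edge_diff e q \<bullet> edge_diff e x)"
    unfolding dual_system_iff_det[OF linear_inner_edge_diff] using \<open>?F q \<noteq> 0\<close> by blast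
  ultimately show ?thesis using that by blast
qed

section \<open>Cylindrical spaces over spaces of dimension at least two\<close>

text \<open>The vectors \<open>axis i 1 + real m *\<^sub>R axis j 1\<close> are pairwise not
  parallel, so each element of \<open>B\<close> excludes at most one natural number
  \<open>m\<close>.\<close>

lemma exists_direction:
  fixes B :: "(real ^ 'd::finite) set"
  assumes "CARD('d) \<ge> 2" "finite B"
  shows "\<exists>z. z \<noteq> 0 \<and> (\<forall>w\<in>B. \<forall>c. z \<noteq> c *\<^sub>R w)"
proof -
  obtain i j :: 'd where ij: "i \<noteq> j"
    using assms(1) by (metis card_le_Suc0_iff_eq finite UNIV_I not_less_eq_eq numeral_2_eq_2)
  define z :: "nat \<Rightarrow> real ^ 'd" where "z m = axis i 1 + real m *\<^sub>R axis j 1" for m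
  have z: "z m $ i = 1" "z m $ j = real m" for m using ij by (simp_all add: z_def axis_def)
  have "finite {m. \<exists>c. z m = c *\<^sub>R w}" for w
  proof -
    have "m = m'" if "z m = c *\<^sub>R w" "z m' = c' *\<^sub>R w" for m m' c c'
    proof -
      have "c * w $ i = c' * w $ i" "c * w $ i = 1" "c * w $ j = real m" "c' * w $ j = real m'"
        using z[of m] z[of m'] unfolding that by simp_all
      moreover from this(2) have "w $ i \<noteq> 0" by auto
      ultimately have "c = c'" by (metis mult_right_cancel)
      with \<open>c * w $ j = real m\<close> \<open>c' * w $ j = real m'\<close> show ?thesis by simp
    qed
    then have unique: "m = m'" if "m \<in> {m. \<exists>c. z m = c *\<^sub>R w}" "m' \<in> {m. \<exists>c. z m = c *\<^sub>R w}" for m m'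
      using that by blast
    show ?thesis
    proof (cases "{m. \<exists>c. z m = c *\<^sub>R w} = {}")
      case False
      then obtain m where "m \<in> {m. \<exists>c. z m = c *\<^sub>R w}" by blast
      then have "{m. \<exists>c. z m = c *\<^sub>R w} \<subseteq> {m}" using unique by blast
      then show ?thesis by (rule finite_subset) simp
    qed simp
  qed
  then have "finite (\<Union>w\<in>B. {m. \<exists>c. z m = c *\<^sub>R w})" using assms(2) by blast
  then obtain m where "m \<notin> (\<Union>w\<in>B. {m. \<exists>c. z m = c *\<^sub>R w})"
    using ex_new_if_finite infinite_UNIV_nat by blast
  moreover have "z m \<noteq> 0" using z(1)[of m] by auto
  ultimately show ?thesis by blast
qed

lemma exists_pos_less_finite:
  fixes D :: "real set"
  assumes "finite D" "\<And>d. d \<in> D \<Longrightarrow> d > 0"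
  shows "\<exists>\<delta>>0. \<forall>d\<in>D. \<delta> < d"
  using assms
proof (induction D rule: finite_induct)
  case empty
  show ?case by (intro exI[of _ 1]) simp
next
  case (insert d D)
  then obtain \<delta> where "\<delta> > 0" "\<forall>d\<in>D. \<delta> < d" by auto
  then show ?case using insert.prems[of d] by (intro exI[of _ "min \<delta> (d / 2)"]) auto
qed

text \<open>Edges of \<open>T\<close> lie on the light cone, all other pairs in \<open>A\<close> are
  strictly flat. \<open>\<kappa> v\<close> tells whether all neighbours of \<open>v\<close> lie
  above or below it with respect to \<open>s\<close>, so it records the bipartition of the
  tree.\<close>

definition isotropic_placement ::
  "'v set \<Rightarrow> 'v set set \<Rightarrow> ('v \<Rightarrow> 'a::real_normed_vector) \<Rightarrow> ('v \<Rightarrow> real) \<Rightarrow> ('v \<Rightarrow> real) \<Rightarrow> bool" where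
  "isotropic_placement A T q s \<kappa> \<longleftrightarrow> (\<forall>v. \<kappa> v = 1 \<or> \<kappa> v = - 1) \<and>
     (\<forall>v w. {v, w} \<in> T \<longrightarrow> norm (q v - q w) = \<bar>s v - s w\<bar> \<and> 0 < \<kappa> v * (s w - s v)) \<and>
     (\<forall>v\<in>A. \<forall>w\<in>A. v \<noteq> w \<longrightarrow> {v, w} \<notin> T \<longrightarrow> \<bar>s v - s w\<bar> < norm (q v - q w))"

lemma isotropic_placementD:
  assumes "isotropic_placement A T q s \<kappa>"
  shows "\<kappa> v = 1 \<or> \<kappa> v = - 1"
    "{v, w} \<in> T \<Longrightarrow> norm (q v - q w) = \<bar>s v - s w\<bar>" "{v, w} \<in> T \<Longrightarrow> 0 < \<kappa> v * (s w - s v)"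
    "v \<in> A \<Longrightarrow> w \<in> A \<Longrightarrow> v \<noteq> w \<Longrightarrow> {v, w} \<notin> T \<Longrightarrow> \<bar>s v - s w\<bar> < norm (q v - q w)"
  using assms unfolding isotropic_placement_def by auto

text \<open>A new leaf \<open>v\<close> is put close to its neighbour \<open>a\<close>, on the same side (with respect to \<open>s\<close>) as all other
  neighbours of \<open>a\<close>, in a spatial direction different from theirs.  The strict triangle
  inequality then separates \<open>v\<close> from these neighbours.\<close>

lemma isotropic_spanning_tree:
  fixes T :: "'v::finite set set"
  assumes d: "CARD('d::finite) \<ge> 2" and "spanning_tree A T"
  shows "\<exists>(q :: 'v \<Rightarrow> real ^ 'd) s \<kappa>. isotropic_placement A T q s \<kappa>"
  using assms(2)
proof (induction "card A" arbitrary: A T rule: less_induct)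
  case less
  note D = spanning_treeD[OF less.prems]
  show ?case
  proof (cases "card A = 1")
    case True
    then have "T = {}" using D(4) by simp
    moreover obtain a where "A = {a}" using True by (metis card_1_singletonE)
    ultimately show ?thesis by (intro exI[of _ "\<lambda>_. 0"] exI[of _ "\<lambda>_. 1"]) (simp add: isotropic_placement_def)
  next
    case False
    obtain v a where v: "v \<in> A" "{e \<in> T. v \<in> e} = {{v, a}}"
      using spanning_tree_leaf[OF less.prems False] .
    define A0 T0 where "A0 = A - {v}" and "T0 = T - {{v, a}}"
    have T0: "spanning_tree A0 T0" "a \<in> A0"
      using spanning_tree_remove_leaf[OF less.prems v(2)] by (simp_all add: A0_def T0_def)
    have "card A0 < card A" unfolding A0_def using v(1) by (meson card_Diff1_less finite)
    from less.hyps[OF this T0(1)] obtain q :: "'v \<Rightarrow> real ^ 'd" and s \<kappa> where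
      "isotropic_placement A0 T0 q s \<kappa>" by blast
    note \<kappa> = isotropic_placementD(1)[OF this] and iso = isotropic_placementD(2)[OF this]
      and side = isotropic_placementD(3)[OF this] and space = isotropic_placementD(4)[OF this]
    have "finite (range (\<lambda>u. q u - q a))" by simp
    from exists_direction[OF d this] obtain z where
      z: "z \<noteq> 0" "\<forall>w\<in>range (\<lambda>u. q u - q a). \<forall>c. z \<noteq> c *\<^sub>R w" by blast
    have z': "z \<noteq> c *\<^sub>R (q u - q a)" for u c using z(2) by blast
    define \<theta> where "\<theta> = sgn z"
    have \<theta>: "norm \<theta> = 1" using z(1) by (simp add: \<theta>_def norm_sgn)
    have par: "q u - q a \<noteq> c *\<^sub>R \<theta>" if "c \<noteq> 0" for u c
    proof
      assume "q u - q a = c *\<^sub>R \<theta>"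
      then have "z = (norm z / c) *\<^sub>R (q u - q a)" using z(1) that by (simp add: \<theta>_def sgn_div_norm)
      then show False using z' by blast
    qed
    \<comment> \<open>Bound for the distance \<open>\<delta>\<close> of the new leaf from
      \<open>a\<close>: for a neighbour \<open>u\<close> of \<open>a\<close> it keeps the height of
      \<open>v\<close> strictly between those of \<open>a\<close> and \<open>u\<close>; for other
      vertices half of the slack absorbs the change of both components.\<close>
    define m where "m u = (if {a, u} \<in> T0 then \<bar>s u - s a\<bar> else (norm (q u - q a) - \<bar>s u - s a\<bar>) / 2)" for u
    have "0 < m u" if "u \<in> A0 - {a}" for u
    proof (cases "{a, u} \<in> T0")
      case True
      then show ?thesis using side[OF True] by (auto simp: m_def)
    next
      case False
      then show ?thesis using space[of u a] that T0(2) by (simp add: m_def insert_commute)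
    qed
    then obtain \<delta> where \<delta>: "\<delta> > 0" "\<And>u. u \<in> A0 - {a} \<Longrightarrow> \<delta> < m u"
      using exists_pos_less_finite[of "m ` (A0 - {a})"] by auto
    \<comment> \<open>The leaf goes to the side of \<open>a\<close> on which all neighbours of
      \<open>a\<close> lie, hence its own neighbour is on the opposite side.\<close>
    define q' s' \<kappa>' where "q' = q(v := q a + \<delta> *\<^sub>R \<theta>)" and "s' = s(v := s a + \<kappa> a * \<delta>)"
      and "\<kappa>' = \<kappa>(v := - \<kappa> a)"
    have av: "a \<noteq> v" using T0(2) by (auto simp: A0_def)
    have old: "q' u = q u" "s' u = s u" "\<kappa>' u = \<kappa> u" if "u \<noteq> v" for u
      using that by (simp_all add: q'_def s'_def \<kappa>'_def)
    have new: "q' v = q a + \<delta> *\<^sub>R \<theta>" "s' v = s a + \<kappa> a * \<delta>" "\<kappa>' v = - \<kappa> a"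
      by (simp_all add: q'_def s'_def \<kappa>'_def)
    have \<kappa>\<kappa>: "\<kappa> a * \<kappa> a = 1" "\<bar>\<kappa> a\<bar> = 1" using \<kappa>[of a] by auto
    have far: "\<bar>s' u - s' v\<bar> < norm (q' u - q' v)" if u: "u \<in> A0" "u \<noteq> a" for u
    proof -
      have uv: "u \<noteq> v" using u by (auto simp: A0_def)
      have less: "\<delta> < m u" using \<delta>(2) u by simp
      show ?thesis
      proof (cases "{a, u} \<in> T0")
        case True
        let ?w = "q u - q a"
        have L: "\<kappa> a * (s u - s a) = \<bar>s u - s a\<bar>" using side[OF True] \<kappa>[of a] by auto
        have "\<bar>s' u - s' v\<bar> = \<bar>\<kappa> a * (s u - s a) - \<delta>\<bar>"
          using \<kappa>[of a] unfolding old[OF uv] new by auto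
        also have "\<dots> = \<bar>s u - s a\<bar> - \<delta>" using less True unfolding L m_def by simp
        finally have 1: "\<bar>s' u - s' v\<bar> = norm ?w - \<delta>"
          using iso[of u a] True by (simp add: insert_commute)
        have 2: "q' u - q' v = ?w - \<delta> *\<^sub>R \<theta>" unfolding old[OF uv] new by simp
        have "norm ?w < norm (?w - \<delta> *\<^sub>R \<theta>) + \<delta>"
        proof (rule ccontr)
          assume "\<not> ?thesis"
          moreover have "norm ?w \<le> norm (?w - \<delta> *\<^sub>R \<theta>) + norm (\<delta> *\<^sub>R \<theta>)"
            using norm_triangle_ineq[of "?w - \<delta> *\<^sub>R \<theta>" "\<delta> *\<^sub>R \<theta>"] by simp
          ultimately have "norm ((?w - \<delta> *\<^sub>R \<theta>) + \<delta> *\<^sub>R \<theta>) = norm (?w - \<delta> *\<^sub>R \<theta>) + norm (\<delta> *\<^sub>R \<theta>)"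
            using \<theta> \<delta>(1) by simp
          then have "norm (?w - \<delta> *\<^sub>R \<theta>) *\<^sub>R (\<delta> *\<^sub>R \<theta>) = norm (\<delta> *\<^sub>R \<theta>) *\<^sub>R (?w - \<delta> *\<^sub>R \<theta>)"
            by (simp only: norm_triangle_eq)
          then have "\<delta> *\<^sub>R (norm (?w - \<delta> *\<^sub>R \<theta>) *\<^sub>R \<theta>) = \<delta> *\<^sub>R (?w - \<delta> *\<^sub>R \<theta>)"
            using \<theta> \<delta>(1) by (simp add: mult.commute)
          then have "norm (?w - \<delta> *\<^sub>R \<theta>) *\<^sub>R \<theta> = ?w - \<delta> *\<^sub>R \<theta>"
            using \<delta>(1) by (simp only: scaleR_cancel_left) simp
          then have "?w = (norm (?w - \<delta> *\<^sub>R \<theta>) + \<delta>) *\<^sub>R \<theta>" by (simp add: scaleR_add_left)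
          moreover have "norm (?w - \<delta> *\<^sub>R \<theta>) + \<delta> \<noteq> 0"
            using \<delta>(1) norm_ge_zero[of "?w - \<delta> *\<^sub>R \<theta>"] by linarith
          ultimately show False using par by blast
        qed
        then show ?thesis unfolding 1 2 by simp
      next
        case False
        have "\<bar>s' u - s' v\<bar> \<le> \<bar>s u - s a\<bar> + \<delta>"
          using \<kappa>[of a] \<delta>(1) unfolding old[OF uv] new by auto
        moreover have "norm (q u - q a) - \<delta> \<le> norm (q' u - q' v)"
          using norm_triangle_ineq2[of "q u - q a" "\<delta> *\<^sub>R \<theta>"] \<theta> \<delta>(1) unfolding old[OF uv] new
          by (simp add: algebra_simps)
        moreover have "2 * \<delta> < norm (q u - q a) - \<bar>s u - s a\<bar>" using less False by (simp add: m_def)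
        ultimately show ?thesis by linarith
      qed
    qed
    have edge: "{x, y} \<in> T0 \<and> x \<noteq> v \<and> y \<noteq> v \<or> x = v \<and> y = a \<or> x = a \<and> y = v" if "{x, y} \<in> T" for x y
    proof (cases "v \<in> {x, y}")
      case True
      then have "{x, y} \<in> {e \<in> T. v \<in> e}" using that by simp
      then have "{x, y} = {v, a}" unfolding v(2) by simp
      then show ?thesis by (auto simp: doubleton_eq_iff)
    next
      case False
      then show ?thesis using that by (auto simp: T0_def)
    qed
    have va: "norm (q' v - q' a) = \<delta>" "norm (q' a - q' v) = \<delta>" "\<bar>s' v - s' a\<bar> = \<delta>" "\<bar>s' a - s' v\<bar> = \<delta>"
      "\<kappa>' v * (s' a - s' v) = \<delta>" "\<kappa>' a * (s' v - s' a) = \<delta>"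
      using \<theta> \<delta>(1) \<kappa>[of a] unfolding old[OF av] new by auto
    have c1: "norm (q' x - q' y) = \<bar>s' x - s' y\<bar> \<and> 0 < \<kappa>' x * (s' y - s' x)" if "{x, y} \<in> T" for x y
      using edge[OF that] iso[of x y] side[of x y] va \<delta>(1) old[of x] old[of y] by auto
    have c2: "\<bar>s' x - s' y\<bar> < norm (q' x - q' y)" if "x \<in> A" "y \<in> A" "x \<noteq> y" "{x, y} \<notin> T" for x y
    proof -
      have "{v, a} \<in> T" using v(2) by blast
      then have "x = v \<Longrightarrow> y \<noteq> a" "y = v \<Longrightarrow> x \<noteq> a" using that(4) by (auto simp: insert_commute)
      moreover have "x = v \<Longrightarrow> y \<in> A0" "y = v \<Longrightarrow> x \<in> A0" using that by (auto simp: A0_def)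
      ultimately consider "x \<noteq> v" "y \<noteq> v" | "x = v" "y \<in> A0" "y \<noteq> a" | "y = v" "x \<in> A0" "x \<noteq> a"
        by blast
      then show ?thesis
      proof cases
        case 1
        then show ?thesis using space[of x y] that old by (simp add: A0_def T0_def)
      next
        case 2
        then show ?thesis using far[of y] by (simp add: abs_minus_commute norm_minus_commute)
      next
        case 3
        then show ?thesis using far[of x] by simp
      qed
    qed
    have c3: "\<kappa>' x = 1 \<or> \<kappa>' x = - 1" for x using \<kappa>[of x] \<kappa>[of a] by (auto simp: \<kappa>'_def)
    have "isotropic_placement A T q' s' \<kappa>'"
      unfolding isotropic_placement_def by (intro conjI allI impI ballI c1[THEN conjunct1] c1[THEN conjunct2] c2 c3)
    then show ?thesis by blast
  qed
qed

text \<open>Stretching the heights of an isotropic placement by \<open>1 + \<epsilon>\<close> makes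
  the tree edges steep; a small \<open>\<epsilon>\<close> leaves the finitely many other pairs
  flat.\<close>

lemma timelike_tree:
  fixes T :: "'v::finite set set"
  assumes d: "CARD('d::finite) \<ge> 2" and T: "tree_graph T"
  obtains q :: "(real ^ 'd) ^ 'v" and s :: "real ^ 'v" where
    "\<And>e. e \<in> T \<Longrightarrow> norm (edge_diff e q) < \<bar>edge_diff e s\<bar>"
    "\<And>e. card e = 2 \<Longrightarrow> e \<notin> T \<Longrightarrow> \<bar>edge_diff e s\<bar> < norm (edge_diff e q)"
proof -
  have simple: "simple_graph T" using T by (simp add: tree_graph_def)
  have "spanning_tree UNIV T" using T tree_graph_iff_spanning_tree by blast
  from isotropic_spanning_tree[OF d this] obtain q :: "'v \<Rightarrow> real ^ 'd" and s \<kappa> where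
    *: "isotropic_placement UNIV T q s \<kappa>" by blast
  have iso: "norm (q v - q w) = \<bar>s v - s w\<bar> \<and> 0 < \<kappa> v * (s w - s v)" if "{v, w} \<in> T" for v w
    using isotropic_placementD(2,3)[OF * that] by blast
  have space: "\<bar>s v - s w\<bar> < norm (q v - q w)" if "v \<noteq> w" "{v, w} \<notin> T" for v w
    using isotropic_placementD(4)[OF *] that by simp
  define Q S where "Q = (\<chi> v. q v)" and "S = (\<chi> v. s v)"
  have iso': "norm (edge_diff e Q) = \<bar>edge_diff e S\<bar>" "edge_diff e S \<noteq> 0" if "e \<in> T" for e
    using iso[of "src e" "tgt e"] src_tgt(1)[of e] simple that by (auto simp: edge_diff_def Q_def S_def simple_graph_def)
  have space': "\<bar>edge_diff e S\<bar> < norm (edge_diff e Q)" if "card e = 2" "e \<notin> T" for e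
    using space[of "src e" "tgt e"] src_tgt[OF that(1)] that(2) by (simp add: edge_diff_def Q_def S_def)
  \<comment> \<open>Upper bounds for \<open>\<epsilon>\<close>; the summand 1 in the denominator
    covers pairs of equal height.\<close>
  let ?m = "\<lambda>e. (norm (edge_diff e Q) - \<bar>edge_diff e S\<bar>) / (\<bar>edge_diff e S\<bar> + 1)"
  have "0 < ?m e" if "card e = 2" "e \<notin> T" for e
    using space'[OF that] by (intro divide_pos_pos) (simp_all add: add_nonneg_pos)
  then have pos: "0 < d" if "d \<in> ?m ` {e. card e = 2 \<and> e \<notin> T}" for d using that by blast
  have "finite (?m ` {e. card e = 2 \<and> e \<notin> T})" by simp
  from exists_pos_less_finite[OF this pos]
  obtain \<epsilon> where "\<epsilon> > 0" "\<forall>d\<in>?m ` {e. card e = 2 \<and> e \<notin> T}. \<epsilon> < d" by blast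
  then have \<epsilon>: "\<epsilon> > 0" "\<And>e. card e = 2 \<Longrightarrow> e \<notin> T \<Longrightarrow> \<epsilon> < ?m e" by blast+
  have sc: "edge_diff e ((1 + \<epsilon>) *\<^sub>R S) = (1 + \<epsilon>) * edge_diff e S" for e
    using linear_scale[OF linear_edge_diff, of e "1 + \<epsilon>" S] by simp
  show ?thesis
  proof (rule that[of Q "(1 + \<epsilon>) *\<^sub>R S"])
    show "norm (edge_diff e Q) < \<bar>edge_diff e ((1 + \<epsilon>) *\<^sub>R S)\<bar>" if "e \<in> T" for e
      using iso'[OF that] \<epsilon>(1) unfolding sc abs_mult by simp
    show "\<bar>edge_diff e ((1 + \<epsilon>) *\<^sub>R S)\<bar> < norm (edge_diff e Q)" if "card e = 2" "e \<notin> T" for e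
    proof -
      have "\<epsilon> * (\<bar>edge_diff e S\<bar> + 1) < norm (edge_diff e Q) - \<bar>edge_diff e S\<bar>"
        using \<epsilon>(2)[OF that] by (subst (asm) pos_less_divide_eq) (simp_all add: add_nonneg_pos)
      then show ?thesis using \<epsilon>(1) unfolding sc abs_mult by (simp add: algebra_simps)
    qed
  qed
qed

text \<open>\<open>H\<close>, \<open>T\<close> is the pattern realised by the placement,
  \<open>H0\<close>, \<open>T0\<close> a given decomposition that supplies the edge count; over a
  line the two may differ.\<close>

lemma cylindrical_of_pattern:
  fixes E :: "'v::finite set set" and q :: "(real ^ 'd::finite) ^ 'v" and s :: "real ^ 'v"
  assumes E: "simple_graph E" and HT: "H \<union> T = E" "H \<inter> T = {}"
    and H: "\<And>e. e \<in> H \<Longrightarrow> \<bar>edge_diff e s\<bar> < norm (edge_diff e q)"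
    and T: "\<And>e. e \<in> T \<Longrightarrow> norm (edge_diff e q) < \<bar>edge_diff e s\<bar>"
    and dual: "dual_system H (\<lambda>e x. sgn (edge_diff e q) \<bullet> edge_diff e x)" and tree: "tree_graph T"
    and span: "affinely_spanning q"
    and H0T0: "H0 \<union> T0 = E" "H0 \<inter> T0 = {}" "minimally_rigid (norm :: real ^ 'd \<Rightarrow> real) H0" "tree_graph T0"
  shows "minimally_rigid (cylindrical_norm :: (real ^ 'd) \<times> real \<Rightarrow> real) E"
proof -
  define p where "p = pairv q s"
  have d: "fst (edge_diff e p) = edge_diff e q" "snd (edge_diff e p) = edge_diff e s" for e
    unfolding p_def by (simp_all add: edge_diff_pair[of e "pairv q s"])
  define f where "f e x = (if e \<in> H then sgn (edge_diff e q) \<bullet> edge_diff e (fstv x)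
        else sgn (edge_diff e s) * edge_diff e (sndv x))" for e and x :: "((real ^ 'd) \<times> real) ^ 'v"
  have lin: "linear (f e)" for e
    unfolding f_def using linear_compose[OF linear_fstv linear_inner_edge_diff[of "sgn (edge_diff e q)" e]]
      linear_compose[OF linear_sndv linear_mult_edge_diff[of "sgn (edge_diff e s)" e]]
    by (cases "e \<in> H") (simp_all add: o_def)
  have ne: "norm (edge_diff e q) \<noteq> \<bar>edge_diff e s\<bar>" "e \<in> H \<longleftrightarrow> norm (edge_diff e q) > \<bar>edge_diff e s\<bar>" if "e \<in> E" for e
    using H[of e] T[of e] that HT by fastforce+
  then have wp: "well_positioned cylindrical_norm E p"
    using well_positioned_cylindrical(1)[OF E, of p] by (simp add: d)
  have "dual_system T (\<lambda>e (x :: real ^ 'v). sgn (edge_diff e s) * edge_diff e x)"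
  proof (rule dual_system_scale)
    show "dual_system T (\<lambda>e (x :: real ^ 'v). edge_diff e x)"
      using tree tree_graph_iff[of T] by (simp add: tree_graph_def)
    show "sgn (edge_diff e s) \<noteq> 0" if "e \<in> T" for e
      using T[OF that] norm_ge_zero[of "edge_diff e q"] by (auto simp: sgn_0_0)
  qed (rule linear_edge_diff)
  then have "dual_system E f"
    unfolding HT(1)[symmetric] f_def[abs_def] using dual
    by (subst dual_system_product[OF HT(2)]) (simp_all add: linear_inner_edge_diff linear_mult_edge_diff)
  moreover have "rigidity_differential cylindrical_norm E p = functional_map E f"
    unfolding well_positioned_cylindrical(2)[OF E wp] functional_map_def d f_def
    by (intro ext) (auto simp: vec_eq_iff inner_prod_def edge_diff_pair ne)
  moreover have "affinely_spanning (fstv p)" using span by (simp add: p_def)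
  moreover have "simple_graph H0" using E H0T0(1) by (auto intro: simple_graph_subset)
  ultimately show ?thesis
    using minimally_rigid_of_dual_system[of cylindrical_norm E p f, OF wp _ lin _ infinitesimal_motions_cylindrical]
      H0T0 by blast
qed

lemma exists_frame:
  assumes "CARD('v::finite) \<ge> CARD('d::finite) + 1"
  shows "\<exists>u :: 'd option \<Rightarrow> 'v. inj u"
proof -
  have "card (UNIV :: 'd option set) \<le> card (UNIV :: 'v set)" using assms by simp
  then show ?thesis using card_le_inj[of "UNIV :: 'd option set" "UNIV :: 'v set"] by auto
qed

lemma continuous_on_edge_diff: "continuous_on S (\<lambda>x :: 'a::euclidean_space ^ 'v::finite. edge_diff e x)"
  using linear_continuous_on[OF bounded_linear_edge_diff] .

text \<open>The heights \<open>s\<close> are kept fixed. The pattern is an open condition on the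
  base placement, which can therefore be made generic for \<open>H\<close> without changing
  it.\<close>

lemma decomposition_imp_cylindrical_ge_2:
  fixes E :: "'v::finite set set"
  assumes E: "simple_graph E" and card: "CARD('v) \<ge> CARD('d::finite) + 1" and d: "CARD('d) \<ge> 2"
    and HT: "H \<union> T = E" "H \<inter> T = {}" "minimally_rigid (norm :: real ^ 'd \<Rightarrow> real) H" "tree_graph T"
  shows "minimally_rigid (cylindrical_norm :: (real ^ 'd) \<times> real \<Rightarrow> real) E"
proof -
  have H: "simple_graph H" using E HT(1) by (auto intro: simple_graph_subset)
  obtain u :: "'d option \<Rightarrow> 'v" where u: "inj u" using exists_frame[OF card] by blast
  obtain q' :: "(real ^ 'd) ^ 'v" and s :: "real ^ 'v" where q':
    "\<And>e. e \<in> T \<Longrightarrow> norm (edge_diff e q') < \<bar>edge_diff e s\<bar>"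
    "\<And>e. card e = 2 \<Longrightarrow> e \<notin> T \<Longrightarrow> \<bar>edge_diff e s\<bar> < norm (edge_diff e q')"
    using timelike_tree[OF d HT(4)] by blast
  define U where "U = (\<Inter>e\<in>T. {q :: (real ^ 'd) ^ 'v. norm (edge_diff e q) < \<bar>edge_diff e s\<bar>}) \<inter>
    (\<Inter>e\<in>H. {q. \<bar>edge_diff e s\<bar> < norm (edge_diff e q)})"
  have "open U" unfolding U_def
    by (intro open_Int open_INT ballI open_Collect_less continuous_intros continuous_on_edge_diff) simp_all
  moreover have "q' \<in> U" using q' HT(2) H by (auto simp: U_def simple_graph_def)
  ultimately obtain q where q: "q \<in> U" "frame_det u q \<noteq> 0"
    "dual_system H (\<lambda>e x. edge_diff e q \<bullet> edge_diff e x)"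
    using generic_placement[OF H HT(3) u, of U q'] by blast
  have nz: "edge_diff e q \<noteq> 0" if "e \<in> H" for e using q(1) that by (auto simp: U_def)
  show ?thesis
  proof (rule cylindrical_of_pattern[OF E HT(1,2) _ _ _ HT(4) _ HT])
    show "\<bar>edge_diff e s\<bar> < norm (edge_diff e q)" if "e \<in> H" for e using q(1) that by (simp add: U_def)
    show "norm (edge_diff e q) < \<bar>edge_diff e s\<bar>" if "e \<in> T" for e using q(1) that by (simp add: U_def)
    show "dual_system H (\<lambda>e x. sgn (edge_diff e q) \<bullet> edge_diff e x)"
      using q(3) dual_system_sgn_iff[OF nz] by blast
    show "affinely_spanning q" using affinely_spanning_of_frame_det[OF q(2)] .
  qed
qed

section \<open>Conical spaces over spaces of dimension at least two\<close>

text \<open>Real analyticity on the whole line in the form needed for the identity theorem: an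
  extension to a connected open set, here a strip of uniform width.\<close>

definition strip_analytic :: "(real \<Rightarrow> real) \<Rightarrow> bool" where
  "strip_analytic F \<longleftrightarrow> (\<exists>\<epsilon>>0. \<exists>f. f holomorphic_on {z. \<bar>Im z\<bar> < \<epsilon>} \<and> (\<forall>t. f (complex_of_real t) = complex_of_real (F t)))"

lemma strip_analytic_const: "strip_analytic (\<lambda>_. c)"
  unfolding strip_analytic_def
  by (intro exI[of _ 1] conjI exI[of _ "\<lambda>_. complex_of_real c"] holomorphic_intros) auto

lemma strip_analytic_ident: "strip_analytic (\<lambda>t. t)"
  unfolding strip_analytic_def
  by (intro exI[of _ 1] conjI exI[of _ "\<lambda>z. z"] holomorphic_intros) auto

lemma strip_analytic_add:
  assumes "strip_analytic F" "strip_analytic G"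
  shows "strip_analytic (\<lambda>t. F t + G t)"
proof -
  obtain \<epsilon> f \<delta> g where f: "\<epsilon> > 0" "f holomorphic_on {z. \<bar>Im z\<bar> < \<epsilon>}" "\<And>t. f (complex_of_real t) = complex_of_real (F t)"
    and g: "\<delta> > 0" "g holomorphic_on {z. \<bar>Im z\<bar> < \<delta>}" "\<And>t. g (complex_of_real t) = complex_of_real (G t)"
    using assms unfolding strip_analytic_def by blast
  have "f holomorphic_on {z. \<bar>Im z\<bar> < min \<epsilon> \<delta>}" "g holomorphic_on {z. \<bar>Im z\<bar> < min \<epsilon> \<delta>}"
    using f(2) g(2) by (auto elim: holomorphic_on_subset)
  then show ?thesis unfolding strip_analytic_def using f(1,3) g(1,3)
    by (intro exI[of _ "min \<epsilon> \<delta>"] conjI exI[of _ "\<lambda>z. f z + g z"] holomorphic_intros) auto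
qed

lemma strip_analytic_mult:
  assumes "strip_analytic F" "strip_analytic G"
  shows "strip_analytic (\<lambda>t. F t * G t)"
proof -
  obtain \<epsilon> f \<delta> g where f: "\<epsilon> > 0" "f holomorphic_on {z. \<bar>Im z\<bar> < \<epsilon>}" "\<And>t. f (complex_of_real t) = complex_of_real (F t)"
    and g: "\<delta> > 0" "g holomorphic_on {z. \<bar>Im z\<bar> < \<delta>}" "\<And>t. g (complex_of_real t) = complex_of_real (G t)"
    using assms unfolding strip_analytic_def by blast
  have "f holomorphic_on {z. \<bar>Im z\<bar> < min \<epsilon> \<delta>}" "g holomorphic_on {z. \<bar>Im z\<bar> < min \<epsilon> \<delta>}"
    using f(2) g(2) by (auto elim: holomorphic_on_subset)
  then show ?thesis unfolding strip_analytic_def using f(1,3) g(1,3)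
    by (intro exI[of _ "min \<epsilon> \<delta>"] conjI exI[of _ "\<lambda>z. f z * g z"] holomorphic_intros) auto
qed

lemma strip_analytic_sum:
  assumes "\<And>i. i \<in> I \<Longrightarrow> strip_analytic (F i)"
  shows "strip_analytic (\<lambda>t. \<Sum>i\<in>I. F i t)"
  using assms
  by (induction I rule: infinite_finite_induct) (auto intro: strip_analytic_const strip_analytic_add)

lemma strip_analytic_prod:
  assumes "\<And>i. i \<in> I \<Longrightarrow> strip_analytic (F i)"
  shows "strip_analytic (\<lambda>t. \<Prod>i\<in>I. F i t)"
  using assms
  by (induction I rule: infinite_finite_induct) (auto intro: strip_analytic_const strip_analytic_mult)

lemma strip_analytic_det:
  fixes M :: "real \<Rightarrow> real ^ 'n ^ 'n::finite"
  assumes "\<And>i j. strip_analytic (\<lambda>t. M t $ i $ j)"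
  shows "strip_analytic (\<lambda>t. det (M t))"
  unfolding det_def
  by (intro strip_analytic_sum strip_analytic_mult strip_analytic_const strip_analytic_prod assms)

lemma strip_analytic_poly: "strip_analytic (poly P)"
proof (induction P)
  case (pCons a P)
  then have "strip_analytic (\<lambda>t. a + t * poly P t)"
    by (intro strip_analytic_add strip_analytic_mult strip_analytic_const strip_analytic_ident)
  then show ?case by (simp add: poly_pCons[abs_def])
qed (simp add: strip_analytic_const poly_0[abs_def])

lemma strip_analytic_line_polynomial:
  assumes "line_polynomial F"
  shows "strip_analytic (\<lambda>t. F (x + t *\<^sub>R y))"
  using assms strip_analytic_poly unfolding line_polynomial_def by (metis (no_types, lifting) ext)

text \<open>Completing the square writes the squared length as
  \<open>m + C * (t + B / C)\<^sup>2\<close> with minimum \<open>m > 0\<close>. As long as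
  \<open>C * (Im z)\<^sup>2 < m\<close> its continuation has positive real part, so the principal
  square root is holomorphic; hence the width \<open>sqrt (m / C)\<close>.\<close>

lemma strip_analytic_norm_line:
  fixes a c :: "'a::real_inner"
  assumes ne: "\<And>t. a + t *\<^sub>R c \<noteq> 0"
  shows "strip_analytic (\<lambda>t. norm (a + t *\<^sub>R c))"
proof (cases "c = 0")
  case True
  then show ?thesis by (simp add: strip_analytic_const)
next
  case False
  define A B C where "A = a \<bullet> a" and "B = a \<bullet> c" and "C = c \<bullet> c"
  have C: "C > 0" using False by (simp add: C_def)
  have Q: "(a + t *\<^sub>R c) \<bullet> (a + t *\<^sub>R c) = A + 2 * B * t + C * t\<^sup>2" for t
    by (simp add: A_def B_def C_def inner_add inner_commute power2_eq_square algebra_simps)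
  define m where "m = A - B\<^sup>2 / C"
  have square: "A + 2 * B * t + C * t\<^sup>2 = m + C * (t + B / C)\<^sup>2" for t
    using C by (simp add: m_def field_simps power2_eq_square)
  have "0 < (a + (- B / C) *\<^sub>R c) \<bullet> (a + (- B / C) *\<^sub>R c)" using ne[of "- B / C"] by (simp only: inner_gt_zero_iff) simp
  then have m: "m > 0" unfolding Q square by simp
  define \<epsilon> where "\<epsilon> = sqrt (m / C)"
  have \<epsilon>: "\<epsilon> > 0" "C * \<epsilon>\<^sup>2 = m" using m C by (simp_all add: \<epsilon>_def)
  define g where "g z = of_real A + of_real (2 * B) * z + of_real C * z\<^sup>2" for z :: complex
  have "g z \<notin> \<real>\<^sub>\<le>\<^sub>0" if "\<bar>Im z\<bar> < \<epsilon>" for z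
  proof -
    have "(Im z)\<^sup>2 < \<epsilon>\<^sup>2" using power_strict_mono[OF that, of 2] by simp
    then have "C * (Im z)\<^sup>2 < m" using C \<epsilon>(2) by (metis mult_strict_left_mono)
    moreover have "Re (g z) = A + 2 * B * Re z + C * (Re z)\<^sup>2 - C * (Im z)\<^sup>2"
      by (simp add: g_def power2_eq_square algebra_simps)
    moreover have "C * (Re z + B / C)\<^sup>2 \<ge> 0" using C by simp
    ultimately have "Re (g z) > 0" unfolding square by linarith
    then show ?thesis by (auto simp: complex_nonpos_Reals_iff)
  qed
  then have "(\<lambda>z. csqrt (g z)) holomorphic_on {z. \<bar>Im z\<bar> < \<epsilon>}"
    unfolding g_def by (intro holomorphic_intros) auto
  moreover have "csqrt (g (of_real t)) = of_real (norm (a + t *\<^sub>R c))" for t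
  proof -
    have "g (of_real t) = of_real ((a + t *\<^sub>R c) \<bullet> (a + t *\<^sub>R c))" unfolding Q by (simp add: g_def)
    then show ?thesis by (simp only: norm_eq_sqrt_inner[of "a + t *\<^sub>R c"] of_real_sqrt[OF inner_ge_zero])
  qed
  ultimately show ?thesis unfolding strip_analytic_def using \<epsilon>(1)
    by (intro exI[of _ \<epsilon>] conjI exI[of _ "\<lambda>z. csqrt (g z)"] allI)
qed

text \<open>A half-line has accumulation points inside the strip, so vanishing on it would propagate
  to the whole line.\<close>

lemma strip_analytic_nonzero:
  assumes F: "strip_analytic F" and "F x \<noteq> 0"
  shows "\<exists>t>a. F t \<noteq> 0"
proof (rule ccontr)
  assume "\<not> ?thesis"
  then have 0: "F t = 0" if "t > a" for t using that by blast
  obtain \<epsilon> f where f: "\<epsilon> > 0" "f holomorphic_on {z. \<bar>Im z\<bar> < \<epsilon>}" "\<And>t. f (complex_of_real t) = complex_of_real (F t)"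
    using F unfolding strip_analytic_def by blast
  have S: "{z. \<bar>Im z\<bar> < \<epsilon>} = {z. Im z < \<epsilon>} \<inter> {z. Im z > - \<epsilon>}" by auto
  have "f (complex_of_real x) = 0"
  proof (rule analytic_continuation[OF f(2)])
    show "open {z. \<bar>Im z\<bar> < \<epsilon>}" unfolding S by (intro open_Int open_halfspace_Im_lt open_halfspace_Im_gt)
    show "connected {z. \<bar>Im z\<bar> < \<epsilon>}" unfolding S
      by (intro convex_connected convex_Int convex_halfspace_Im_lt convex_halfspace_Im_gt)
    show "complex_of_real ` {a<..} \<subseteq> {z. \<bar>Im z\<bar> < \<epsilon>}" using f(1) by auto
    show "complex_of_real (a + 1) \<in> {z. \<bar>Im z\<bar> < \<epsilon>}" "complex_of_real x \<in> {z. \<bar>Im z\<bar> < \<epsilon>}" using f(1) by auto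
    show "complex_of_real (a + 1) islimpt complex_of_real ` {a<..}"
      unfolding islimpt_approachable
    proof (intro allI impI)
      fix e :: real assume "e > 0"
      then show "\<exists>x'\<in>complex_of_real ` {a<..}. x' \<noteq> complex_of_real (a + 1) \<and> dist x' (complex_of_real (a + 1)) < e"
        by (intro bexI[of _ "complex_of_real (a + 1 + e / 2)"]) (auto simp: dist_of_real dist_real_def simp del: of_real_add)
    qed
    show "f z = 0" if "z \<in> complex_of_real ` {a<..}" for z using that 0 f(3) by auto
  qed
  then show False using f(3) assms(2) by simp
qed

text \<open>A row of the conical rigidity matrix multiplied by the length of the base edge. Heights
  occur only through the signs \<open>\<tau>\<close>, which are treated as free parameters.\<close>

definition cone_row :: "('v set \<Rightarrow> real) \<Rightarrow> 'a::euclidean_space ^ 'v::finite \<Rightarrow> 'v set \<Rightarrow> ('a \<times> real) ^ 'v \<Rightarrow> real" where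
  "cone_row \<tau> q e x = edge_diff e q \<bullet> edge_diff e (fstv x) + \<tau> e * norm (edge_diff e q) * edge_diff e (sndv x)"

lemma linear_cone_row: "linear (cone_row \<tau> q e)"
proof -
  have "linear (\<lambda>x. edge_diff e q \<bullet> edge_diff e (fstv x))"
    "linear (\<lambda>x :: ('a \<times> real) ^ 'b. \<tau> e * norm (edge_diff e q) * edge_diff e (sndv x))"
    using linear_compose[OF linear_fstv linear_inner_edge_diff[of "edge_diff e q" e]]
      linear_compose[OF linear_sndv linear_mult_edge_diff[of "\<tau> e * norm (edge_diff e q)" e]] by (simp_all add: o_def)
  from linear_compose_add[OF this] show ?thesis by (simp add: cone_row_def[abs_def])
qed

text \<open>Asks which sign patterns admit an independent base placement; actual heights are brought
  in at the end.\<close>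

definition cone_realizable :: "('d::finite option \<Rightarrow> 'v::finite) \<Rightarrow> 'v set set \<Rightarrow> ('v set \<Rightarrow> real) \<Rightarrow> bool" where
  "cone_realizable u E \<tau> \<longleftrightarrow> (\<exists>q :: (real ^ 'd) ^ 'v. (\<forall>e\<in>E. edge_diff e q \<noteq> 0) \<and> frame_det u q \<noteq> 0 \<and>
     dual_system E (cone_row \<tau> q))"

section \<open>Changing the signs one edge at a time\<close>

lemma exists_injective_labelling: "\<exists>n :: 'v::finite \<Rightarrow> real. inj n"
proof -
  obtain f :: "'v \<Rightarrow> nat" where "inj f"
    using finite_imp_inj_to_nat_seg[of "UNIV :: 'v set"] by auto
  then have "inj (\<lambda>v. real (f v))" by (auto simp: inj_def)
  then show ?thesis by blast
qed

text \<open>Move the placement along a line on which the edge \<open>e0\<close> shrinks to a point at time \<open>1\<close> and is reflected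
  afterwards, while no other edge degenerates.  The analytic continuation of the length of \<open>e0\<close> beyond time \<open>1\<close> is
  its negative.\<close>

lemma cone_realizable_flip:
  fixes u :: "'d::finite option \<Rightarrow> 'v::finite"
  assumes E: "simple_graph E" and d: "CARD('d) \<ge> 2" and e0: "e0 \<in> E" and real: "cone_realizable u E \<tau>"
  shows "cone_realizable u E (\<tau>(e0 := - \<tau> e0))"
proof -
  obtain q :: "(real ^ 'd) ^ 'v" where q: "\<And>e. e \<in> E \<Longrightarrow> edge_diff e q \<noteq> 0" "frame_det u q \<noteq> 0"
    "dual_system E (cone_row \<tau> q)" using real unfolding cone_realizable_def by blast
  have "finite ((\<lambda>e. edge_diff e q) ` E)" by simp
  from exists_direction[OF d this] obtain z where z: "\<And>e c. e \<in> E \<Longrightarrow> z \<noteq> c *\<^sub>R edge_diff e q" by blast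
  obtain n :: "'v \<Rightarrow> real" where n: "inj n" using exists_injective_labelling by blast
  \<comment> \<open>\<open>n\<close> is injective, so \<open>h\<close> identifies the ends of
    \<open>e0\<close> and no other pair of vertices: at time 1 the placement \<open>\<gamma>\<close>
    lies on the line spanned by \<open>z\<close>, and \<open>e0\<close> is its only degenerate
    edge.\<close>
  define h where "h v = (if v = src e0 then n (tgt e0) else n v)" for v
  define k where "k e = h (src e) - h (tgt e)" for e
  have st: "e = {src e, tgt e}" "src e \<noteq> tgt e" if "e \<in> E" for e
    using src_tgt[of e] E that by (simp_all add: simple_graph_def)
  have k: "k e \<noteq> 0" if "e \<in> E" "e \<noteq> e0" for e
  proof
    assume "k e = 0"
    then have "{src e, tgt e} = {src e0, tgt e0}"
      using st(2)[OF that(1)] st(2)[OF e0] injD[OF n] by (auto simp: k_def h_def split: if_splits)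
    then show False using st(1)[OF that(1)] st(1)[OF e0] that(2) by simp
  qed
  have k0: "k e0 = 0" using st(2)[OF e0] by (simp add: k_def h_def)
  define r where "r = (\<chi> v. h v *\<^sub>R z) - q"
  define \<gamma> where "\<gamma> t = q + t *\<^sub>R r" for t :: real
  have r: "edge_diff e r = k e *\<^sub>R z - edge_diff e q" for e
    by (simp add: r_def k_def edge_diff_def scaleR_diff_left)
  have \<gamma>: "edge_diff e (\<gamma> t) = edge_diff e q + t *\<^sub>R (k e *\<^sub>R z - edge_diff e q)" for e t
    unfolding \<gamma>_def by (simp only: linear_add[OF linear_edge_diff] linear_scale[OF linear_edge_diff] r)
  have \<gamma>0: "edge_diff e0 (\<gamma> t) = (1 - t) *\<^sub>R edge_diff e0 q" for t
    by (simp add: \<gamma> k0 scaleR_diff_left)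
  \<comment> \<open>The line through \<open>edge_diff e q\<close> and the nonzero multiple
    \<open>k e *\<^sub>R z\<close> misses 0, since the two are not parallel.\<close>
  have nz: "edge_diff e q + t *\<^sub>R (k e *\<^sub>R z - edge_diff e q) \<noteq> 0" if e: "e \<in> E" "e \<noteq> e0" for e t
  proof
    assume *: "edge_diff e q + t *\<^sub>R (k e *\<^sub>R z - edge_diff e q) = 0"
    then have "t \<noteq> 0" using q(1)[OF e(1)] by auto
    have "(t * k e) *\<^sub>R z = (t - 1) *\<^sub>R edge_diff e q" using * by (simp add: algebra_simps eq_diff_eq)
    then have "z = ((t - 1) / (t * k e)) *\<^sub>R edge_diff e q"
      using \<open>t \<noteq> 0\<close> k[OF e] by (metis (no_types, lifting) divide_inverse_commute eq_vector_fraction_iff mult_eq_0_iff scaleR_scaleR)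
    then show False using z[OF e(1)] by blast
  qed
  obtain b where b: "det (pairing_matrix E (cone_row \<tau> q) b) \<noteq> 0"
    using q(3) unfolding dual_system_iff_det[OF linear_cone_row] by blast
  \<comment> \<open>The length of \<open>e0\<close> at time \<open>t\<close> is
    \<open>\<bar>1 - t\<bar>\<close> times a constant; \<open>R\<close> uses the analytic
    continuation \<open>1 - t\<close> instead. Beyond time 1 this is the row with the sign of
    \<open>e0\<close> reversed.\<close>
  define R where "R t e x = (if e = e0 then (1 - t) * cone_row \<tau> q e0 x else cone_row \<tau> (\<gamma> t) e x)" for t e x
  define G where "G t = det (pairing_matrix E (R t) b) * frame_det u (\<gamma> t)" for t
  have "strip_analytic G"
    unfolding G_def
  proof (intro strip_analytic_mult strip_analytic_det)
    show "strip_analytic (\<lambda>t. frame_det u (\<gamma> t))"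
      unfolding \<gamma>_def by (intro strip_analytic_line_polynomial line_polynomial_frame_det)
    fix e e'
    have "strip_analytic (\<lambda>t. R t e x)" if "e \<in> E" for x
    proof (cases "e = e0")
      case True
      have "strip_analytic (\<lambda>t. (1 + (- 1) * t) * cone_row \<tau> q e0 x)"
        by (intro strip_analytic_mult strip_analytic_add strip_analytic_const strip_analytic_ident)
      then show ?thesis using True by (simp add: R_def)
    next
      case False
      have "strip_analytic (\<lambda>t. norm (edge_diff e q + t *\<^sub>R (k e *\<^sub>R z - edge_diff e q)))"
        by (intro strip_analytic_norm_line nz that False)
      moreover have "strip_analytic (\<lambda>t. (edge_diff e q \<bullet> edge_diff e (fstv x)) + t * ((k e *\<^sub>R z - edge_diff e q) \<bullet> edge_diff e (fstv x)))"
        by (intro strip_analytic_mult strip_analytic_add strip_analytic_const strip_analytic_ident)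
      ultimately have "strip_analytic (\<lambda>t. ((edge_diff e q \<bullet> edge_diff e (fstv x)) + t * ((k e *\<^sub>R z - edge_diff e q) \<bullet> edge_diff e (fstv x)))
          + \<tau> e * norm (edge_diff e q + t *\<^sub>R (k e *\<^sub>R z - edge_diff e q)) * edge_diff e (sndv x))"
        by (intro strip_analytic_mult strip_analytic_add strip_analytic_const strip_analytic_ident)
      then show ?thesis using False by (simp add: R_def cone_row_def \<gamma> inner_add_left)
    qed
    then show "strip_analytic (\<lambda>t. pairing_matrix E (R t) b $ e $ e')"
      unfolding pairing_matrix_def by (cases "e \<in> E \<and> e' \<in> E") (auto simp: strip_analytic_const)
  qed
  moreover have "G 0 \<noteq> 0"
  proof -
    have "R 0 = cone_row \<tau> q" by (intro ext) (simp add: R_def \<gamma>_def)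
    then show ?thesis using b q(2) by (simp add: G_def \<gamma>_def)
  qed
  ultimately obtain t where t: "t > 1" "G t \<noteq> 0" using strip_analytic_nonzero by blast
  have nrm: "norm (edge_diff e0 (\<gamma> t)) = (t - 1) * norm (edge_diff e0 q)" unfolding \<gamma>0 using t(1) by simp
  have "cone_row (\<tau>(e0 := - \<tau> e0)) (\<gamma> t) e0 x = (1 - t) * cone_row \<tau> q e0 x" for x
    unfolding cone_row_def nrm unfolding \<gamma>0 by (simp add: algebra_simps)
  then have "R t e x = cone_row (\<tau>(e0 := - \<tau> e0)) (\<gamma> t) e x" for e x
    by (cases "e = e0") (simp_all add: R_def cone_row_def)
  then have "R t = cone_row (\<tau>(e0 := - \<tau> e0)) (\<gamma> t)" by blast
  then have "dual_system E (cone_row (\<tau>(e0 := - \<tau> e0)) (\<gamma> t))"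
    using t(2) unfolding dual_system_iff_det[OF linear_cone_row] G_def by auto
  moreover have "frame_det u (\<gamma> t) \<noteq> 0" using t(2) by (simp add: G_def)
  moreover have "edge_diff e (\<gamma> t) \<noteq> 0" if "e \<in> E" for e
    using nz[OF that] \<gamma>[of e t] \<gamma>0[of t] q(1)[OF e0] t(1) by (cases "e = e0") auto
  ultimately show ?thesis unfolding cone_realizable_def by blast
qed

lemma cone_realizable_all_signs:
  fixes u :: "'d::finite option \<Rightarrow> 'v::finite"
  assumes E: "simple_graph E" and d: "CARD('d) \<ge> 2" and real: "cone_realizable u E \<tau>"
    and \<tau>: "\<And>e. e \<in> E \<Longrightarrow> \<tau> e = 1 \<or> \<tau> e = - 1" and \<sigma>: "\<And>e. e \<in> E \<Longrightarrow> \<sigma> e = 1 \<or> \<sigma> e = - 1"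
  shows "cone_realizable u E \<sigma>"
proof -
  have flip: "cone_realizable u E (\<lambda>e. if e \<in> F then - \<tau> e else \<tau> e)" if "finite F" "F \<subseteq> E" for F
    using that
  proof (induction F rule: finite_induct)
    case empty
    then show ?case using real by simp
  next
    case (insert e0 F)
    let ?\<tau> = "\<lambda>e. if e \<in> F then - \<tau> e else \<tau> e"
    have "cone_realizable u E (?\<tau>(e0 := - ?\<tau> e0))"
      using insert by (intro cone_realizable_flip[OF E d]) auto
    moreover have "?\<tau>(e0 := - ?\<tau> e0) = (\<lambda>e. if e \<in> insert e0 F then - \<tau> e else \<tau> e)"
      using insert.hyps(2) by (auto simp: fun_eq_iff)
    ultimately show ?case by simp
  qed
  define F where "F = {e \<in> E. \<sigma> e \<noteq> \<tau> e}"
  have "cone_realizable u E (\<lambda>e. if e \<in> F then - \<tau> e else \<tau> e)" by (rule flip) (auto simp: F_def)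
  moreover have "(if e \<in> F then - \<tau> e else \<tau> e) = \<sigma> e" if "e \<in> E" for e
    using \<tau>[OF that] \<sigma>[OF that] that by (auto simp: F_def)
  then have "dual_system E (cone_row (\<lambda>e. if e \<in> F then - \<tau> e else \<tau> e) q) \<longleftrightarrow> dual_system E (cone_row \<sigma> q)"
    for q :: "(real ^ 'd) ^ 'v"
    by (intro dual_system_cong) (simp add: cone_row_def)
  ultimately show ?thesis unfolding cone_realizable_def by simp
qed

lemma decomposition_imp_conical_ge_2:
  fixes E :: "'v::finite set set"
  assumes E: "simple_graph E" and card: "CARD('v) \<ge> CARD('d::finite) + 1" and d: "CARD('d) \<ge> 2"
    and HT: "H \<union> T = E" "H \<inter> T = {}" "minimally_rigid (norm :: real ^ 'd \<Rightarrow> real) H" "tree_graph T"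
  shows "minimally_rigid (conical_norm :: (real ^ 'd) \<times> real \<Rightarrow> real) E"
proof -
  have H: "simple_graph H" using E HT(1) by (auto intro: simple_graph_subset)
  obtain u :: "'d option \<Rightarrow> 'v" where u: "inj u" using exists_frame[OF card] by blast
  obtain n :: "'v \<Rightarrow> real" where n: "inj n" using exists_injective_labelling by blast
  have n': "n (src e) \<noteq> n (tgt e)" if "e \<in> E" for e
    using src_tgt(2)[of e] E that injD[OF n] by (auto simp: simple_graph_def)
  define U where "U = (\<Inter>e\<in>E. {q :: (real ^ 'd) ^ 'v. 0 < norm (edge_diff e q)})"
  have "open U" unfolding U_def
    by (intro open_INT ballI open_Collect_less continuous_intros continuous_on_edge_diff) simp
  obtain z :: "real ^ 'd" where z: "z \<noteq> 0" using exists_direction[OF d, of "{}"] by auto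
  have "edge_diff e (\<chi> v. n v *\<^sub>R z) = (n (src e) - n (tgt e)) *\<^sub>R z" for e
    by (simp add: edge_diff_def scaleR_diff_left)
  then have "(\<chi> v. n v *\<^sub>R z) \<in> U" using n' z by (auto simp: U_def)
  with \<open>open U\<close> obtain q where q: "q \<in> U" "frame_det u q \<noteq> 0"
    "dual_system H (\<lambda>e x. edge_diff e q \<bullet> edge_diff e x)"
    using generic_placement[OF H HT(3) u] by blast
  have nz: "edge_diff e q \<noteq> 0" if "e \<in> E" for e using q(1) that by (auto simp: U_def)
  have "dual_system T (\<lambda>e (x :: real ^ 'v). norm (edge_diff e q) * edge_diff e x)"
  proof (rule dual_system_scale)
    show "dual_system T (\<lambda>e (x :: real ^ 'v). edge_diff e x)"
      using HT(4) tree_graph_iff[of T] by (simp add: tree_graph_def)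
    show "norm (edge_diff e q) \<noteq> 0" if "e \<in> T" for e using nz[of e] HT(1) that by auto
  qed (rule linear_edge_diff)
  then have split: "dual_system E (\<lambda>e (x :: ((real ^ 'd) \<times> real) ^ 'v). if e \<in> H then edge_diff e q \<bullet> edge_diff e (fstv x)
      else norm (edge_diff e q) * edge_diff e (sndv x))" (is "dual_system E ?f")
    using q(3) unfolding HT(1)[symmetric]
    by (subst dual_system_product[OF HT(2)]) (simp_all add: linear_inner_edge_diff linear_mult_edge_diff)
  \<comment> \<open>The base row is half the sum, and the vertical row half the difference, of the
    conical rows with \<open>\<tau> = 1\<close> and \<open>\<tau> = - 1\<close>. Multilinearity
    therefore yields some sign pattern with independent rows.\<close>
  define w where "w e = (if e \<in> H then 1 / 2 else - 1 / 2 :: real)" for e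
  have sum: "?f e x = (1 / 2) * cone_row (\<lambda>_. 1) q e x + w e * cone_row (\<lambda>_. - 1) q e x" for e x
    by (auto simp: w_def cone_row_def add_divide_distrib diff_divide_distrib)
  have lin: "linear (\<lambda>x. c * cone_row \<tau> q e x)" for c \<tau> e
    using linear_compose_scale_right[OF linear_cone_row, of c] by simp
  have "finite E" by simp
  then obtain F where F: "F \<subseteq> E"
    "dual_system E (\<lambda>e. if e \<in> F then (\<lambda>x. (1 / 2) * cone_row (\<lambda>_. 1) q e x) else (\<lambda>x. w e * cone_row (\<lambda>_. - 1) q e x))"
    using split lin lin sum by (rule dual_system_split)
  define \<tau> where "\<tau> e = (if e \<in> F then 1 else - 1 :: real)" for e
  have "dual_system E (\<lambda>e x. (if e \<in> F then 2 else 1 / w e) *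
     (if e \<in> F then (\<lambda>x. (1 / 2) * cone_row (\<lambda>_. 1) q e x) else (\<lambda>x. w e * cone_row (\<lambda>_. - 1) q e x)) x)"
  proof (rule dual_system_scale[OF F(2)])
    show "linear (if e \<in> F then (\<lambda>x. (1 / 2) * cone_row (\<lambda>_. 1) q e x) else (\<lambda>x. w e * cone_row (\<lambda>_. - 1) q e x))" for e
      using lin[of "1 / 2" "\<lambda>_. 1" e] lin[of "w e" "\<lambda>_. - 1" e] by (simp only: if_split) blast
  qed (simp add: w_def)
  then have "dual_system E (cone_row \<tau> q)"
    by (rule dual_system_cong[THEN iffD1, rotated]) (simp add: \<tau>_def cone_row_def w_def)
  then have "cone_realizable u E \<tau>" unfolding cone_realizable_def using nz q(2) by blast
  \<comment> \<open>Any heights that separate the ends of all edges will do; their signs become the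
    pattern to be reached.\<close>
  define s :: "real ^ 'v" where "s = (\<chi> v. n v)"
  have s: "edge_diff e s \<noteq> 0" if "e \<in> E" for e using n'[OF that] by (simp add: s_def edge_diff_def)
  have "cone_realizable u E (\<lambda>e. sgn (edge_diff e s))"
    using \<open>cone_realizable u E \<tau>\<close> by (rule cone_realizable_all_signs[OF E d]) (use s in \<open>auto simp: \<tau>_def sgn_if\<close>)
  then obtain q :: "(real ^ 'd) ^ 'v" where q: "\<And>e. e \<in> E \<Longrightarrow> edge_diff e q \<noteq> 0" "frame_det u q \<noteq> 0"
    "dual_system E (cone_row (\<lambda>e. sgn (edge_diff e s)) q)" unfolding cone_realizable_def by blast
  define p where "p = pairv q s"
  have fs: "fst (edge_diff e p) = edge_diff e q" "snd (edge_diff e p) = edge_diff e s" for e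
    unfolding p_def by (simp_all add: edge_diff_pair[of e "pairv q s"])
  have wp: "well_positioned conical_norm E p"
    using well_positioned_conical(1)[OF E, of p] q(1) s by (simp add: fs)
  define f where "f e x = (sgn (fst (edge_diff e p)), sgn (snd (edge_diff e p))) \<bullet> edge_diff e x"
    for e and x :: "((real ^ 'd) \<times> real) ^ 'v"
  have rd: "rigidity_differential conical_norm E p = functional_map E f"
    unfolding well_positioned_conical(2)[OF E wp] f_def[abs_def] ..
  have linf: "linear (f e)" for e unfolding f_def[abs_def] by (rule linear_inner_edge_diff)
  have "dual_system E (\<lambda>e x. inverse (norm (edge_diff e q)) * cone_row (\<lambda>e. sgn (edge_diff e s)) q e x)"
    using q(3) by (rule dual_system_scale) (use q(1) linear_cone_row in auto)
  then have dual: "dual_system E f"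
  proof (rule dual_system_cong[THEN iffD1, rotated])
    fix e and x :: "((real ^ 'd) \<times> real) ^ 'v" assume "e \<in> E"
    from q(1)[OF this] show "inverse (norm (edge_diff e q)) * cone_row (\<lambda>e. sgn (edge_diff e s)) q e x = f e x"
      unfolding f_def fs cone_row_def edge_diff_pair[of e x] inner_prod_def sgn_div_norm[of "edge_diff e q"]
      by (simp add: distrib_left)
  qed
  show ?thesis
  proof (rule minimally_rigid_of_dual_system[OF wp rd linf dual infinitesimal_motions_conical _ HT(1,2) H HT(3,4)])
    show "affinely_spanning (fstv p)" using affinely_spanning_of_frame_det[OF q(2)] by (simp add: p_def)
  qed
qed

section \<open>Two trees and two linear orders\<close>

text \<open>Edges of \<open>H\<close> alone are ordered alike by \<open>u\<close> and
  \<open>w\<close>, edges of \<open>T\<close> alone oppositely, and \<open>\<phi>\<close> decides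
  for common edges. Common edges must be allowed because suppressing a vertex can create an edge
  that the other tree already has.\<close>

definition order_colouring :: "'v set \<Rightarrow> 'v set set \<Rightarrow> 'v set set \<Rightarrow> ('v set \<Rightarrow> bool) \<Rightarrow> ('v \<Rightarrow> real) \<Rightarrow> ('v \<Rightarrow> real) \<Rightarrow> bool" where
  "order_colouring A H T \<phi> u w \<longleftrightarrow> inj_on u A \<and> inj_on w A \<and>
     (\<forall>a b. {a, b} \<in> H \<union> T \<longrightarrow> ((u a < u b \<longleftrightarrow> w a < w b) \<longleftrightarrow> {a, b} \<notin> T \<or> {a, b} \<in> H \<and> \<phi> {a, b}))"

text \<open>Only the union and the intersection of the trees are prescribed, so edges may move
  between them.\<close>

definition order_realizable :: "'v::finite set \<Rightarrow> 'v set set \<Rightarrow> 'v set set \<Rightarrow> ('v set \<Rightarrow> bool) \<Rightarrow> bool" where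
  "order_realizable A U I \<phi> \<longleftrightarrow> (\<exists>H T u w. spanning_tree A H \<and> spanning_tree A T \<and> H \<union> T = U \<and> H \<inter> T = I \<and>
     order_colouring A H T \<phi> u w)"

text \<open>Reversing one order interchanges agreement and disagreement, hence the roles of the
  trees, and negates the type of common edges.\<close>

lemma order_realizable_swap:
  assumes "order_realizable A U I (\<lambda>e. \<not> \<phi> e)"
  shows "order_realizable A U I \<phi>"
proof -
  obtain H T u w where H: "spanning_tree A H" and T: "spanning_tree A T" "H \<union> T = U" "H \<inter> T = I"
    and c: "order_colouring A H T (\<lambda>e. \<not> \<phi> e) u w"
    using assms unfolding order_realizable_def by blast
  have inj: "inj_on u A" "inj_on w A" using c by (auto simp: order_colouring_def)
  have "order_colouring A T H \<phi> u (\<lambda>v. - w v)"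
    unfolding order_colouring_def
  proof (intro conjI allI impI)
    show "inj_on u A" "inj_on (\<lambda>v. - w v) A" using inj by (auto simp: inj_on_def)
    fix a b assume e: "{a, b} \<in> T \<union> H"
    then have "a \<in> A" "b \<in> A" "a \<noteq> b"
      using spanning_treeD(5)[OF H, of a b] spanning_treeD(5)[OF T(1), of a b] by blast+
    then have "w a \<noteq> w b" using inj(2) by (auto simp: inj_on_def)
    then have "(u a < u b \<longleftrightarrow> - w a < - w b) \<longleftrightarrow> \<not> (u a < u b \<longleftrightarrow> w a < w b)" by auto
    also have "\<dots> \<longleftrightarrow> \<not> ({a, b} \<notin> T \<or> {a, b} \<in> H \<and> \<not> \<phi> {a, b})"
      using c e unfolding order_colouring_def by blast
    also have "\<dots> \<longleftrightarrow> {a, b} \<notin> H \<or> {a, b} \<in> T \<and> \<phi> {a, b}" using e by blast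
    finally show "(u a < u b \<longleftrightarrow> - w a < - w b) \<longleftrightarrow> {a, b} \<notin> H \<or> {a, b} \<in> T \<and> \<phi> {a, b}" .
  qed
  moreover have "T \<union> H = U" "T \<inter> H = I" using T by auto
  ultimately show ?thesis unfolding order_realizable_def using H T(1) by blast
qed

text \<open>\<open>C\<close> and \<open>D\<close> are the neighbours of the new vertex in the two
  trees, \<open>x\<close> and \<open>y\<close> its positions in the two orders. By
  \<open>col\<close>, the old edges that are kept must retain their type.\<close>

lemma order_colouring_insert:
  assumes c: "order_colouring A0 H0 T0 \<phi>0 u w" and v: "v \<notin> A0"
    and sub: "\<Union>H1 \<subseteq> A0" "\<Union>T1 \<subseteq> A0" "H1 \<union> T1 \<subseteq> H0 \<union> T0"
    and col: "\<And>e. e \<in> H1 \<union> T1 \<Longrightarrow> (e \<notin> T1 \<or> e \<in> H1 \<and> \<phi> e) \<longleftrightarrow> (e \<notin> T0 \<or> e \<in> H0 \<and> \<phi>0 e)"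
    and xy: "x \<notin> u ` A0" "y \<notin> w ` A0"
    and CD: "C \<subseteq> A0" "D \<subseteq> A0"
    and new: "\<And>z. z \<in> C \<union> D \<Longrightarrow> (x < u z \<longleftrightarrow> y < w z) \<longleftrightarrow> z \<notin> D \<or> z \<in> C \<and> \<phi> {v, z}"
    and H: "H = (\<lambda>z. {v, z}) ` C \<union> H1" and T: "T = (\<lambda>z. {v, z}) ` D \<union> T1"
  shows "order_colouring (insert v A0) H T \<phi> (u(v := x)) (w(v := y))"
  unfolding order_colouring_def
proof (intro conjI allI impI)
  have inj: "inj_on u A0" "inj_on w A0" using c by (auto simp: order_colouring_def)
  then show "inj_on (u(v := x)) (insert v A0)" "inj_on (w(v := y)) (insert v A0)"
    using v xy by (auto simp: inj_on_def)
  fix a b assume e: "{a, b} \<in> H \<union> T"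
  have vH: "{v, z} \<notin> H1" "{v, z} \<notin> T1" "{z, v} \<notin> H1" "{z, v} \<notin> T1" for z
    using sub v by auto
  have v': "({v, z} \<in> H \<longleftrightarrow> z \<in> C) \<and> ({v, z} \<in> T \<longleftrightarrow> z \<in> D)" for z
    using vH by (auto simp: H T doubleton_eq_iff)
  show "((u(v := x)) a < (u(v := x)) b \<longleftrightarrow> (w(v := y)) a < (w(v := y)) b) \<longleftrightarrow>
     {a, b} \<notin> T \<or> {a, b} \<in> H \<and> \<phi> {a, b}"
  proof (cases "a = v \<or> b = v")
    case True
    then obtain z where z: "a = v \<and> b = z \<or> a = z \<and> b = v" "{a, b} = {v, z}" by auto
    then have zC: "z \<in> C \<union> D" using e v'[of z] by auto
    then have "z \<in> A0" using CD by auto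
    then have zv: "z \<noteq> v" "x \<noteq> u z" "y \<noteq> w z" using v xy by auto
    have "((u(v := x)) a < (u(v := x)) b \<longleftrightarrow> (w(v := y)) a < (w(v := y)) b) \<longleftrightarrow> (x < u z \<longleftrightarrow> y < w z)"
      using z(1) zv by auto
    then show ?thesis using new[OF zC] v'[of z] z(2) by simp
  next
    case False
    then have nv: "{a, b} \<notin> (\<lambda>z. {v, z}) ` X" for X by (auto simp: doubleton_eq_iff)
    then have m: "{a, b} \<in> H \<longleftrightarrow> {a, b} \<in> H1" "{a, b} \<in> T \<longleftrightarrow> {a, b} \<in> T1" by (simp_all add: H T)
    then have e1: "{a, b} \<in> H1 \<union> T1" using e by blast
    then have "(u a < u b \<longleftrightarrow> w a < w b) \<longleftrightarrow> {a, b} \<notin> T0 \<or> {a, b} \<in> H0 \<and> \<phi>0 {a, b}"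
      using c sub(3) unfolding order_colouring_def by blast
    then show ?thesis using col[OF e1] False m by simp
  qed
qed

section \<open>Room for a new vertex in two linear orders\<close>

lemma exists_between:
  fixes l r :: real
  assumes "finite F" "l < r"
  shows "\<exists>x. l < x \<and> x < r \<and> x \<notin> F"
proof -
  have "infinite ({l<..<r} - F)" using assms by (simp add: Diff_infinite_finite)
  then have "{l<..<r} - F \<noteq> {}" by (metis finite.emptyI)
  then show ?thesis by auto
qed

lemma exists_above:
  fixes F :: "real set"
  assumes "finite F"
  shows "\<exists>x. \<forall>z\<in>F. z < x"
proof (intro exI[of _ "Max (insert 0 F) + 1"] ballI)
  fix z assume "z \<in> F"
  then have "z \<le> Max (insert 0 F)" using assms by (intro Max_ge) auto
  then show "z < Max (insert 0 F) + 1" by simp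
qed

text \<open>In the plane with coordinates \<open>(u, w)\<close>: a new point relative to which
  \<open>P\<close> lies in the upper right and lower left quadrants and \<open>N\<close> in the
  other two.\<close>

definition can_place :: "'v set \<Rightarrow> ('v \<Rightarrow> real) \<Rightarrow> ('v \<Rightarrow> real) \<Rightarrow> 'v set \<Rightarrow> 'v set \<Rightarrow> bool" where
  "can_place A u w P N \<longleftrightarrow> (\<exists>x y. x \<notin> u ` A \<and> y \<notin> w ` A \<and>
     (\<forall>z\<in>P. x < u z \<longleftrightarrow> y < w z) \<and> (\<forall>z\<in>N. \<not> (x < u z \<longleftrightarrow> y < w z)))"

text \<open>With \<open>y\<close> above everything, a vertex agrees with the new point iff it lies
  to the left of \<open>x\<close>.\<close>

lemma can_place_between_above:
  assumes "finite A" "l < r" "P \<union> N \<subseteq> A" "\<And>z. z \<in> P \<Longrightarrow> u z \<le> l" "\<And>z. z \<in> N \<Longrightarrow> u z \<ge> r"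
  shows "can_place A u w P N"
proof -
  obtain x where x: "l < x" "x < r" "x \<notin> u ` A" using exists_between[OF _ assms(2), of "u ` A"] assms(1) by auto
  obtain y where y: "\<forall>z\<in>w ` A. z < y" using exists_above[of "w ` A"] assms(1) by auto
  show ?thesis unfolding can_place_def
  proof (rule exI[of _ x], rule exI[of _ y], intro conjI ballI)
    show "x \<notin> u ` A" "y \<notin> w ` A" using x y by auto
    show "x < u z \<longleftrightarrow> y < w z" if "z \<in> P" for z using assms(3,4) that x y by force
    show "\<not> (x < u z \<longleftrightarrow> y < w z)" if "z \<in> N" for z using assms(3,5) that x y by force
  qed
qed

text \<open>Reflecting one axis exchanges the two pairs of quadrants.\<close>

lemma can_place_flip: "can_place A (\<lambda>z. - u z) w P N \<Longrightarrow> P \<union> N \<subseteq> A \<Longrightarrow> can_place A u w N P"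
proof -
  assume "can_place A (\<lambda>z. - u z) w P N" and PN: "P \<union> N \<subseteq> A"
  then obtain x y where xy: "x \<notin> (\<lambda>z. - u z) ` A" "y \<notin> w ` A"
    "\<forall>z\<in>P. x < - u z \<longleftrightarrow> y < w z" "\<forall>z\<in>N. \<not> (x < - u z \<longleftrightarrow> y < w z)"
    unfolding can_place_def by blast
  have ne: "- x \<noteq> u z" if "z \<in> A" for z using xy(1) that by force
  then have *: "(- x < u z \<longleftrightarrow> y < w z) \<longleftrightarrow> \<not> (x < - u z \<longleftrightarrow> y < w z)" if "z \<in> A" for z
    using ne[OF that] by (cases "y < w z") auto
  have "- x \<notin> u ` A" using ne by blast
  moreover have "- x < u z \<longleftrightarrow> y < w z" if "z \<in> N" for z
    using *[of z] xy(4) PN that by blast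
  moreover have "\<not> (- x < u z \<longleftrightarrow> y < w z)" if "z \<in> P" for z
    using *[of z] xy(3) PN that by blast
  ultimately show "can_place A u w N P" unfolding can_place_def using xy(2) by blast
qed

lemma can_place_swap: "can_place A u w P N \<longleftrightarrow> can_place A w u P N"
proof -
  have "can_place A w u P N" if uw: "can_place A u w P N" for u w
  proof -
    obtain x y where xy: "x \<notin> u ` A" "y \<notin> w ` A" "\<forall>z\<in>P. x < u z \<longleftrightarrow> y < w z" "\<forall>z\<in>N. \<not> (x < u z \<longleftrightarrow> y < w z)"
      using uw unfolding can_place_def by blast
    show ?thesis unfolding can_place_def
      by (rule exI[of _ y], rule exI[of _ x]) (use xy in auto)
  qed
  then show ?thesis by blast
qed

lemma can_place_flip': "can_place A u (\<lambda>z. - w z) P N \<Longrightarrow> P \<union> N \<subseteq> A \<Longrightarrow> can_place A u w N P"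
  using can_place_flip[of A w u P N] can_place_swap[of A] by blast

lemma can_place_between_below:
  assumes "finite A" "l < r" "P \<union> N \<subseteq> A" "\<And>z. z \<in> P \<Longrightarrow> u z \<ge> r" "\<And>z. z \<in> N \<Longrightarrow> u z \<le> l"
  shows "can_place A u w P N"
proof (rule can_place_flip')
  show "can_place A u (\<lambda>z. - w z) N P"
    using assms by (intro can_place_between_above[where l = l and r = r]) auto
qed (use assms(3) in auto)

lemma can_place_one:
  assumes "finite A" "a \<in> A"
  shows "can_place A u w {a} {}" "can_place A u w {} {a}"
  using can_place_between_above[of A "u a" "u a + 1" "{a}" "{}"] can_place_between_above[of A "u a - 1" "u a" "{}" "{a}"] assms
  by auto

lemma can_place_two:
  assumes A: "finite A" "a \<in> A" "b \<in> A" "a \<noteq> b" and inj: "inj_on u A"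
  shows "can_place A u w {a} {b}" "can_place A u w {a, b} {}" "can_place A u w {} {a, b}"
proof -
  have "u a \<noteq> u b" using A inj by (auto simp: inj_on_def)
  then consider "u a < u b" | "u b < u a" by linarith
  then show "can_place A u w {a} {b}"
  proof cases
    case 1
    then show ?thesis using A by (intro can_place_between_above[where l = "u a" and r = "u b"]) auto
  next
    case 2
    then show ?thesis using A by (intro can_place_between_below[where l = "u b" and r = "u a"]) auto
  qed
  show "can_place A u w {a, b} {}"
    using A by (intro can_place_between_above[where l = "max (u a) (u b)" and r = "max (u a) (u b) + 1"]) auto
  show "can_place A u w {} {a, b}"
    using A by (intro can_place_between_above[where r = "min (u a) (u b)" and l = "min (u a) (u b) - 1"]) auto
qed

text \<open>A point that is extreme in one order splits the vertices by the other, which settles the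
  case of \<open>c\<close> outside the box spanned by \<open>a\<close> and \<open>b\<close>. Inside
  the box, if \<open>a\<close> and \<open>b\<close> disagree, a point slightly beyond
  \<open>c\<close> in both orders works; if they agree, \<open>c\<close> is between them in both
  orders and either end can take its place.\<close>

lemma can_place_three_aux:
  assumes A: "finite A" "a \<in> A" "b \<in> A" "c \<in> A" "c \<noteq> a" "c \<noteq> b" and inj: "inj_on u A" "inj_on w A"
    and ab: "u a < u b"
  shows "w b < w a \<Longrightarrow> can_place A u w {c} {a, b}"
    "w a < w b \<Longrightarrow> can_place A u w {c} {a, b} \<or> can_place A u w {a} {b, c} \<and> can_place A u w {b} {a, c}"
proof -
  have ne: "u c \<noteq> u a" "u c \<noteq> u b" "w c \<noteq> w a" "w c \<noteq> w b" using A inj by (auto simp: inj_on_def)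
  have 1: "can_place A u w {c} {a, b}" if "u c < u a"
    using that ab A by (intro can_place_between_above[where l = "u c" and r = "u a"]) auto
  have 2: "can_place A u w {c} {a, b}" if "u b < u c"
    using that ab A by (intro can_place_between_below[where l = "u b" and r = "u c"]) auto
  have 3: "can_place A u w {c} {a, b}" if "w c < min (w a) (w b)"
    unfolding can_place_swap[of A u]
    using that A by (intro can_place_between_above[where l = "w c" and r = "min (w a) (w b)"]) auto
  have 4: "can_place A u w {c} {a, b}" if "max (w a) (w b) < w c"
    unfolding can_place_swap[of A u]
    using that A by (intro can_place_between_below[where l = "max (w a) (w b)" and r = "w c"]) auto
  show "can_place A u w {c} {a, b}" if ba: "w b < w a"
  proof (cases "u c < u a \<or> u b < u c \<or> w c < min (w a) (w b) \<or> max (w a) (w b) < w c")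
    case True
    then show ?thesis using 1 2 3 4 by blast
  next
    case False
    then have box: "u a < u c" "u c < u b" "w b < w c" "w c < w a" using ne ba by (auto simp: min_def max_def)
    obtain x where x: "u c < x" "x < u b" "x \<notin> u ` A" using exists_between[OF _ box(2), of "u ` A"] A(1) by auto
    obtain y where y: "w c < y" "y < w a" "y \<notin> w ` A" using exists_between[OF _ box(4), of "w ` A"] A(1) by auto
    show ?thesis unfolding can_place_def
      by (rule exI[of _ x], rule exI[of _ y]) (use x y box in auto)
  qed
  show "can_place A u w {c} {a, b} \<or> can_place A u w {a} {b, c} \<and> can_place A u w {b} {a, c}" if ab': "w a < w b"
  proof (cases "u c < u a \<or> u b < u c \<or> w c < min (w a) (w b) \<or> max (w a) (w b) < w c")
    case True
    then show ?thesis using 1 2 3 4 by blast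
  next
    case False
    then have box: "u a < u c" "u c < u b" "w a < w c" "w c < w b" using ne ab' by (auto simp: min_def max_def)
    have "can_place A u w {a} {b, c}"
      using box A by (intro can_place_between_above[where l = "u a" and r = "u c"]) auto
    moreover have "can_place A u w {b} {a, c}"
      using box A by (intro can_place_between_below[where l = "u c" and r = "u b"]) auto
    ultimately show ?thesis by blast
  qed
qed

lemma can_place_three:
  assumes A: "finite A" "a \<in> A" "b \<in> A" "c \<in> A" "c \<noteq> a" "c \<noteq> b" "a \<noteq> b" and inj: "inj_on u A" "inj_on w A"
  shows "\<not> (u a < u b \<longleftrightarrow> w a < w b) \<Longrightarrow> can_place A u w {c} {a, b}"
    "(u a < u b \<longleftrightarrow> w a < w b) \<Longrightarrow>
      can_place A u w {c} {a, b} \<or> can_place A u w {a} {b, c} \<and> can_place A u w {b} {a, c}"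
proof -
  have ne: "u a \<noteq> u b" "w a \<noteq> w b" using A inj by (auto simp: inj_on_def)
  have sw: "{a, b} = {b, a}" by blast
  show "can_place A u w {c} {a, b}" if "\<not> (u a < u b \<longleftrightarrow> w a < w b)"
  proof (cases "u a < u b")
    case True
    then show ?thesis using can_place_three_aux(1)[OF A(1-6) inj] that ne by auto
  next
    case False
    then show ?thesis unfolding sw using can_place_three_aux(1)[OF A(1,3,2,4,6,5) inj] that ne by auto
  qed
  show "can_place A u w {c} {a, b} \<or> can_place A u w {a} {b, c} \<and> can_place A u w {b} {a, c}"
    if "u a < u b \<longleftrightarrow> w a < w b"
  proof (cases "u a < u b")
    case True
    then show ?thesis using can_place_three_aux(2)[OF A(1-6) inj] that by blast
  next
    case False
    then show ?thesis unfolding sw using can_place_three_aux(2)[OF A(1,3,2,4,6,5) inj] that ne by auto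
  qed
qed

lemma order_realizable_insert:
  assumes c: "order_colouring A0 H0 T0 \<phi>0 u w" and v: "v \<notin> A0"
    and sub: "\<Union>H1 \<subseteq> A0" "\<Union>T1 \<subseteq> A0" "H1 \<union> T1 \<subseteq> H0 \<union> T0"
    and col: "\<And>e. e \<in> H1 \<union> T1 \<Longrightarrow> (e \<notin> T1 \<or> e \<in> H1 \<and> \<phi> e) \<longleftrightarrow> (e \<notin> T0 \<or> e \<in> H0 \<and> \<phi>0 e)"
    and CD: "C \<subseteq> A0" "D \<subseteq> A0"
    and place: "can_place A0 u w ((C - D) \<union> {z \<in> C \<inter> D. \<phi> {v, z}}) ((D - C) \<union> {z \<in> C \<inter> D. \<not> \<phi> {v, z}})"
    and trees: "spanning_tree (insert v A0) ((\<lambda>z. {v, z}) ` C \<union> H1)" "spanning_tree (insert v A0) ((\<lambda>z. {v, z}) ` D \<union> T1)"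
    and U: "U = (\<lambda>z. {v, z}) ` (C \<union> D) \<union> (H1 \<union> T1)" and I: "I = (\<lambda>z. {v, z}) ` (C \<inter> D) \<union> (H1 \<inter> T1)"
  shows "order_realizable (insert v A0) U I \<phi>"
proof -
  obtain x y where xy: "x \<notin> u ` A0" "y \<notin> w ` A0"
    "\<And>z. z \<in> (C - D) \<union> {z \<in> C \<inter> D. \<phi> {v, z}} \<Longrightarrow> x < u z \<longleftrightarrow> y < w z"
    "\<And>z. z \<in> (D - C) \<union> {z \<in> C \<inter> D. \<not> \<phi> {v, z}} \<Longrightarrow> \<not> (x < u z \<longleftrightarrow> y < w z)"
    using place unfolding can_place_def by blast
  have "order_colouring (insert v A0) ((\<lambda>z. {v, z}) ` C \<union> H1) ((\<lambda>z. {v, z}) ` D \<union> T1) \<phi> (u(v := x)) (w(v := y))"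
  proof (rule order_colouring_insert[OF c v sub col xy(1,2) CD _ refl refl])
    fix z assume "z \<in> C \<union> D"
    then show "(x < u z \<longleftrightarrow> y < w z) \<longleftrightarrow> z \<notin> D \<or> z \<in> C \<and> \<phi> {v, z}"
      using xy(3,4)[of z] by (cases "z \<in> D"; cases "z \<in> C"; cases "\<phi> {v, z}") simp_all
  qed
  moreover have nv: "{v, z} \<notin> H1" "{v, z} \<notin> T1" for z using sub v by auto
  have "((\<lambda>z. {v, z}) ` C \<union> H1) \<inter> ((\<lambda>z. {v, z}) ` D \<union> T1) = I"
    unfolding I using nv by (auto simp: doubleton_eq_iff)
  moreover have "((\<lambda>z. {v, z}) ` C \<union> H1) \<union> ((\<lambda>z. {v, z}) ` D \<union> T1) = U" unfolding U by blast
  ultimately show ?thesis unfolding order_realizable_def using trees by blast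
qed

section \<open>Induction on the number of vertices\<close>

lemma order_colouring_edge:
  assumes "order_colouring A H T \<phi> u w" "{a, b} \<in> H \<union> T"
  shows "(u a < u b \<longleftrightarrow> w a < w b) \<longleftrightarrow> {a, b} \<notin> T \<or> {a, b} \<in> H \<and> \<phi> {a, b}"
  using assms unfolding order_colouring_def by blast

lemma order_realizableE:
  assumes "order_realizable A U I \<phi>"
  obtains H T u w where "spanning_tree A H" "spanning_tree A T" "H \<union> T = U" "H \<inter> T = I" "order_colouring A H T \<phi> u w"
  using assms unfolding order_realizable_def by (elim exE conjE)

lemma order_realizableI:
  assumes "spanning_tree A H" "spanning_tree A T" "order_colouring A H T \<phi> u w"
  shows "order_realizable A (H \<union> T) (H \<inter> T) \<phi>"
  unfolding order_realizable_def using assms by blast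

text \<open>The induction hypothesis may return trees other than the two without \<open>v\<close>,
  but with the same union and intersection; \<open>v\<close> can be attached to them as a leaf at
  its old neighbours.\<close>

lemma order_realizable_two_leaves:
  assumes H: "spanning_tree A H" "{e \<in> H. v \<in> e} = {{v, c}}" and T: "spanning_tree A T" "{e \<in> T. v \<in> e} = {{v, a}}"
    and v: "v \<in> A"
    and IH: "\<And>H T \<phi>. spanning_tree (A - {v}) H \<Longrightarrow> spanning_tree (A - {v}) T \<Longrightarrow> order_realizable (A - {v}) (H \<union> T) (H \<inter> T) \<phi>"
  shows "order_realizable A (H \<union> T) (H \<inter> T) \<phi>"
proof -
  define A0 where "A0 = A - {v}"
  have A: "insert v A0 = A" "v \<notin> A0" using v by (auto simp: A0_def)
  let ?H0 = "H - {{v, c}}" and ?T0 = "T - {{v, a}}"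
  have H0: "spanning_tree A0 ?H0" "c \<in> A0" using spanning_tree_remove_leaf[OF H] by (simp_all add: A0_def)
  have T0: "spanning_tree A0 ?T0" "a \<in> A0" using spanning_tree_remove_leaf[OF T] by (simp_all add: A0_def)
  have "order_realizable A0 (?H0 \<union> ?T0) (?H0 \<inter> ?T0) \<phi>"
    by (rule IH[folded A0_def, OF H0(1) T0(1)])
  then obtain H1 T1 u w where H1: "spanning_tree A0 H1" and T1: "spanning_tree A0 T1"
    and U: "H1 \<union> T1 = ?H0 \<union> ?T0" and I: "H1 \<inter> T1 = ?H0 \<inter> ?T0" and c: "order_colouring A0 H1 T1 \<phi> u w"
    by (rule order_realizableE)
  have inj: "inj_on u A0" using c by (simp add: order_colouring_def)
  have "order_realizable (insert v A0) (H \<union> T) (H \<inter> T) \<phi>"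
  proof (rule order_realizable_insert[OF c A(2), where C = "{c}" and D = "{a}"])
    show "\<Union>H1 \<subseteq> A0" "\<Union>T1 \<subseteq> A0" using spanning_treeD(2) H1 T1 by blast+
    show "{c} \<subseteq> A0" "{a} \<subseteq> A0" using H0(2) T0(2) by auto
    show "spanning_tree (insert v A0) ((\<lambda>z. {v, z}) ` {c} \<union> H1)"
      using spanning_tree_add_leaf[OF H1 H0(2) A(2)] by simp
    show "spanning_tree (insert v A0) ((\<lambda>z. {v, z}) ` {a} \<union> T1)"
      using spanning_tree_add_leaf[OF T1 T0(2) A(2)] by simp
    show "can_place A0 u w (({c} - {a}) \<union> {z \<in> {c} \<inter> {a}. \<phi> {v, z}}) (({a} - {c}) \<union> {z \<in> {c} \<inter> {a}. \<not> \<phi> {v, z}})"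
    proof (cases "a = c")
      case True
      then show ?thesis using can_place_one[of A0 a u w] T0(2)
        by (cases "\<phi> {v, a}") (simp_all add: Collect_conv_if)
    next
      case False
      then show ?thesis using can_place_two(1)[of A0 c a u w] T0(2) H0(2) inj by simp
    qed
    have va: "{v, c} \<in> H" "{v, a} \<in> T" using H(2) T(2) by blast+
    show "H \<union> T = (\<lambda>z. {v, z}) ` ({c} \<union> {a}) \<union> (H1 \<union> T1)" unfolding U using va by auto
    have "{v, a} \<in> H \<longleftrightarrow> a = c" "{v, c} \<in> T \<longleftrightarrow> a = c"
    proof -
      have "{v, a} \<in> H \<longleftrightarrow> {v, a} \<in> {e \<in> H. v \<in> e}" "{v, c} \<in> T \<longleftrightarrow> {v, c} \<in> {e \<in> T. v \<in> e}" by simp_all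
      then show "{v, a} \<in> H \<longleftrightarrow> a = c" "{v, c} \<in> T \<longleftrightarrow> a = c"
        unfolding H(2) T(2) by (auto simp: doubleton_eq_iff)
    qed
    then show "H \<inter> T = (\<lambda>z. {v, z}) ` ({c} \<inter> {a}) \<union> (H1 \<inter> T1)" unfolding I using va by auto
  qed auto
  then show ?thesis by (simp only: A(1))
qed

text \<open>Suppressing \<open>v\<close> in \<open>T\<close> yields an edge \<open>{a, b}\<close> that may already belong to \<open>H\<close>.  In that
  case the freedom to prescribe the order type of common edges is used to make \<open>{a, b}\<close> an edge of \<open>H\<close>.\<close>

lemma order_realizable_suppress:
  assumes H: "spanning_tree A H" "{e \<in> H. v \<in> e} = {{v, c}}"
    and T: "spanning_tree A T" "{e \<in> T. v \<in> e} = {{v, a}, {v, b}}" and ab: "a \<noteq> b"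
    and v: "v \<in> A"
    and IH: "\<And>H T \<phi>. spanning_tree (A - {v}) H \<Longrightarrow> spanning_tree (A - {v}) T \<Longrightarrow> order_realizable (A - {v}) (H \<union> T) (H \<inter> T) \<phi>"
  shows "order_realizable A (H \<union> T) (H \<inter> T) \<phi>"
proof -
  define A0 where "A0 = A - {v}"
  have A: "insert v A0 = A" "v \<notin> A0" using v by (auto simp: A0_def)
  have fin: "finite A0" by simp
  define H0 T0 where "H0 = H - {{v, c}}" and "T0 = T - {{v, a}, {v, b}}"
  have H0: "spanning_tree A0 H0" "c \<in> A0" using spanning_tree_remove_leaf[OF H] by (simp_all add: A0_def H0_def)
  have T0: "spanning_tree A0 (insert {a, b} T0)" "{a, b} \<notin> T" "a \<in> A0" "b \<in> A0"
    using spanning_tree_suppress[OF T ab] by (simp_all add: A0_def T0_def)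
  then have abT0: "{a, b} \<notin> T0" by (simp add: T0_def)
  have sub0: "\<Union>H0 \<subseteq> A0" "\<Union>T0 \<subseteq> A0" using spanning_treeD(2)[OF H0(1)] spanning_treeD(2)[OF T0(1)] by auto
  have va: "{v, c} \<in> H" "{v, a} \<in> T" "{v, b} \<in> T" using H(2) T(2) by blast+
  then have HT: "H = insert {v, c} H0" "T = insert {v, a} (insert {v, b} T0)" by (auto simp: H0_def T0_def)
  have nv: "{v, z} \<notin> H0" "{v, z} \<notin> T0" for z using sub0 A(2) by auto
  have U: "H \<union> T = (\<lambda>z. {v, z}) ` {a, b, c} \<union> (H0 \<union> T0)" unfolding HT by auto
  have I: "H \<inter> T = (\<lambda>z. {v, z}) ` ({c} \<inter> {a, b}) \<union> (H0 \<inter> T0)"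
    unfolding HT using nv by (auto simp: doubleton_eq_iff)
  define \<phi>0 where "\<phi>0 = \<phi>({a, b} := True)"
  have "order_realizable A0 (H0 \<union> insert {a, b} T0) (H0 \<inter> insert {a, b} T0) \<phi>0"
    by (rule IH[folded A0_def, OF H0(1) T0(1)])
  then obtain H1 T1 u w where H1: "spanning_tree A0 H1" and T1: "spanning_tree A0 T1"
    and U1: "H1 \<union> T1 = H0 \<union> insert {a, b} T0" and I1: "H1 \<inter> T1 = H0 \<inter> insert {a, b} T0"
    and col: "order_colouring A0 H1 T1 \<phi>0 u w"
    by (rule order_realizableE)
  have inj: "inj_on u A0" "inj_on w A0" using col by (simp_all add: order_colouring_def)
  have sub1: "\<Union>H1 \<subseteq> A0" "\<Union>T1 \<subseteq> A0" using spanning_treeD(2) H1 T1 by blast+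
  have abU: "{a, b} \<in> H1 \<union> T1" using U1 by blast
  have colab: "(u a < u b \<longleftrightarrow> w a < w b) \<longleftrightarrow> {a, b} \<notin> T1 \<or> {a, b} \<in> H1"
    unfolding order_colouring_edge[OF col abU] by (simp add: \<phi>0_def)
  have \<phi>0: "\<phi>0 e = \<phi> e" if "e \<noteq> {a, b}" for e using that by (simp add: \<phi>0_def)
  note insert = order_realizable_insert[OF col A(2)]
  have place_common: "can_place A0 u w ({x \<in> {c}. \<phi> {v, x}}) ({y} \<union> {x \<in> {c}. \<not> \<phi> {v, x}})"
    "can_place A0 u w ({y} \<union> {x \<in> {c}. \<phi> {v, x}}) ({x \<in> {c}. \<not> \<phi> {v, x}})"
    if "y \<in> A0" "y \<noteq> c" for y
    using can_place_two[of A0 c y u w] can_place_two[of A0 y c u w] that fin H0(2) inj(1)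
    by (cases "\<phi> {v, c}"; simp add: Collect_conv_if insert_commute)+
  have "order_realizable (insert v A0) (H \<union> T) (H \<inter> T) \<phi>"
  proof (cases "{a, b} \<in> T1")
    case True
    define T2 where "T2 = T1 - {{a, b}}"
    have tree: "spanning_tree (insert v A0) ((\<lambda>z. {v, z}) ` {x, y} \<union> T2)"
      if "x \<in> A0" "joined T2 a x" "y \<in> A0" "joined T2 b y" for x y
      using spanning_tree_insert_vertex[OF T1 True A(2)] that by (simp add: T2_def)
    have treeH: "spanning_tree (insert v A0) ((\<lambda>z. {v, z}) ` {x} \<union> H1)" if "x \<in> A0" for x
      using spanning_tree_add_leaf[OF H1 that A(2)] by simp
    have U2: "H1 \<union> T2 = H0 \<union> T0" using U1 I1 abT0 True unfolding T2_def by blast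
    have I2: "H1 \<inter> T2 = H0 \<inter> T0" using I1 abT0 unfolding T2_def by blast
    have sub2: "\<Union>T2 \<subseteq> A0" "H1 \<union> T2 \<subseteq> H1 \<union> T1" using sub1 by (auto simp: T2_def)
    \<comment> \<open>\<open>\<phi>0\<close> makes the orders agree on a common edge
      \<open>{a, b}\<close>, which is the type it must have when it remains in \<open>H1\<close>
      alone.\<close>
    have col2: "(e \<notin> T2 \<or> e \<in> H1 \<and> \<phi> e) \<longleftrightarrow> (e \<notin> T1 \<or> e \<in> H1 \<and> \<phi>0 e)" if "e \<in> H1 \<union> T2" for e
      using that \<phi>0[of e] by (cases "e = {a, b}") (auto simp: T2_def \<phi>0_def)
    have std: ?thesis if "can_place A0 u w (({c} - {a, b}) \<union> {z \<in> {c} \<inter> {a, b}. \<phi> {v, z}})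
        (({a, b} - {c}) \<union> {z \<in> {c} \<inter> {a, b}. \<not> \<phi> {v, z}})"
    proof (rule insert[OF sub1(1) sub2 col2 _ _ that])
      show "spanning_tree (insert v A0) ((\<lambda>z. {v, z}) ` {a, b} \<union> T2)" using T0 by (intro tree) auto
      show "spanning_tree (insert v A0) ((\<lambda>z. {v, z}) ` {c} \<union> H1)" using H0 by (intro treeH)
      show "H \<union> T = (\<lambda>z. {v, z}) ` ({c} \<union> {a, b}) \<union> (H1 \<union> T2)" unfolding U2 U by auto
      show "H \<inter> T = (\<lambda>z. {v, z}) ` ({c} \<inter> {a, b}) \<union> (H1 \<inter> T2)" unfolding I2 I ..
    qed (use H0 T0 in auto)
    show ?thesis
    proof (cases "c = a \<or> c = b")
      case c: True
      define y where "y = (if c = a then b else a)"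
      have y: "y \<in> A0" "y \<noteq> c" "{a, b} - {c} = {y}" "{c} \<inter> {a, b} = {c}" "{c} - {a, b} = {}"
        using c ab T0 by (auto simp: y_def)
      show ?thesis using place_common(1)[OF y(1,2)] by (intro std) (simp only: y Un_empty_left)
    next
      case c: False
      then have s: "{c} - {a, b} = {c}" "{a, b} - {c} = {a, b}" "{c} \<inter> {a, b} = {}" by auto
      have std': ?thesis if "can_place A0 u w {c} {a, b}" using that by (intro std) (simp only: s, simp)
      have pos: "finite A0" "a \<in> A0" "b \<in> A0" "c \<in> A0" "c \<noteq> a" "c \<noteq> b" "a \<noteq> b"
        using fin T0 H0 c ab by auto
      show ?thesis
      proof (cases "{a, b} \<in> H1")
        case False
        then show ?thesis using colab True can_place_three(1)[OF pos inj] std' by blast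
      next
        case abH: True
        then consider "can_place A0 u w {c} {a, b}" | "can_place A0 u w {a} {b, c}" "can_place A0 u w {b} {a, c}"
          using colab can_place_three(2)[OF pos inj] by blast
        then show ?thesis
        proof cases
          case 1
          then show ?thesis by (rule std')
        next
          case 2
          \<comment> \<open>The exchange: \<open>c\<close> lies in one of the two halves of
            \<open>T1 - {{a, b}}\<close>, so it can replace \<open>a\<close> or \<open>b\<close> as
            a neighbour of \<open>v\<close> in that tree, and the replaced vertex becomes the
            neighbour of \<open>v\<close> in the other tree.\<close>
          have "joined T2 a c \<or> joined T2 b c"
            unfolding T2_def using joined_remove_edge[OF True] spanning_treeD(3)[OF T1] pos by blast
          then show ?thesis
          proof
            assume j: "joined T2 a c"
            have s: "{a} - {b, c} = {a}" "{b, c} - {a} = {b, c}" "{a} \<inter> {b, c} = {}" using pos by auto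
            show ?thesis
            proof (rule insert[OF sub1(1) sub2 col2, where C = "{a}" and D = "{b, c}"])
              show "spanning_tree (insert v A0) ((\<lambda>z. {v, z}) ` {b, c} \<union> T2)"
                using tree[of c b] j pos by (simp add: insert_commute)
              show "spanning_tree (insert v A0) ((\<lambda>z. {v, z}) ` {a} \<union> H1)" using pos by (intro treeH)
              show "can_place A0 u w (({a} - {b, c}) \<union> {z \<in> {a} \<inter> {b, c}. \<phi> {v, z}})
                (({b, c} - {a}) \<union> {z \<in> {a} \<inter> {b, c}. \<not> \<phi> {v, z}})"
                using 2(1) unfolding s by simp
              show "H \<union> T = (\<lambda>z. {v, z}) ` ({a} \<union> {b, c}) \<union> (H1 \<union> T2)" unfolding U2 U by auto
              show "H \<inter> T = (\<lambda>z. {v, z}) ` ({a} \<inter> {b, c}) \<union> (H1 \<inter> T2)" unfolding I2 I s using pos by auto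
            qed (use pos in auto)
          next
            assume j: "joined T2 b c"
            have s: "{b} - {a, c} = {b}" "{a, c} - {b} = {a, c}" "{b} \<inter> {a, c} = {}" using pos by auto
            show ?thesis
            proof (rule insert[OF sub1(1) sub2 col2, where C = "{b}" and D = "{a, c}"])
              show "spanning_tree (insert v A0) ((\<lambda>z. {v, z}) ` {a, c} \<union> T2)"
                using tree[of a c] j pos by simp
              show "spanning_tree (insert v A0) ((\<lambda>z. {v, z}) ` {b} \<union> H1)" using pos by (intro treeH)
              show "can_place A0 u w (({b} - {a, c}) \<union> {z \<in> {b} \<inter> {a, c}. \<phi> {v, z}})
                (({a, c} - {b}) \<union> {z \<in> {b} \<inter> {a, c}. \<not> \<phi> {v, z}})"
                using 2(2) unfolding s by simp
              show "H \<union> T = (\<lambda>z. {v, z}) ` ({b} \<union> {a, c}) \<union> (H1 \<union> T2)" unfolding U2 U by auto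
              show "H \<inter> T = (\<lambda>z. {v, z}) ` ({b} \<inter> {a, c}) \<union> (H1 \<inter> T2)" unfolding I2 I s using pos by auto
            qed (use pos in auto)
          qed
        qed
      qed
    qed
  next
    case False
    \<comment> \<open>The induction hypothesis has moved \<open>{a, b}\<close> to the other tree;
      now \<open>v\<close> subdivides \<open>H1\<close> and becomes a leaf of
      \<open>T1\<close>.\<close>
    then have abH: "{a, b} \<in> H1" using abU by blast
    define H2 where "H2 = H1 - {{a, b}}"
    have tree: "spanning_tree (insert v A0) ((\<lambda>z. {v, z}) ` {a, b} \<union> H2)"
      using spanning_tree_insert_vertex[OF H1 abH A(2), of a b] T0 by (simp add: H2_def)
    have U2: "H2 \<union> T1 = H0 \<union> T0" using U1 I1 abT0 False abH unfolding H2_def by blast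
    have I2: "H2 \<inter> T1 = H0 \<inter> T0" using I1 abT0 False unfolding H2_def by blast
    have sub2: "\<Union>H2 \<subseteq> A0" "\<Union>T1 \<subseteq> A0" "H2 \<union> T1 \<subseteq> H1 \<union> T1" using sub1 by (auto simp: H2_def)
    have col2: "(e \<notin> T1 \<or> e \<in> H2 \<and> \<phi> e) \<longleftrightarrow> (e \<notin> T1 \<or> e \<in> H1 \<and> \<phi>0 e)" if "e \<in> H2 \<union> T1" for e
      using that \<phi>0[of e] False by (cases "e = {a, b}") (auto simp: H2_def)
    show ?thesis
    proof (rule insert[OF sub2 col2, where C = "{a, b}" and D = "{c}"])
      show "spanning_tree (insert v A0) ((\<lambda>z. {v, z}) ` {a, b} \<union> H2)" by (rule tree)
      show "spanning_tree (insert v A0) ((\<lambda>z. {v, z}) ` {c} \<union> T1)"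
        using spanning_tree_add_leaf[OF T1 H0(2) A(2)] by simp
      show "H \<union> T = (\<lambda>z. {v, z}) ` ({a, b} \<union> {c}) \<union> (H2 \<union> T1)" unfolding U2 U by auto
      show "H \<inter> T = (\<lambda>z. {v, z}) ` ({a, b} \<inter> {c}) \<union> (H2 \<inter> T1)" unfolding I2 I by auto
      show "can_place A0 u w (({a, b} - {c}) \<union> {z \<in> {a, b} \<inter> {c}. \<phi> {v, z}}) (({c} - {a, b}) \<union> {z \<in> {a, b} \<inter> {c}. \<not> \<phi> {v, z}})"
      proof (cases "c = a \<or> c = b")
        case c: True
        define y where "y = (if c = a then b else a)"
        have y: "y \<in> A0" "y \<noteq> c" "{a, b} - {c} = {y}" "{a, b} \<inter> {c} = {c}" "{c} - {a, b} = {}"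
          using c ab T0 by (auto simp: y_def)
        show ?thesis using place_common(2)[OF y(1,2)] by (simp only: y Un_empty_left)
      next
        case c: False
        then have s: "{c} - {a, b} = {c}" "{a, b} - {c} = {a, b}" "{a, b} \<inter> {c} = {}" by auto
        have pos: "finite A0" "a \<in> A0" "b \<in> A0" "c \<in> A0" "c \<noteq> a" "c \<noteq> b" "a \<noteq> b"
          using fin T0 H0 c ab by auto
        \<comment> \<open>Reversing \<open>w\<close> makes \<open>a\<close> and \<open>b\<close>
          disagree, so the favourable case for three neighbours applies.\<close>
        have inj': "inj_on (\<lambda>z. - w z) A0" using inj(2) by (auto simp: inj_on_def)
        have "w a \<noteq> w b" using inj(2) pos by (auto simp: inj_on_def)
        then have "\<not> (u a < u b \<longleftrightarrow> - w a < - w b)" using colab False by auto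
        then have "can_place A0 u (\<lambda>z. - w z) {c} {a, b}"
          by (rule can_place_three(1)[OF pos inj(1) inj'])
        then have "can_place A0 u w {a, b} {c}" by (rule can_place_flip') (use pos in auto)
        then show ?thesis unfolding s by simp
      qed
    qed (use H0 T0 in auto)
  qed
  then show ?thesis by (simp only: A(1))
qed

text \<open>The degrees in both trees sum to \<open>4 * card A - 4\<close>, so some vertex has total
  degree at most 3; its degrees are (1, 1), (1, 2) or (2, 1).\<close>

lemma order_realizable_trees:
  fixes \<phi> :: "'v::finite set \<Rightarrow> bool"
  assumes "spanning_tree A H" "spanning_tree A T"
  shows "order_realizable A (H \<union> T) (H \<inter> T) \<phi>"
  using assms
proof (induction "card A" arbitrary: A H T \<phi> rule: less_induct)
  case (less A H T \<phi>)
  note H = less.prems(1) and T = less.prems(2)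
  note DH = spanning_treeD[OF H] and DT = spanning_treeD[OF T]
  show ?case
  proof (cases "card A = 1")
    case True
    then obtain a where "A = {a}" by (metis card_1_singletonE)
    moreover have "H = {}" "T = {}" using True DH(4) DT(4) by simp_all
    ultimately have "order_colouring A H T \<phi> (\<lambda>_. 0) (\<lambda>_. 0)" by (simp add: order_colouring_def)
    with H T show ?thesis by (rule order_realizableI)
  next
    case False
    have "\<exists>v\<in>A. card {e \<in> H. v \<in> e} + card {e \<in> T. v \<in> e} \<le> 3"
    proof (rule ccontr)
      assume "\<not> ?thesis"
      then have "(\<Sum>v\<in>A. 4) \<le> (\<Sum>v\<in>A. card {e \<in> H. v \<in> e} + card {e \<in> T. v \<in> e})" by (intro sum_mono) force
      also have "\<dots> = 2 * card H + 2 * card T"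
        using sum_degree[OF DH(1,2)] sum_degree[OF DT(1,2)] by (simp add: sum.distrib)
      finally show False using DH(4) DT(4) by simp
    qed
    then obtain v where v: "v \<in> A" "card {e \<in> H. v \<in> e} + card {e \<in> T. v \<in> e} \<le> 3" by blast
    have pos: "card {e \<in> H. v \<in> e} \<ge> 1" "card {e \<in> T. v \<in> e} \<ge> 1"
      using spanning_tree_degree_pos[OF H v(1) False] spanning_tree_degree_pos[OF T v(1) False] .
    have "card (A - {v}) < card A" using v(1) by (meson card_Diff1_less finite)
    note IH = less.hyps[OF this]
    consider "card {e \<in> H. v \<in> e} = 1" "card {e \<in> T. v \<in> e} = 1" | "card {e \<in> H. v \<in> e} = 1" "card {e \<in> T. v \<in> e} = 2"
      | "card {e \<in> H. v \<in> e} = 2" "card {e \<in> T. v \<in> e} = 1"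
      using v(2) pos by linarith
    then show ?thesis
    proof cases
      case 1
      obtain c where c: "{e \<in> H. v \<in> e} = {{v, c}}" using degree_one[OF DH(1) 1(1)] .
      obtain a where a: "{e \<in> T. v \<in> e} = {{v, a}}" using degree_one[OF DT(1) 1(2)] .
      show ?thesis by (rule order_realizable_two_leaves[OF H c T a v(1) IH])
    next
      case 2
      obtain c where c: "{e \<in> H. v \<in> e} = {{v, c}}" using degree_one[OF DH(1) 2(1)] .
      obtain a b where ab: "{e \<in> T. v \<in> e} = {{v, a}, {v, b}}" "a \<noteq> b" using degree_two[OF DT(1) 2(2)] .
      show ?thesis by (rule order_realizable_suppress[OF H c T ab v(1) IH])
    next
      case 3
      obtain c where c: "{e \<in> T. v \<in> e} = {{v, c}}" using degree_one[OF DT(1) 3(2)] .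
      obtain a b where ab: "{e \<in> H. v \<in> e} = {{v, a}, {v, b}}" "a \<noteq> b" using degree_two[OF DH(1) 3(1)] .
      have "order_realizable A (T \<union> H) (T \<inter> H) (\<lambda>e. \<not> \<phi> e)"
        by (rule order_realizable_suppress[OF T c H ab v(1) IH])
      then show ?thesis unfolding Un_commute[of T H] Int_commute[of T H] by (rule order_realizable_swap)
    qed
  qed
qed

lemma two_trees_order:
  fixes H T :: "'v::finite set set"
  assumes "tree_graph H" "tree_graph T" "H \<inter> T = {}"
  obtains H' T' and u w :: "'v \<Rightarrow> real" where "tree_graph H'" "tree_graph T'" "H' \<union> T' = H \<union> T" "H' \<inter> T' = {}"
    "inj u" "inj w" "\<And>a b. {a, b} \<in> H' \<Longrightarrow> (u a - u b) * (w a - w b) > 0"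
    "\<And>a b. {a, b} \<in> T' \<Longrightarrow> (u a - u b) * (w a - w b) < 0"
proof -
  have "order_realizable UNIV (H \<union> T) {} (\<lambda>_. True)"
    using order_realizable_trees[of UNIV H T] assms unfolding tree_graph_iff_spanning_tree by metis
  then obtain H' T' u w where t: "spanning_tree UNIV H'" "spanning_tree UNIV T'" "H' \<union> T' = H \<union> T" "H' \<inter> T' = {}"
    and c: "order_colouring UNIV H' T' (\<lambda>_. True) u w" by (rule order_realizableE)
  have inj: "inj u" "inj w" using c by (simp_all add: order_colouring_def)
  have ne: "u a \<noteq> u b" "w a \<noteq> w b" if "{a, b} \<in> H' \<union> T'" for a b
    using that spanning_treeD(5)[OF t(1), of a b] spanning_treeD(5)[OF t(2), of a b] inj by (auto simp: inj_def)
  have pos: "(u a - u b) * (w a - w b) > 0" if "{a, b} \<in> H'" for a b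
  proof -
    have "u a < u b \<longleftrightarrow> w a < w b" using order_colouring_edge[OF c, of a b] that t(4) by blast
    then show ?thesis using ne[of a b] that by (auto simp: zero_less_mult_iff)
  qed
  have neg: "(u a - u b) * (w a - w b) < 0" if "{a, b} \<in> T'" for a b
  proof -
    have "\<not> (u a < u b \<longleftrightarrow> w a < w b)" using order_colouring_edge[OF c, of a b] that t(4) by blast
    then show ?thesis using ne[of a b] that by (auto simp: mult_less_0_iff)
  qed
  show ?thesis
  proof (rule that)
    show "tree_graph H'" "tree_graph T'" using t by (simp_all add: tree_graph_iff_spanning_tree)
    show "H' \<union> T' = H \<union> T" "H' \<inter> T' = {}" by (rule t)+
    show "inj u" "inj w" by (rule inj)+
  qed (erule pos, erule neg)
qed

section \<open>One-dimensional base space\<close>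

context
  fixes k :: "'d::finite"
  assumes UNIV_k: "(UNIV :: 'd set) = {k}"
begin

lemma inner_line: "(x :: real ^ 'd) \<bullet> y = x $ k * y $ k"
  by (simp add: inner_vec_def UNIV_k)

lemma norm_line: "norm (x :: real ^ 'd) = \<bar>x $ k\<bar>"
  by (simp add: norm_eq_sqrt_inner inner_line)

lemma eq_line_iff: "(x :: real ^ 'd) = y \<longleftrightarrow> x $ k = y $ k"
  using UNIV_k by (auto simp: vec_eq_iff)

lemma edge_diff_nth: "edge_diff e q $ k = edge_diff e (\<chi> v. q $ v $ k)" for q :: "(real ^ 'd) ^ 'v::finite"
  by (simp add: edge_diff_def)

lemma sgn_line_nonzero: "(q :: real ^ 'd) \<noteq> 0 \<Longrightarrow> sgn q $ k \<noteq> 0"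
  by (simp add: sgn_div_norm eq_line_iff)

text \<open>On a line every row is the incidence row times \<open>1\<close> or
  \<open>- 1\<close>.\<close>

lemma dual_system_line_iff:
  fixes q :: "(real ^ 'd) ^ 'v::finite"
  assumes "\<And>e. e \<in> H \<Longrightarrow> edge_diff e q \<noteq> 0"
  shows "dual_system H (\<lambda>e x. sgn (edge_diff e q) \<bullet> edge_diff e x) \<longleftrightarrow> dual_system H (\<lambda>e (x :: real ^ 'v). edge_diff e x)"
proof
  let ?c = "\<lambda>e. sgn (edge_diff e q) $ k"
  assume "dual_system H (\<lambda>e x. sgn (edge_diff e q) \<bullet> edge_diff e x)"
  then obtain b where b: "\<And>e e'. e \<in> H \<Longrightarrow> e' \<in> H \<Longrightarrow> sgn (edge_diff e q) \<bullet> edge_diff e (b e') = (if e = e' then 1 else 0)"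
    unfolding dual_system_def by blast
  have "dual_system H (\<lambda>e (x :: real ^ 'v). ?c e * edge_diff e x)"
    unfolding dual_system_def
  proof (intro exI ballI)
    show "?c e * edge_diff e (\<chi> v. b e' $ v $ k) = (if e = e' then 1 else 0)" if "e \<in> H" "e' \<in> H" for e e'
      using b[OF that] by (simp add: inner_line edge_diff_nth)
  qed
  then have "dual_system H (\<lambda>e (x :: real ^ 'v). (1 / ?c e) * (?c e * edge_diff e x))"
    by (rule dual_system_scale) (use assms sgn_line_nonzero in \<open>auto intro: linear_mult_edge_diff\<close>)
  then show "dual_system H (\<lambda>e (x :: real ^ 'v). edge_diff e x)"
    by (rule dual_system_cong[THEN iffD1, rotated]) (use assms sgn_line_nonzero in simp)
next
  let ?c = "\<lambda>e. sgn (edge_diff e q) $ k"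
  assume "dual_system H (\<lambda>e (x :: real ^ 'v). edge_diff e x)"
  then have "dual_system H (\<lambda>e (x :: real ^ 'v). ?c e * edge_diff e x)"
    by (rule dual_system_scale) (use assms sgn_line_nonzero linear_edge_diff in auto)
  then obtain b where b: "\<And>e e'. e \<in> H \<Longrightarrow> e' \<in> H \<Longrightarrow> ?c e * edge_diff e (b e' :: real ^ 'v) = (if e = e' then 1 else 0)"
    unfolding dual_system_def by blast
  show "dual_system H (\<lambda>e x. sgn (edge_diff e q) \<bullet> edge_diff e x)"
    unfolding dual_system_def
  proof (intro exI ballI)
    show "sgn (edge_diff e q) \<bullet> edge_diff e (\<chi> v. \<chi> i. b e' $ v) = (if e = e' then 1 else 0)" if "e \<in> H" "e' \<in> H" for e e'
      using b[OF that] by (simp add: inner_line edge_diff_def)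
  qed
qed

text \<open>Euclidean motions of a line are translations, so the trivial motions are constant and
  rigidity amounts to connectedness.\<close>

lemma minimally_rigid_line_imp_tree:
  fixes H :: "'v::finite set set"
  assumes H: "simple_graph H" "minimally_rigid (norm :: real ^ 'd \<Rightarrow> real) H"
  shows "tree_graph H"
proof -
  obtain q :: "(real ^ 'd) ^ 'v" where q: "\<And>e. e \<in> H \<Longrightarrow> edge_diff e q \<noteq> 0"
    "dual_system H (\<lambda>e x. sgn (edge_diff e q) \<bullet> edge_diff e x)"
    "{x. \<forall>e\<in>H. sgn (edge_diff e q) \<bullet> edge_diff e x = 0} = trivial_motions norm q"
    using H(2) unfolding minimally_rigid_norm_iff[OF H(1)] by blast
  have "{x :: real ^ 'v. \<forall>e\<in>H. edge_diff e x = 0} = {x. \<exists>c. \<forall>v. x $ v = c}"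
  proof (intro equalityI subsetI)
    fix x :: "real ^ 'v" assume "x \<in> {x. \<forall>e\<in>H. edge_diff e x = 0}"
    then have "(\<chi> v. \<chi> i. x $ v) \<in> {x. \<forall>e\<in>H. sgn (edge_diff e q) \<bullet> edge_diff e x = 0}"
      by (simp add: inner_line edge_diff_def)
    then obtain \<eta> where \<eta>: "\<eta> \<in> euclidean_motions" "(\<chi> v. \<chi> i. x $ v) = (\<chi> v. \<eta> (q $ v))"
      unfolding q(3) trivial_motions_norm by blast
    have "\<eta> y = \<eta> z" for y z
    proof (cases "y = z")
      case False
      moreover have "(\<eta> y - \<eta> z) $ k * (y - z) $ k = 0"
        using \<eta>(1) by (simp only: euclidean_motions_def inner_line[symmetric] mem_Collect_eq)
      ultimately show ?thesis by (simp add: eq_line_iff)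
    qed simp
    moreover have "x $ v = \<eta> (q $ v) $ k" for v
      using arg_cong[OF \<eta>(2), of "\<lambda>x. x $ v $ k"] by simp
    ultimately have "x $ v = \<eta> 0 $ k" for v by metis
    then show "x \<in> {x. \<exists>c. \<forall>v. x $ v = c}" by blast
  qed (auto simp: edge_diff_def)
  then show ?thesis using dual_system_line_iff[OF q(1)] q(2) tree_graph_iff[OF H(1)] by blast
qed

lemma affinely_spanning_line:
  fixes q :: "(real ^ 'd) ^ 'v::finite"
  assumes "q $ v \<noteq> q $ v'"
  shows "affinely_spanning q"
  unfolding affinely_spanning_def
proof (intro allI impI)
  fix A :: "real ^ 'd ^ 'd" and b assume *: "\<forall>v. A *v (q $ v) + b = 0"
  have mv: "(A *v x) $ k = A $ k $ k * x $ k" for x by (simp add: matrix_vector_mult_def UNIV_k)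
  have "A $ k $ k * q $ v $ k + b $ k = 0" "A $ k $ k * q $ v' $ k + b $ k = 0"
    using arg_cong[OF *[rule_format, of v], of "\<lambda>x. x $ k"] arg_cong[OF *[rule_format, of v'], of "\<lambda>x. x $ k"]
    by (simp_all only: vector_add_component mv zero_index)
  then have "A $ k $ k * q $ v $ k = A $ k $ k * q $ v' $ k" by linarith
  then have "A $ k $ k * (q $ v $ k - q $ v' $ k) = 0" by (simp only: right_diff_distrib diff_self)
  then have "A $ k $ k = 0" using assms by (simp add: eq_line_iff)
  then have "A $ i $ j = 0" for i j using UNIV_k by (metis UNIV_I singletonD)
  then have "A = 0" by (simp add: vec_eq_iff)
  then show "A = 0 \<and> b = 0" using * by simp
qed

text \<open>In the cylindrical placement \<open>(u + w, u - w)\<close> an edge is flat iff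
  \<open>u\<close> and \<open>w\<close> agree on it; in the conical placement \<open>(u, w)\<close>
  its row is, up to sign, the sum or the difference of the two incidence rows accordingly.\<close>

lemma decomposition_imp_rigid_line:
  fixes E :: "'v::finite set set"
  assumes E: "simple_graph E" and card: "CARD('v) \<ge> 2"
    and HT: "H \<union> T = E" "H \<inter> T = {}" "minimally_rigid (norm :: real ^ 'd \<Rightarrow> real) H" "tree_graph T"
  shows "minimally_rigid (cylindrical_norm :: (real ^ 'd) \<times> real \<Rightarrow> real) E"
    "minimally_rigid (conical_norm :: (real ^ 'd) \<times> real \<Rightarrow> real) E"
proof -
  have H: "simple_graph H" using E HT(1) by (auto intro: simple_graph_subset)
  have tree: "tree_graph H" using minimally_rigid_line_imp_tree[OF H HT(3)] .
  obtain H' T' and u w :: "'v \<Rightarrow> real" where t: "tree_graph H'" "tree_graph T'" "H' \<union> T' = H \<union> T" "H' \<inter> T' = {}"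
    and inj: "inj u" "inj w" and agree: "\<And>a b. {a, b} \<in> H' \<Longrightarrow> (u a - u b) * (w a - w b) > 0"
    "\<And>a b. {a, b} \<in> T' \<Longrightarrow> (u a - u b) * (w a - w b) < 0"
    using two_trees_order[OF tree HT(4,2)] by blast
  have E': "H' \<union> T' = E" using t(3) HT(1) by simp
  have simple: "simple_graph H'" "simple_graph T'" using t(1,2) by (simp_all add: tree_graph_def)
  have st: "e = {src e, tgt e}" "src e \<noteq> tgt e" if "e \<in> E" for e
    using src_tgt[of e] E that by (simp_all add: simple_graph_def)
  define du dw where "du e = u (src e) - u (tgt e)" and "dw e = w (src e) - w (tgt e)" for e
  have pos: "du e * dw e > 0" if "e \<in> H'" for e
    using agree(1)[of "src e" "tgt e"] st(1)[of e] that E' by (auto simp: du_def dw_def)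
  have neg: "du e * dw e < 0" if "e \<in> T'" for e
    using agree(2)[of "src e" "tgt e"] st(1)[of e] that E' by (auto simp: du_def dw_def)
  have dual: "dual_system H' (\<lambda>e (x :: real ^ 'v). edge_diff e x)" "dual_system T' (\<lambda>e (x :: real ^ 'v). edge_diff e x)"
    using t(1,2) tree_graph_iff[OF simple(1)] tree_graph_iff[OF simple(2)] by blast+
  define lift :: "('v \<Rightarrow> real) \<Rightarrow> (real ^ 'd) ^ 'v" where "lift f = (\<chi> v. \<chi> i. f v)" for f
  have lift: "edge_diff e (lift f) $ k = f (src e) - f (tgt e)" for e f by (simp add: lift_def edge_diff_def)
  \<comment> \<open>One edge with distinct ends suffices for affine spanning on a line.\<close>
  have "card H' \<noteq> 0" using tree_graph_card[OF t(1)] card by linarith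
  then obtain e0 where e0: "e0 \<in> H'" by fastforce
  show "minimally_rigid (cylindrical_norm :: (real ^ 'd) \<times> real \<Rightarrow> real) E"
  proof -
    define q where "q = lift (\<lambda>v. u v + w v)"
    define s :: "real ^ 'v" where "s = (\<chi> v. u v - w v)"
    have q: "norm (edge_diff e q) = \<bar>du e + dw e\<bar>" for e
      unfolding q_def norm_line lift by (simp add: du_def dw_def)
    have s: "edge_diff e s = du e - dw e" for e by (simp add: s_def edge_diff_def du_def dw_def)
    have Hq: "\<bar>edge_diff e s\<bar> < norm (edge_diff e q)" if "e \<in> H'" for e
      using pos[OF that] unfolding q s by (auto simp: zero_less_mult_iff)
    have Tq: "norm (edge_diff e q) < \<bar>edge_diff e s\<bar>" if "e \<in> T'" for e
      using neg[OF that] unfolding q s by (auto simp: mult_less_0_iff)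
    have nz: "edge_diff e q \<noteq> 0" if "e \<in> H'" for e using Hq[OF that] by auto
    have span: "affinely_spanning q" using nz[OF e0] affinely_spanning_line[of q] by (auto simp: edge_diff_def)
    show ?thesis
      by (rule cylindrical_of_pattern[OF E E' t(4) Hq Tq dual_system_line_iff[OF nz, THEN iffD2, OF _ dual(1)] t(2) span HT])
  qed
  show "minimally_rigid (conical_norm :: (real ^ 'd) \<times> real \<Rightarrow> real) E"
  proof -
    define q where "q = lift u"
    define s :: "real ^ 'v" where "s = (\<chi> v. w v)"
    define p where "p = pairv q s"
    have fs: "fst (edge_diff e p) = edge_diff e q" "snd (edge_diff e p) = edge_diff e s" for e
      unfolding p_def by (simp_all add: edge_diff_pair[of e "pairv q s"])
    have s: "edge_diff e s = dw e" and q: "edge_diff e q $ k = du e" for e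
      unfolding q_def lift by (simp_all add: s_def edge_diff_def du_def dw_def)
    have nz: "du e \<noteq> 0" "dw e \<noteq> 0" if "e \<in> E" for e
      using st(2)[OF that] inj by (auto simp: du_def dw_def inj_def)
    have wp: "well_positioned conical_norm E p"
      using well_positioned_conical(1)[OF E, of p] nz by (simp add: fs s eq_line_iff q)
    define f where "f e x = (sgn (fst (edge_diff e p)), sgn (snd (edge_diff e p))) \<bullet> edge_diff e x"
      for e and x :: "((real ^ 'd) \<times> real) ^ 'v"
    have rd: "rigidity_differential conical_norm E p = functional_map E f"
      unfolding well_positioned_conical(2)[OF E wp] f_def[abs_def] ..
    have linf: "linear (f e)" for e unfolding f_def[abs_def] by (rule linear_inner_edge_diff)
    have f: "f e x = sgn (du e) * edge_diff e (fstv x) $ k + sgn (dw e) * edge_diff e (sndv x)" for e x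
      unfolding f_def fs edge_diff_pair[of e x] inner_prod_def by (simp add: inner_line s q sgn_div_norm norm_line sgn_if)
    obtain bH where bH: "\<And>e e'. e \<in> H' \<Longrightarrow> e' \<in> H' \<Longrightarrow> edge_diff e (bH e' :: real ^ 'v) = (if e = e' then 1 else 0)"
      using dual(1) unfolding dual_system_def by blast
    obtain bT where bT: "\<And>e e'. e \<in> T' \<Longrightarrow> e' \<in> T' \<Longrightarrow> edge_diff e (bT e' :: real ^ 'v) = (if e = e' then 1 else 0)"
      using dual(2) unfolding dual_system_def by blast
    \<comment> \<open>Up to sign the row is the sum of the base and the vertical incidence row on
      \<open>H'\<close>, and their difference on \<open>T'\<close>. The dual vectors are halved
      copies of those of the trees, on the diagonal and on the antidiagonal, where the rows of the
      other kind vanish.\<close>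
    define b where "b e = (if e \<in> H' then pairv (lift (\<lambda>v. sgn (du e) / 2 * bH e $ v)) ((sgn (dw e) / 2) *\<^sub>R bH e)
        else pairv (lift (\<lambda>v. sgn (du e) / 2 * bT e $ v)) ((sgn (dw e) / 2) *\<^sub>R bT e))" for e
    have signs: "sgn (dw e) = sgn (du e)" "sgn (du e) * sgn (du e) = 1" if "e \<in> H'" for e
      using pos[OF that] by (auto simp: zero_less_mult_iff)
    have signs': "sgn (dw e) = - sgn (du e)" "sgn (du e) * sgn (du e) = 1" if "e \<in> T'" for e
      using neg[OF that] by (auto simp: mult_less_0_iff)
    have liftm: "edge_diff e (lift (\<lambda>v. c * x $ v)) $ k = c * edge_diff e x" for e c and x :: "real ^ 'v"
      unfolding lift by (simp add: edge_diff_def algebra_simps)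
    have sc: "edge_diff e (c *\<^sub>R x) = c * edge_diff e x" for e c and x :: "real ^ 'v"
      using linear_scale[OF linear_edge_diff, of e c x] by simp
    have "f e (b e') = (if e = e' then 1 else 0)" if "e \<in> E" "e' \<in> E" for e e'
    proof -
      have f': "f e (b e') = (sgn (du e) * sgn (du e') + sgn (dw e) * sgn (dw e')) / 2 *
          edge_diff e (if e' \<in> H' then bH e' else bT e')"
        unfolding f b_def
        by (cases "e' \<in> H'") (simp_all only: if_True if_False fstv_pairv sndv_pairv liftm sc, simp_all add: field_simps)
      have HT1: "e \<in> H' \<or> e \<in> T'" "e' \<in> H' \<or> e' \<in> T'" using that unfolding E'[symmetric] by auto
      have HT2: "e' \<in> T' \<longrightarrow> e' \<notin> H'" using t(4) by blast
      consider "e \<in> H'" "e' \<in> H'" | "e \<in> T'" "e' \<in> T'" "e' \<notin> H'"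
        | "e \<in> H'" "e' \<in> T'" | "e \<in> T'" "e' \<in> H'" using HT1 HT2 by blast
      then show ?thesis
      proof cases
        case 1
        then have eq: "edge_diff e (if e' \<in> H' then bH e' else bT e') = (if e = e' then 1 else 0)"
          by (simp only: if_True bH)
        show ?thesis unfolding f' eq signs(1)[OF 1(1)] signs(1)[OF 1(2)]
          using signs(2)[OF 1(1)] by (cases "e = e'") simp_all
      next
        case 2
        then have eq: "edge_diff e (if e' \<in> H' then bH e' else bT e') = (if e = e' then 1 else 0)"
          by (simp only: if_False bT)
        show ?thesis unfolding f' eq signs'(1)[OF 2(1)] signs'(1)[OF 2(2)]
          using signs'(2)[OF 2(1)] by (cases "e = e'") simp_all
      next
        case 3
        then have "e \<noteq> e'" using t(4) by blast
        then show ?thesis unfolding f' using signs(1)[OF 3(1)] signs'(1)[OF 3(2)] by simp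
      next
        case 4
        then have "e \<noteq> e'" using t(4) by blast
        then show ?thesis unfolding f' using signs'(1)[OF 4(1)] signs(1)[OF 4(2)] by simp
      qed
    qed
    then have dualf: "dual_system E f" unfolding dual_system_def by blast
    have "q $ src e0 \<noteq> q $ tgt e0"
      using q[of e0] nz(1)[of e0] e0 E' by (auto simp: edge_diff_def)
    then have span: "affinely_spanning (fstv p)" using affinely_spanning_line by (simp add: p_def)
    show ?thesis
      by (rule minimally_rigid_of_dual_system[OF wp rd linf dualf infinitesimal_motions_conical span HT(1,2) H HT(3,4)])
  qed
qed

end

section \<open>The characterisation\<close>

theorem theorem5p9:
  fixes E :: "'v::finite set set"
  assumes "simple_graph E"
    and "CARD('v) \<ge> CARD('d::finite) + 1"
  shows "(minimally_rigid (conical_norm :: (real ^ 'd) \<times> real \<Rightarrow> real) E \<longleftrightarrow>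
          minimally_rigid (cylindrical_norm :: (real ^ 'd) \<times> real \<Rightarrow> real) E) \<and>
         (minimally_rigid (cylindrical_norm :: (real ^ 'd) \<times> real \<Rightarrow> real) E \<longleftrightarrow>
          (\<exists>H T. H \<union> T = E \<and> H \<inter> T = {} \<and>
             minimally_rigid (norm :: real ^ 'd \<Rightarrow> real) H \<and> tree_graph T))"
proof -
  have backward: "minimally_rigid (conical_norm :: (real ^ 'd) \<times> real \<Rightarrow> real) E \<and>
      minimally_rigid (cylindrical_norm :: (real ^ 'd) \<times> real \<Rightarrow> real) E"
    if HT: "H \<union> T = E" "H \<inter> T = {}" "minimally_rigid (norm :: real ^ 'd \<Rightarrow> real) H" "tree_graph T" for H T
  proof -
    show ?thesis
    proof (cases "CARD('d) \<ge> 2")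
      case True
      show ?thesis
        using decomposition_imp_conical_ge_2[OF assms True HT] decomposition_imp_cylindrical_ge_2[OF assms True HT] ..
    next
      case False
      moreover have "CARD('d) > 0" by simp
      ultimately have "CARD('d) = 1" by linarith
      then obtain k :: 'd where k: "UNIV = {k}" by (metis card_1_singletonE)
      have "CARD('v) \<ge> 2" using assms(2) \<open>CARD('d) = 1\<close> by simp
      then show ?thesis
        using decomposition_imp_rigid_line[OF k assms(1) _ HT] by blast
    qed
  qed
  show ?thesis
  proof (intro conjI iffI)
    assume "minimally_rigid (conical_norm :: (real ^ 'd) \<times> real \<Rightarrow> real) E"
    from conical_imp_decomposition[OF assms(1) this]
    show "minimally_rigid (cylindrical_norm :: (real ^ 'd) \<times> real \<Rightarrow> real) E"
      by (elim exE conjE) (rule backward[THEN conjunct2])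
  next
    assume "minimally_rigid (cylindrical_norm :: (real ^ 'd) \<times> real \<Rightarrow> real) E"
    note D = cylindrical_imp_decomposition[OF assms(1) this]
    from D show "minimally_rigid (conical_norm :: (real ^ 'd) \<times> real \<Rightarrow> real) E"
      by (elim exE conjE) (rule backward[THEN conjunct1])
    show "\<exists>H T. H \<union> T = E \<and> H \<inter> T = {} \<and> minimally_rigid (norm :: real ^ 'd \<Rightarrow> real) H \<and> tree_graph T"
      by (rule D)
  next
    assume "\<exists>H T. H \<union> T = E \<and> H \<inter> T = {} \<and> minimally_rigid (norm :: real ^ 'd \<Rightarrow> real) H \<and> tree_graph T"
    then show "minimally_rigid (cylindrical_norm :: (real ^ 'd) \<times> real \<Rightarrow> real) E"
      by (elim exE conjE) (rule backward[THEN conjunct2])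
  qed
qed

end
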